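(* Let $d\ge n$. If $H$ is a reductive (not necessarily connected) subgroup of $GL_n$, then ${}^Hk[M_{n,d}]$ is contained in the $p$-root closure of $GL_d*j({}^Hk[M_{n,n}])$. If $H$ is a reductive subgroup of $SL_n$, then ${}^Hk[M_{n,d}]$ is the $p$-root closure of $GL_d*j({}^Hk[M_{n,n}])$ in its quotient field.
   Context: $k$ is an algebraically closed field of characteristic $p\ge 0$; $GL_m=GL_m(k)$, $SL_n=SL_n(k)$; $M_{n,d}$ is the space of $n\times d$ matrices over $k$, with $d\ge n$, and $x=(x_1,\dots,x_d)\in M_{n,d}$ has $i$th column $x_i$. $H\subset GL_n$ acts on $k[M_{n,d}]$ by $(hF)(x)=F(h^{-1}x)$, with algebra of invariants ${}^Hk[M_{n,d}]$. $GL_d$ acts on $k[M_{n,d}]$ by $(g*F)(x)=F(xg)$. The map $j:k[M_{n,n}]\to k[M_{n,d}]$ is $(jF)(x_1,\dots,x_d)=F(x_1,\dots,x_n)$. $GL_d*j({}^Hk[M_{n,n}])$ is the $k$-algebra generated by all $g*jf$ with $g\in GL_d$, $f\in{}^Hk[M_{n,n}]$. For $k$-algebras $R\subset S$: if $p>0$, $S$ is contained in the $p$-root closure of $R$ if for every $s\in S$ there is an integer $m\ge 0$ with $s^{p^m}\in R$; if $p=0$, this means $R=S$. For a domain $R$ with quotient field $K$, the $p$-root closure of $R$ in $K$ is $\{s\in K: s^{p^m}\in R\text{ for some }m\ge 0\}$ if $p>0$, and $R$ if $p=0$. *)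

theory Defs
  imports
    "HOL-Analysis.Analysis"
    "HOL-Computational_Algebra.Polynomial_Factorial"
    "HOL-Algebra.Coset"
begin

section \<open>The coordinate ring of the space of matrices\<close>

text \<open>
  An \<open>n \<times> d\<close> matrix over \<open>k\<close> is an element of \<^typ>\<open>'k^'d^'n\<close> with \<open>n = CARD('n)\<close> and
  \<open>d = CARD('d)\<close>; the entry in row \<open>i\<close> and column \<open>c\<close> is \<open>x $ i $ c\<close>. Over an infinite field the
  polynomial ring \<open>k[M\<^sub>n\<^sub>,\<^sub>d]\<close> is the ring of polynomial functions, which is the description used
  here.
\<close>

inductive_set poly_functions :: "('k::comm_ring_1^'d::finite^'n::finite \<Rightarrow> 'k) set" where
  const: "(\<lambda>x. a) \<in> poly_functions"
| coord: "(\<lambda>x. x $ i $ c) \<in> poly_functions"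
| add: "F \<in> poly_functions \<Longrightarrow> G \<in> poly_functions \<Longrightarrow> (\<lambda>x. F x + G x) \<in> poly_functions"
| mult: "F \<in> poly_functions \<Longrightarrow> G \<in> poly_functions \<Longrightarrow> (\<lambda>x. F x * G x) \<in> poly_functions"

typedef (overloaded) ('k, 'n, 'd) mat_poly =
  "poly_functions :: ('k::comm_ring_1^'d::finite^'n::finite \<Rightarrow> 'k) set"
  morphisms value_at Abs_mat_poly
  using poly_functions.const by blast

setup_lifting type_definition_mat_poly

lemma poly_functions_sum:
  "(\<And>i. i \<in> I \<Longrightarrow> f i \<in> poly_functions) \<Longrightarrow> (\<lambda>x. \<Sum>i\<in>I. f i x) \<in> poly_functions"
  by (induction I rule: infinite_finite_induct)
     (simp_all add: poly_functions.const poly_functions.add)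

lemma poly_functions_compose:
  assumes "F \<in> poly_functions" and "\<And>i c. (\<lambda>x. \<phi> x $ i $ c) \<in> poly_functions"
  shows "(\<lambda>x. F (\<phi> x)) \<in> poly_functions"
  using assms
proof (induction rule: poly_functions.induct)
  case (const a)
  show ?case by (rule poly_functions.const)
next
  case (coord i c)
  show ?case by fact
next
  case (add F G)
  then show ?case by (intro poly_functions.add) auto
next
  case (mult F G)
  then show ?case by (intro poly_functions.mult) auto
qed

lemma poly_functions_matrix_mult_left:
  "(\<lambda>x :: 'k::comm_ring_1^'d::finite^'n::finite. (h ** x) $ i $ c) \<in> poly_functions"
proof -
  have "(\<lambda>x :: 'k^'d^'n. \<Sum>l\<in>UNIV. h $ i $ l * x $ l $ c) \<in> poly_functions"
    by (intro poly_functions_sum poly_functions.mult poly_functions.const poly_functions.coord)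
  then show ?thesis by (simp add: matrix_matrix_mult_def)
qed

lemma poly_functions_matrix_mult_right:
  "(\<lambda>x :: 'k::comm_ring_1^'d::finite^'n::finite. (x ** g) $ i $ c) \<in> poly_functions"
proof -
  have "(\<lambda>x :: 'k^'d^'n. \<Sum>l\<in>UNIV. x $ i $ l * g $ l $ c) \<in> poly_functions"
    by (intro poly_functions_sum poly_functions.mult poly_functions.const poly_functions.coord)
  then show ?thesis by (simp add: matrix_matrix_mult_def)
qed

instantiation mat_poly :: (comm_ring_1, finite, finite) comm_ring_1
begin

lift_definition zero_mat_poly :: "('a, 'b, 'c) mat_poly" is "\<lambda>x. 0"
  by (rule poly_functions.const)

lift_definition one_mat_poly :: "('a, 'b, 'c) mat_poly" is "\<lambda>x. 1"
  by (rule poly_functions.const)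

lift_definition plus_mat_poly ::
    "('a, 'b, 'c) mat_poly \<Rightarrow> ('a, 'b, 'c) mat_poly \<Rightarrow> ('a, 'b, 'c) mat_poly"
  is "\<lambda>F G x. F x + G x"
  by (rule poly_functions.add)

lift_definition times_mat_poly ::
    "('a, 'b, 'c) mat_poly \<Rightarrow> ('a, 'b, 'c) mat_poly \<Rightarrow> ('a, 'b, 'c) mat_poly"
  is "\<lambda>F G x. F x * G x"
  by (rule poly_functions.mult)

lift_definition uminus_mat_poly :: "('a, 'b, 'c) mat_poly \<Rightarrow> ('a, 'b, 'c) mat_poly"
  is "\<lambda>F x. - F x"
proof -
  fix F :: "'a^'c^'b \<Rightarrow> 'a" assume "F \<in> poly_functions"
  then have "(\<lambda>x. (- 1) * F x) \<in> poly_functions"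
    by (intro poly_functions.mult poly_functions.const)
  then show "(\<lambda>x. - F x) \<in> poly_functions" by simp
qed

lift_definition minus_mat_poly ::
    "('a, 'b, 'c) mat_poly \<Rightarrow> ('a, 'b, 'c) mat_poly \<Rightarrow> ('a, 'b, 'c) mat_poly"
  is "\<lambda>F G x. F x - G x"
proof -
  fix F G :: "'a^'c^'b \<Rightarrow> 'a" assume "F \<in> poly_functions" "G \<in> poly_functions"
  then have "(\<lambda>x. F x + (- 1) * G x) \<in> poly_functions"
    by (intro poly_functions.add poly_functions.mult poly_functions.const)
  then show "(\<lambda>x. F x - G x) \<in> poly_functions" by simp
qed

instance
proof
  fix F G K :: "('a, 'b, 'c) mat_poly"
  show "F * G * K = F * (G * K)" by transfer (simp add: mult.assoc)
  show "F * G = G * F" by transfer (simp add: mult.commute)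
  show "1 * F = F" by transfer simp
  show "F + G + K = F + (G + K)" by transfer (simp add: add.assoc)
  show "F + G = G + F" by transfer (simp add: add.commute)
  show "0 + F = F" by transfer simp
  show "- F + F = 0" by transfer simp
  show "F - G = F + - G" by transfer simp
  show "(F + G) * K = F * K + G * K" by transfer (simp add: distrib_right)
  show "(0 :: ('a, 'b, 'c) mat_poly) \<noteq> 1" by transfer (simp add: fun_eq_iff)
qed

end

lemma infinite_alg_closed_field: "infinite (UNIV :: 'a::alg_closed_field set)"
proof
  assume fin: "finite (UNIV :: 'a set)"
  define p :: "'a poly" where "p = 1 + (\<Prod>a\<in>UNIV. [:- a, 1:])"
  have deg: "degree (\<Prod>a\<in>(UNIV::'a set). [:- a, 1:]) = card (UNIV :: 'a set)"
    by (subst degree_prod_eq_sum_degree) auto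
  have "card (UNIV :: 'a set) > 0"
    using fin by (simp add: finite_UNIV_card_ge_0)
  then have "degree p > 0"
    unfolding p_def by (subst degree_add_eq_right) (auto simp: deg)
  then obtain z where "poly p z = 0"
    using alg_closed_imp_poly_has_root by blast
  moreover have "poly p z = 1"
    using fin by (simp add: p_def poly_prod)
  ultimately show False by simp
qed

lemma poly_function_on_line:
  assumes "F \<in> poly_functions"
  shows "\<exists>p. \<forall>t. F (\<chi> i c. x $ i $ c + t * y $ i $ c) = poly p t"
  using assms
proof (induction rule: poly_functions.induct)
  case (const a)
  show ?case by (rule exI[of _ "[:a:]"]) simp
next
  case (coord i c)
  show ?case by (rule exI[of _ "[:x $ i $ c, y $ i $ c:]"]) simp
next
  case (add F G)
  then show ?case by (metis poly_add)
next
  case (mult F G)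
  then show ?case by (metis poly_mult)
qed

instance mat_poly :: (alg_closed_field, finite, finite) idom
proof
  fix P Q :: "('a, 'b, 'c) mat_poly"
  assume "P \<noteq> 0" "Q \<noteq> 0"
  then show "P * Q \<noteq> 0"
  proof transfer
    fix F G :: "'a^'c^'b \<Rightarrow> 'a"
    assume F: "F \<in> poly_functions" "F \<noteq> (\<lambda>x. 0)" and G: "G \<in> poly_functions" "G \<noteq> (\<lambda>x. 0)"
    from F(2) G(2) obtain u v where u: "F u \<noteq> 0" and v: "G v \<noteq> 0" by (auto simp: fun_eq_iff)
    let ?l = "\<lambda>t. \<chi> i c. u $ i $ c + t * (v - u) $ i $ c"
    obtain p where p: "\<And>t. F (?l t) = poly p t" using poly_function_on_line[OF F(1)] by blast
    obtain q where q: "\<And>t. G (?l t) = poly q t" using poly_function_on_line[OF G(1)] by blast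
    have "?l 0 = u" "?l 1 = v" by (simp_all add: vec_eq_iff)
    with u v p[of 0] q[of 1] have "p \<noteq> 0" "q \<noteq> 0" by auto
    then have "finite {t. poly (p * q) t = 0}" by (intro poly_roots_finite) simp
    then obtain t where "poly (p * q) t \<noteq> 0"
      using infinite_alg_closed_field[where 'a = 'a] by (metis (mono_tags) UNIV_eq_I mem_Collect_eq)
    then have "F (?l t) * G (?l t) \<noteq> 0" unfolding p q by simp
    then show "(\<lambda>x. F x * G x) \<noteq> (\<lambda>x. 0)" by (rule contrapos_nn) (drule fun_cong)
  qed
qed

lift_definition const_poly :: "'k::comm_ring_1 \<Rightarrow> ('k, 'n::finite, 'd::finite) mat_poly"
  is "\<lambda>a x. a"
  by (rule poly_functions.const)

definition subalgebra :: "('k::comm_ring_1, 'n::finite, 'd::finite) mat_poly set \<Rightarrow> bool" where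
  "subalgebra A \<longleftrightarrow>
    range const_poly \<subseteq> A \<and> (\<forall>F\<in>A. \<forall>G\<in>A. F + G \<in> A) \<and> (\<forall>F\<in>A. \<forall>G\<in>A. F * G \<in> A)"


section \<open>Reductive subgroups of the general linear group\<close>

definition GL :: "('k::field^'n::finite^'n) monoid" where
  "GL = \<lparr>carrier = {g. invertible g}, mult = (**), one = mat 1\<rparr>"

definition SL :: "('k::field^'n::finite^'n) set" where
  "SL = {g. det g = 1}"

definition zero_locus :: "('k::comm_ring_1, 'n::finite, 'd::finite) mat_poly set \<Rightarrow> ('k^'d^'n) set" where
  "zero_locus S = {x. \<forall>F\<in>S. value_at F x = 0}"

definition zariski :: "('k::field^'d::finite^'n::finite) topology" where
  "zariski = topology (\<lambda>U. \<exists>S. - U = zero_locus S)"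

lemma istopology_zariski:
  "istopology (\<lambda>U :: ('k::field^'d::finite^'n::finite) set. \<exists>S. - U = zero_locus S)"
  unfolding istopology_def
proof (intro conjI allI impI)
  fix U V :: "('k^'d^'n) set"
  assume "\<exists>S. - U = zero_locus S" "\<exists>S. - V = zero_locus S"
  then obtain S T where ST: "- U = zero_locus S" "- V = zero_locus T" by blast
  have "- (U \<inter> V) = zero_locus {F * G | F G. F \<in> S \<and> G \<in> T}"
    unfolding Compl_Int ST by (fastforce simp: zero_locus_def times_mat_poly.rep_eq)
  then show "\<exists>S. - (U \<inter> V) = zero_locus S" by blast
next
  fix \<K> :: "('k^'d^'n) set set"
  assume "\<forall>U\<in>\<K>. \<exists>S. - U = zero_locus S"
  then obtain S where S: "\<And>U. U \<in> \<K> \<Longrightarrow> - U = zero_locus (S U)" by metis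
  have "- \<Union>\<K> = (\<Inter>U\<in>\<K>. - U)" by blast
  also have "\<dots> = zero_locus (\<Union>U\<in>\<K>. S U)" using S by (auto simp: zero_locus_def)
  finally show "\<exists>S. - \<Union>\<K> = zero_locus S" by blast
qed

lemma openin_zariski: "openin zariski U \<longleftrightarrow> (\<exists>S. - U = zero_locus S)"
  unfolding zariski_def topology_inverse'[OF istopology_zariski] ..

lemma topspace_zariski: "topspace zariski = UNIV"
proof -
  have "- UNIV = zero_locus {1}" by (auto simp: zero_locus_def one_mat_poly.rep_eq)
  then have "openin zariski UNIV" unfolding openin_zariski by blast
  then show ?thesis by (metis openin_subset top.extremum_uniqueI)
qed

lemma closedin_zariski: "closedin zariski Z \<longleftrightarrow> (\<exists>S. Z = zero_locus S)"
  by (simp add: closedin_def openin_zariski topspace_zariski Compl_eq_Diff_UNIV[symmetric])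

definition closed_subgroup :: "('k::field^'n::finite^'n) set \<Rightarrow> bool" where
  "closed_subgroup H \<longleftrightarrow> subgroup H GL \<and> closedin (subtopology zariski (carrier GL)) H"

definition unipotent :: "'k::field^'n::finite^'n \<Rightarrow> bool" where
  "unipotent u \<longleftrightarrow> (\<exists>m. (((**) (u - mat 1)) ^^ m) (mat 1) = 0)"

text \<open>
  The closed connected normal unipotent subgroups of a linear algebraic group have a largest
  element, which is therefore their union.
\<close>

definition unipotent_radical :: "('k::field^'n::finite^'n) set \<Rightarrow> ('k^'n^'n) set" where
  "unipotent_radical H = \<Union>{U. U \<lhd> GL\<lparr>carrier := H\<rparr> \<and> closed_subgroup U \<and>
     connectedin zariski U \<and> (\<forall>u\<in>U. unipotent u)}"

definition reductive :: "('k::field^'n::finite^'n) set \<Rightarrow> bool" where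
  "reductive H \<longleftrightarrow> closed_subgroup H \<and> unipotent_radical H = {mat 1}"


section \<open>Invariants and polarization\<close>

lift_definition left_act ::
    "'k::field^'n::finite^'n \<Rightarrow> ('k, 'n, 'd::finite) mat_poly \<Rightarrow> ('k, 'n, 'd) mat_poly"
  is "\<lambda>h F x. F (matrix_inv h ** x)"
  by (rule poly_functions_compose) (simp_all add: poly_functions_matrix_mult_left)

lift_definition right_act ::
    "'k::field^'d::finite^'d \<Rightarrow> ('k, 'n::finite, 'd) mat_poly \<Rightarrow> ('k, 'n, 'd) mat_poly"
  is "\<lambda>g F x. F (x ** g)"
  by (rule poly_functions_compose) (simp_all add: poly_functions_matrix_mult_right)

definition invariants ::
    "('k::field^'n::finite^'n) set \<Rightarrow> ('k, 'n, 'd::finite) mat_poly set" where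
  "invariants H = {F. \<forall>h\<in>H. left_act h F = F}"

text \<open>
  The index types carry no order, so an injection \<open>\<sigma>\<close> says which columns of an \<open>n \<times> d\<close> matrix are
  the first \<open>n\<close> ones; an injection exists iff \<open>n \<le> d\<close>.
\<close>

lift_definition first_cols ::
    "('n \<Rightarrow> 'd) \<Rightarrow> ('k::field, 'n::finite, 'n) mat_poly \<Rightarrow> ('k, 'n, 'd::finite) mat_poly"
  is "\<lambda>\<sigma> F x. F (\<chi> i c. x $ i $ \<sigma> c)"
  by (rule poly_functions_compose) (simp_all add: poly_functions.coord)

definition polarized_algebra ::
    "('n \<Rightarrow> 'd) \<Rightarrow> ('k::field, 'n::finite, 'n) mat_poly set \<Rightarrow> ('k, 'n, 'd::finite) mat_poly set" where
  "polarized_algebra \<sigma> A =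
     subalgebra hull {right_act g (first_cols \<sigma> f) | g f. g \<in> carrier GL \<and> f \<in> A}"


section \<open>Root closures\<close>

definition contained_in_root_closure :: "nat \<Rightarrow> 'a::comm_ring_1 set \<Rightarrow> 'a set \<Rightarrow> bool" where
  "contained_in_root_closure p S R \<longleftrightarrow>
     R \<subseteq> S \<and> (if p = 0 then R = S else \<forall>s\<in>S. \<exists>m. s ^ (p ^ m) \<in> R)"

definition quotient_field :: "'a::idom set \<Rightarrow> 'a fract set" where
  "quotient_field R = {Fraction_Field.Fract a b | a b. a \<in> R \<and> b \<in> R \<and> b \<noteq> 0}"

text \<open>The quotient field of \<open>R\<close>, and the closure in it, are formed inside that of the ambient domain.\<close>

definition root_closure_in_quotient_field :: "nat \<Rightarrow> 'a::idom set \<Rightarrow> 'a fract set" where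
  "root_closure_in_quotient_field p R =
     (if p = 0 then to_fract ` R
      else {s \<in> quotient_field R. \<exists>m. s ^ (p ^ m) \<in> to_fract ` R})"

end

theory Submission
  imports Defs
begin

text \<open>
  The invariants \<open>S\<close> in \<open>k[M\<^sub>n\<^sub>,\<^sub>d]\<close> are stable under \<open>F \<mapsto> F(x g)\<close>, and the polarized algebra \<open>R\<close>
  contains \<open>F(x c)\<close> for \<open>F \<in> S\<close> and every \<open>d \<times> d\<close> matrix \<open>c\<close> of rank at most \<open>n\<close>. Hence the group plays no
  further role, and \<open>F\<close> has to be recovered from the functions \<open>F(x c)\<close> with \<open>c\<close> of rank at most \<open>n\<close>.

  In characteristic zero, \<open>F(x)\<close> is a rational linear combination of such \<open>F(x c)\<close>: if a symmetric tensor
  is orthogonal to all powers of matrices of rank at most \<open>n\<close>, the polynomials of the generic matrix do not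
  see it, so the power of the identity matrix may be replaced by its orthogonal projection.

  In characteristic \<open>p\<close>, the columns are removed one at a time. More than \<open>n\<close> columns of the generic matrix
  \<open>x\<close> satisfy a relation \<open>x v = 0\<close>, and wherever \<open>v\<^sub>i\<close> is invertible, \<open>F(x) = F(x c)\<close> with
  \<open>c = 1 - v e\<^sub>i / v\<^sub>i\<close> singular. So \<open>F\<close> is a function on the blow-up of \<open>R\<close> along \<open>v\<close>. Two points \<open>v\<close> and
  \<open>w\<close> of this blow-up over the same point of \<open>R\<close> give \<open>F\<close> the same value, because the projections
  killing \<open>v\<close> and \<open>w\<close> can be chosen to commute, and both values then equal the value at their product.
  A function with this property has a \<open>p\<close>-power in \<open>R\<close>: a subring that is closed under \<open>p\<close>-th roots and
  maximal among those without \<open>F\<close> is local, and modulo its maximal ideal a power of \<open>F\<close> acts as a scalar on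
  the module spanned by the monomials in \<open>v\<close>.
\<close>

section \<open>Monomials and coefficients\<close>

text \<open>The blow-up enters only through its graded pieces of large degree, the spans of the
  monomials of degree N in v. On such a piece s acts, but need not be a scalar modulo the maximal
  ideal; the task is to show that some power of s is one. The projections that kill two points
  compare the values of s only off the diagonal: they give (s \<otimes> 1 - 1 \<otimes> s) m^q = 0
  for the minors m = V_i W_j - V_j W_i. Across the diagonal the chart formula itself has to be
  expanded in both factors, which makes t \<otimes> 1 - 1 \<otimes> t square to zero for t = s^q.
  The degree q is a power of p so that m^q has just the two terms V_i^q W_j^q and V_j^q W_i^q. For H
  inside SL two facts are added. The determinant is invariant, so Cramer's rule writes the generic
  matrix as its first n columns times a matrix over the fractions of R; this puts every invariant
  into the quotient field. Conversely, the polynomial ring contains every p-power root of its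
  elements in its fraction field, and a quotient of invariants is invariant.\<close>

definition mon_at :: "('v \<Rightarrow> 'a::comm_monoid_mult) \<Rightarrow> 'v multiset \<Rightarrow> 'a" where
  "mon_at V I = (\<Prod>i\<in>#I. V i)"

lemma mon_empty [simp]: "mon_at V {#} = 1"
  and mon_add_mset [simp]: "mon_at V (add_mset i I) = V i * mon_at V I"
  and mon_union [simp]: "mon_at V (I + J) = mon_at V I * mon_at V J"
  and mon_replicate_mset [simp]: "mon_at V (replicate_mset n i) = V i ^ n"
  by (simp_all add: mon_at_def)

lemma mon_scale: "mon_at (\<lambda>i. c * V i) I = c ^ size I * mon_at V I"
  by (induction I) (simp_all add: ac_simps)

lemma mon_hom:
  assumes "f 1 = 1" "\<And>a b. f (a * b) = f a * f b"
  shows "mon_at (\<lambda>i. f (V i)) I = f (mon_at V I)"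
  by (induction I) (simp_all add: assms)

lemma mon_repeat_mset [simp]: "mon_at V (repeat_mset n I) = mon_at V I ^ n"
  by (induction n) simp_all

lemma finite_multisets_size [simp]: "finite {I :: 'v::finite multiset. size I = D}"
  using finite_multisets_of_size[of "UNIV :: 'v set" D] by (simp add: multisets_of_size_def)

text \<open>Pigeonhole. In high degree every monomial thus contains a large power of a single
  variable, to which the chart equation of that variable applies.\<close>

lemma ex_large_count:
  fixes I :: "'v::finite multiset"
  assumes "size I \<ge> CARD('v) * n" "n > 0"
  shows "\<exists>i. count I i \<ge> n"
proof (rule ccontr)
  assume "\<not> ?thesis"
  then have less: "count I i < n" for i by (auto simp: not_le)
  have "size I = (\<Sum>i\<in>UNIV. count I i)"
    unfolding size_multiset_overloaded_eq
    by (rule sum.mono_neutral_left) (auto simp: not_in_iff)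
  also have "\<dots> < (\<Sum>i\<in>(UNIV::'v set). n)"
    by (intro sum_strict_mono less) auto
  finally show False using assms by simp
qed

lemma replicate_mset_split:
  assumes "count I i \<ge> n"
  obtains J where "I = J + replicate_mset n i"
  using assms by (metis count_le_replicate_mset_subset_eq subset_mset.diff_add)

section \<open>Subrings, and polynomial functions with prescribed monomials\<close>

definition unital_subring :: "'a::comm_ring_1 set \<Rightarrow> bool" where
  "unital_subring R \<longleftrightarrow> 1 \<in> R \<and> (\<forall>a\<in>R. \<forall>b\<in>R. a - b \<in> R) \<and> (\<forall>a\<in>R. \<forall>b\<in>R. a * b \<in> R)"

lemma unital_subringD:
  assumes "unital_subring R"
  shows subring_1: "1 \<in> R" and subring_0: "0 \<in> R"
    and subring_diff: "a \<in> R \<Longrightarrow> b \<in> R \<Longrightarrow> a - b \<in> R"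
    and subring_mult: "a \<in> R \<Longrightarrow> b \<in> R \<Longrightarrow> a * b \<in> R"
    and subring_uminus: "a \<in> R \<Longrightarrow> - a \<in> R"
    and subring_add: "a \<in> R \<Longrightarrow> b \<in> R \<Longrightarrow> a + b \<in> R"
proof -
  note A = assms[unfolded unital_subring_def]
  show 1: "1 \<in> R" using A by blast
  then have "1 - 1 \<in> R" using A by blast
  then show 0: "0 \<in> R" by simp
  show "a \<in> R \<Longrightarrow> b \<in> R \<Longrightarrow> a - b \<in> R" "a \<in> R \<Longrightarrow> b \<in> R \<Longrightarrow> a * b \<in> R" for a b
    using A by blast+
  have neg: "- a \<in> R" if "a \<in> R" for a
  proof -
    have "0 - a \<in> R" using A 0 that by blast
    then show ?thesis by simp
  qed
  then show "a \<in> R \<Longrightarrow> - a \<in> R" .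
  show "a + b \<in> R" if "a \<in> R" "b \<in> R" for a b
  proof -
    have "a - (- b) \<in> R" using A neg that by blast
    then show ?thesis by simp
  qed
qed

lemma subring_sum: "unital_subring R \<Longrightarrow> (\<And>i. i \<in> T \<Longrightarrow> f i \<in> R) \<Longrightarrow> (\<Sum>i\<in>T. f i) \<in> R"
  by (induction T rule: infinite_finite_induct) (auto intro: unital_subringD)

lemma subring_power: "unital_subring R \<Longrightarrow> a \<in> R \<Longrightarrow> a ^ n \<in> R"
  by (induction n) (auto intro: unital_subringD)

lemma subring_mon: "unital_subring R \<Longrightarrow> (\<And>i. V i \<in> R) \<Longrightarrow> mon_at V I \<in> R"
  by (induction I) (auto intro: unital_subringD)

definition polys :: "'v multiset set \<Rightarrow> (('v \<Rightarrow> 'a::comm_ring_1) \<Rightarrow> 'a) set" where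
  "polys E = {P. \<exists>c. \<forall>V. P V = (\<Sum>I\<in>E. c I * mon_at V I)}"

lemma polysI: "(\<And>V. P V = (\<Sum>I\<in>E. c I * mon_at V I)) \<Longrightarrow> P \<in> polys E"
  unfolding polys_def by blast

lemma polysD: "P \<in> polys E \<Longrightarrow> \<exists>c. \<forall>V. P V = (\<Sum>I\<in>E. c I * mon_at V I)"
  unfolding polys_def by blast

lemma polys_add:
  assumes "P \<in> polys E" "Q \<in> polys E"
  shows "(\<lambda>V. P V + Q V) \<in> polys E"
proof -
  obtain c d where "\<And>V. P V = (\<Sum>I\<in>E. c I * mon_at V I)" "\<And>V. Q V = (\<Sum>I\<in>E. d I * mon_at V I)"
    using assms[THEN polysD] by blast
  then show ?thesis by (intro polysI[where c = "\<lambda>I. c I + d I"]) (simp add: distrib_right sum.distrib)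
qed

lemma polys_scale:
  assumes "P \<in> polys E"
  shows "(\<lambda>V. a * P V) \<in> polys E"
proof -
  obtain c where "\<And>V. P V = (\<Sum>I\<in>E. c I * mon_at V I)" using assms[THEN polysD] by blast
  then show ?thesis by (intro polysI[where c = "\<lambda>I. a * c I"]) (simp add: sum_distrib_left ac_simps)
qed

lemma polys_sum:
  assumes "\<And>i. i \<in> T \<Longrightarrow> P i \<in> polys E"
  shows "(\<lambda>V. \<Sum>i\<in>T. P i V) \<in> polys E"
proof -
  have "(\<lambda>V. 0) \<in> polys E" by (rule polysI[where c = "\<lambda>_. 0"]) simp
  then show ?thesis using assms
    by (induction T rule: infinite_finite_induct) (auto intro: polys_add)
qed

lemma polys_mon:
  assumes "J \<in> E" "finite E"
  shows "(\<lambda>V. mon_at V J) \<in> polys E"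
  by (rule polysI[where c = "\<lambda>I. if I = J then 1 else 0"])
     (use assms in \<open>simp add: if_distrib[of "\<lambda>x. x * _"] sum.delta cong: if_cong\<close>)

lemma polys_mult:
  assumes "P \<in> polys E" "Q \<in> polys E'"
    and "finite E''" "\<And>I J. I \<in> E \<Longrightarrow> J \<in> E' \<Longrightarrow> I + J \<in> E''"
  shows "(\<lambda>V. P V * Q V) \<in> polys E''"
proof -
  obtain c d where "\<And>V. P V = (\<Sum>I\<in>E. c I * mon_at V I)" "\<And>V. Q V = (\<Sum>I\<in>E'. d I * mon_at V I)"
    using assms(1,2)[THEN polysD] by blast
  then have eq: "P V * Q V = (\<Sum>I\<in>E. \<Sum>J\<in>E'. (c I * d J) * mon_at V (I + J))" for V
    by (simp add: sum_product ac_simps)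
  show ?thesis unfolding eq by (intro polys_sum polys_scale polys_mon assms)
qed

text \<open>Used for the constants inside the function field, for the identity of an infinite field,
  and for the rational numbers inside a field of characteristic zero.\<close>

locale scalars =
  fixes \<iota> :: "'k::field \<Rightarrow> 'a::field"
  assumes iota_add: "\<iota> (a + b) = \<iota> a + \<iota> b"
    and iota_mult: "\<iota> (a * b) = \<iota> a * \<iota> b"
    and iota_1 [simp]: "\<iota> 1 = 1"
    and inf_UNIV: "infinite (UNIV :: 'k set)"
begin

lemma iota_0 [simp]: "\<iota> 0 = 0"
  using iota_add[of 0 0] by (metis add_cancel_left_left add_0)

lemma iota_uminus: "\<iota> (- a) = - \<iota> a"
  using iota_add[of a "- a"] by (simp add: eq_neg_iff_add_eq_0 add.commute)

lemma iota_diff: "\<iota> (a - b) = \<iota> a - \<iota> b"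
  using iota_add[of a "- b"] by (simp add: iota_uminus)

lemma iota_power: "\<iota> (a ^ n) = \<iota> a ^ n"
  by (induction n) (simp_all add: iota_mult)

lemma iota_sum: "\<iota> (\<Sum>i\<in>T. f i) = (\<Sum>i\<in>T. \<iota> (f i))"
  by (induction T rule: infinite_finite_induct) (simp_all add: iota_add)

lemma iota_inverse: "a \<noteq> 0 \<Longrightarrow> \<iota> (inverse a) * \<iota> a = 1"
  by (metis iota_1 iota_mult left_inverse)

lemma iota_eq_0_iff [simp]: "\<iota> a = 0 \<longleftrightarrow> a = 0"
  using iota_inverse[of a] by (metis iota_0 mult_zero_right zero_neq_one)

definition subsp :: "'a set \<Rightarrow> bool" where
  "subsp R \<longleftrightarrow> 0 \<in> R \<and> (\<forall>a\<in>R. \<forall>b\<in>R. a + b \<in> R) \<and> (\<forall>c. \<forall>a\<in>R. \<iota> c * a \<in> R)"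

lemma subspD:
  assumes "subsp R"
  shows "0 \<in> R" "a \<in> R \<Longrightarrow> b \<in> R \<Longrightarrow> a + b \<in> R" "a \<in> R \<Longrightarrow> \<iota> c * a \<in> R"
    "a \<in> R \<Longrightarrow> b \<in> R \<Longrightarrow> a - b \<in> R"
proof -
  show *: "0 \<in> R" "a \<in> R \<Longrightarrow> b \<in> R \<Longrightarrow> a + b \<in> R" "a \<in> R \<Longrightarrow> \<iota> c * a \<in> R" for a b c
    using assms unfolding subsp_def by blast+
  show "a - b \<in> R" if "a \<in> R" "b \<in> R" for a b
    using *(2)[OF that(1) *(3)[OF that(2), of "-1"]] by (simp add: iota_uminus)
qed

lemma subsp_zero: "subsp {0}"
  by (simp add: subsp_def)

lemma subsp_subring: "unital_subring R \<Longrightarrow> range \<iota> \<subseteq> R \<Longrightarrow> subsp R"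
  unfolding subsp_def by (auto intro: unital_subringD)

text \<open>Divided differences stay in R because t - s is an invertible scalar, so synthetic
  division lowers the degree at the cost of one point. As R is only a subspace over the scalars, R =
  {0} is allowed and yields uniqueness of coefficients.\<close>

lemma poly_coeff_mem:
  assumes R: "subsp R" and "infinite T" and "\<And>t. t \<in> T \<Longrightarrow> poly p (\<iota> t) \<in> R"
  shows "coeff p i \<in> R"
  using assms(2,3)
proof (induction "degree p" arbitrary: p T i)
  case 0
  then obtain a where p: "p = [:a:]" by (metis degree_eq_zeroE)
  from 0(2) obtain t where "t \<in> T" by fastforce
  with 0(3)[of t] p have "a \<in> R" by simp
  then show ?case using subspD(1)[OF R] by (simp add: p coeff_pCons split: nat.splits)
next
  case (Suc n)
  from Suc(3) obtain s where s: "s \<in> T" by fastforce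
  define q where "q = synthetic_div p (\<iota> s)"
  have p: "p = [:- \<iota> s, 1:] * q + [:poly p (\<iota> s):]"
    unfolding q_def by (rule synthetic_div_correct'[symmetric])
  have "poly q (\<iota> t) \<in> R" if "t \<in> T - {s}" for t
  proof -
    have "poly p (\<iota> t) = (\<iota> t - \<iota> s) * poly q (\<iota> t) + poly p (\<iota> s)"
      by (subst p) (simp add: algebra_simps)
    then have "(\<iota> t - \<iota> s) * poly q (\<iota> t) \<in> R"
      using subspD(4)[OF R Suc(4)[of t] Suc(4)[OF s]] that by simp
    then have "\<iota> (inverse (t - s)) * ((\<iota> t - \<iota> s) * poly q (\<iota> t)) \<in> R"
      by (rule subspD(3)[OF R])
    moreover have "\<iota> (inverse (t - s)) * (\<iota> t - \<iota> s) = 1"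
      using that iota_inverse[of "t - s"] by (simp add: iota_diff)
    ultimately show ?thesis by (simp flip: mult.assoc)
  qed
  moreover have "degree q = n" unfolding q_def using Suc(2) by (simp add: degree_synthetic_div)
  moreover have "infinite (T - {s})" using Suc(3) by simp
  ultimately have q: "coeff q j \<in> R" for j using Suc(1)[of q "T - {s}" j] by simp
  have "coeff p i = (case i of 0 \<Rightarrow> 0 | Suc j \<Rightarrow> coeff q j) - \<iota> s * coeff q i
      + (case i of 0 \<Rightarrow> poly p (\<iota> s) | Suc j \<Rightarrow> 0)"
    by (subst p) (simp add: coeff_pCons split: nat.splits)
  also have "\<dots> \<in> R"
    using q subspD[OF R] Suc(4)[OF s] by (auto split: nat.splits)
  finally show ?case .
qed

end

lemma digits_unique:
  fixes a b :: "nat \<Rightarrow> nat"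
  assumes "(\<Sum>j<n. a j * \<beta> ^ j) = (\<Sum>j<n. b j * \<beta> ^ j)"
    and "\<And>j. j < n \<Longrightarrow> a j < \<beta>" "\<And>j. j < n \<Longrightarrow> b j < \<beta>"
  shows "\<forall>j<n. a j = b j"
  using assms
proof (induction n arbitrary: a b)
  case (Suc n)
  have shift: "(\<Sum>j<Suc n. c j * \<beta> ^ j) = c 0 + \<beta> * (\<Sum>j<n. c (Suc j) * \<beta> ^ j)" for c :: "nat \<Rightarrow> nat"
    by (subst sum.lessThan_Suc_shift) (simp add: sum_distrib_left ac_simps)
  have eq: "a 0 + \<beta> * (\<Sum>j<n. a (Suc j) * \<beta> ^ j) = b 0 + \<beta> * (\<Sum>j<n. b (Suc j) * \<beta> ^ j)"
    using Suc(2) unfolding shift .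
  have lt: "a 0 < \<beta>" "b 0 < \<beta>" using Suc(3,4) by auto
  have 0: "a 0 = b 0" using arg_cong[OF eq, of "\<lambda>x. x mod \<beta>"] lt by simp
  have "(\<Sum>j<n. a (Suc j) * \<beta> ^ j) = (\<Sum>j<n. b (Suc j) * \<beta> ^ j)"
    using eq 0 lt by simp
  then have "\<forall>j<n. a (Suc j) = b (Suc j)"
    using Suc(1)[of "\<lambda>j. a (Suc j)" "\<lambda>j. b (Suc j)"] Suc(3,4) by auto
  then show ?case using 0 by (metis less_Suc_eq_0_disj)
qed simp

text \<open>Kronecker substitution: the variables become powers of t with exponents \<beta>^j, where
  \<beta> exceeds all multiplicities in E. The degree in t is then an expansion in base \<beta> that
  determines the monomial.\<close>

lemma ex_weights_inj:
  fixes E :: "'v::finite multiset set"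
  assumes "finite E"
  shows "\<exists>e :: 'v \<Rightarrow> nat. inj_on (\<lambda>I. \<Sum>i\<in>#I. e i) E"
proof -
  obtain f where f: "bij_betw f (UNIV :: 'v set) {..<CARD('v)}"
    using ex_bij_betw_finite_nat[of "UNIV :: 'v set"] by (auto simp: atLeast0LessThan)
  define \<beta> where "\<beta> = Suc (\<Sum>I\<in>E. size I)"
  have less: "count I i < \<beta>" if "I \<in> E" for I i
  proof -
    have "count I i \<le> size I" by (metis count_le_replicate_mset_subset_eq order_refl size_mset_mono size_replicate_mset)
    also have "\<dots> \<le> (\<Sum>I\<in>E. size I)" using assms that by (intro member_le_sum) auto
    finally show ?thesis by (simp add: \<beta>_def)
  qed
  let ?g = "inv_into UNIV f"
  have gf: "?g (f i) = i" for i using f by (simp add: bij_betw_def)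
  have wt: "(\<Sum>i\<in>#I. \<beta> ^ f i) = (\<Sum>j<CARD('v). count I (?g j) * \<beta> ^ j)" for I
  proof -
    have "(\<Sum>i\<in>#I. \<beta> ^ f i) = (\<Sum>i\<in>UNIV. count I i * \<beta> ^ f i)"
    proof (induction I)
      case (add x I)
      have "(\<Sum>i\<in>UNIV. count (add_mset x I) i * \<beta> ^ f i)
          = (\<Sum>i\<in>UNIV. count I i * \<beta> ^ f i + (if i = x then \<beta> ^ f i else 0))"
        by (intro sum.cong) auto
      then show ?case using add by (simp add: sum.distrib)
    qed simp
    also have "\<dots> = (\<Sum>j<CARD('v). count I (?g j) * \<beta> ^ j)"
      by (rule sum.reindex_bij_betw[OF f, of "\<lambda>j. count I (?g j) * \<beta> ^ j", symmetric, unfolded gf, symmetric])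
    finally show ?thesis .
  qed
  have "inj_on (\<lambda>I. \<Sum>i\<in>#I. \<beta> ^ f i) E"
  proof (rule inj_onI)
    fix I J assume IJ: "I \<in> E" "J \<in> E" "(\<Sum>i\<in>#I. \<beta> ^ f i) = (\<Sum>i\<in>#J. \<beta> ^ f i)"
    have "\<forall>j<CARD('v). count I (?g j) = count J (?g j)"
      using IJ less unfolding wt by (intro digits_unique) auto
    then have "count I i = count J i" for i
      using f gf by (metis UNIV_I bij_betwE lessThan_iff)
    then show "I = J" by (simp add: multiset_eq_iff)
  qed
  then show ?thesis by blast
qed

context scalars
begin

text \<open>Kronecker substitution reduces the claim to one variable. Points with all coordinates
  nonzero suffice, which matters because the applications divide by coordinates.\<close>

lemma coeff_mem:
  fixes c :: "'v::finite multiset \<Rightarrow> 'a"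
  assumes R: "subsp R" and E: "finite E"
    and val: "\<And>V. (\<And>i. V i \<noteq> 0) \<Longrightarrow> (\<Sum>I\<in>E. c I * mon_at (\<lambda>i. \<iota> (V i)) I) \<in> R"
    and J: "J \<in> E"
  shows "c J \<in> R"
proof -
  obtain e :: "'v \<Rightarrow> nat" where e: "inj_on (\<lambda>I. \<Sum>i\<in>#I. e i) E"
    using ex_weights_inj[OF E] by blast
  define p where "p = (\<Sum>I\<in>E. Polynomial.monom (c I) (\<Sum>i\<in>#I. e i))"
  have "poly p (\<iota> t) \<in> R" if "t \<in> UNIV - {0}" for t
  proof -
    have "mon_at (\<lambda>i. \<iota> (t ^ e i)) I = \<iota> t ^ (\<Sum>i\<in>#I. e i)" for I
      by (induction I) (simp_all add: iota_power power_add)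
    then have "poly p (\<iota> t) = (\<Sum>I\<in>E. c I * mon_at (\<lambda>i. \<iota> (t ^ e i)) I)"
      by (simp add: p_def poly_sum poly_monom)
    then show ?thesis using val[of "\<lambda>i. t ^ e i"] that by simp
  qed
  moreover have "infinite (UNIV - {0::'k})" using inf_UNIV by simp
  ultimately have "coeff p (\<Sum>i\<in>#J. e i) \<in> R" using poly_coeff_mem[OF R] by blast
  moreover have "coeff p (\<Sum>i\<in>#J. e i) = (\<Sum>I\<in>E. if I = J then c I else 0)"
    unfolding p_def coeff_sum using e J by (intro sum.cong) (auto dest: inj_onD)
  ultimately show ?thesis using E J by (simp add: sum.delta)
qed

end

section \<open>Descent along a purely inseparable modification\<close>

text \<open>
  A substitute for the Cayley-Hamilton theorem. It is used twice: with the polynomials of degree less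
  than \<open>k\<close> in \<open>z\<close> as \<open>Q k\<close>, and with an ideal as \<open>Q k\<close> for all \<open>k\<close>.
\<close>

lemma elimination:
  fixes z :: "'a::field" and e :: "'i \<Rightarrow> 'a" and Q :: "nat \<Rightarrow> 'a set"
  assumes Q: "\<And>k a b. a \<in> Q k \<Longrightarrow> b \<in> Q k \<Longrightarrow> a + b \<in> Q k" "\<And>k a b. a \<in> Q k \<Longrightarrow> b \<in> Q k \<Longrightarrow> a - b \<in> Q k"
    "\<And>k a b. a \<in> Q k \<Longrightarrow> b \<in> Q k \<Longrightarrow> a * b \<in> Q (2 * k)" "\<And>k a. a \<in> Q k \<Longrightarrow> z ^ k * a \<in> Q (2 * k)"
    and "finite G" "\<exists>l\<in>G. e l \<noteq> 0" "k \<ge> 1"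
    and "\<And>l. l \<in> G \<Longrightarrow> \<exists>\<mu>. (\<forall>j\<in>G. \<mu> j \<in> Q k) \<and> z ^ k * e l = (\<Sum>j\<in>G. \<mu> j * e j)"
  shows "\<exists>k\<ge>1. z ^ k \<in> Q k"
  using assms(5-)
proof (induction G arbitrary: k rule: finite_induct)
  case (insert h G)
  obtain \<mu> where \<mu>: "\<And>l j. l \<in> insert h G \<Longrightarrow> j \<in> insert h G \<Longrightarrow> \<mu> l j \<in> Q k"
    "\<And>l. l \<in> insert h G \<Longrightarrow> z ^ k * e l = (\<Sum>j\<in>insert h G. \<mu> l j * e j)"
    using insert.prems(3) by metis
  have exp: "z ^ k * e l = \<mu> l h * e h + (\<Sum>j\<in>G. \<mu> l j * e j)" if "l \<in> insert h G" for l
    using \<mu>(2)[OF that] insert.hyps by simp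
  show ?case
  proof (cases "\<exists>l\<in>G. e l \<noteq> 0")
    case False
    then have "e h \<noteq> 0" using insert.prems(1) by auto
    moreover have "z ^ k * e h = \<mu> h h * e h" using exp[of h] False by simp
    ultimately have "z ^ k = \<mu> h h" by simp
    then show ?thesis using \<mu>(1)[of h h] insert.prems(2) by auto
  next
    case True
    have "\<exists>\<nu>. (\<forall>j\<in>G. \<nu> j \<in> Q (2 * k)) \<and> z ^ (2 * k) * e l = (\<Sum>j\<in>G. \<nu> j * e j)"
      if l: "l \<in> G" for l
    proof -
      \<comment> \<open>The relation for l is multiplied by z^k and the one for h is inserted; what
        remains of \<open>e h\<close> has the factor \<open>\<mu> l h * e h\<close>, which the
        relation for l expresses by the other generators. So \<open>e h\<close> disappears without
        division by z^k - \<mu> h h, and k doubles.\<close>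
      define \<nu>0 where "\<nu>0 j = z ^ k * \<mu> l j + \<mu> l h * \<mu> h j - \<mu> h h * \<mu> l j" for j
      define \<nu> where "\<nu> j = (if j = l then \<nu>0 j + z ^ k * \<mu> h h else \<nu>0 j)" for j
      have \<nu>0: "\<nu>0 j \<in> Q (2 * k)" if "j \<in> G" for j
        unfolding \<nu>0_def using \<mu>(1) l that Q by simp
      then have mem: "\<forall>j\<in>G. \<nu> j \<in> Q (2 * k)"
        unfolding \<nu>_def using \<mu>(1) l Q by simp
      let ?S = "\<lambda>l. \<Sum>j\<in>G. \<mu> l j * e j"
      have "z ^ (2 * k) * e l = z ^ k * (z ^ k * e l)" by (simp only: mult_2 power_add mult.assoc)
      also have "\<dots> = \<mu> l h * (z ^ k * e h) + z ^ k * ?S l"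
        using exp[of l] l by (simp add: algebra_simps)
      also have "\<dots> = \<mu> h h * (\<mu> l h * e h) + \<mu> l h * ?S h + z ^ k * ?S l"
        using exp[of h] by (simp add: algebra_simps)
      also have "\<mu> l h * e h = z ^ k * e l - ?S l" using exp[of l] l by simp
      also have "\<mu> h h * (z ^ k * e l - ?S l) + \<mu> l h * ?S h + z ^ k * ?S l
          = (\<Sum>j\<in>G. \<nu>0 j * e j) + z ^ k * \<mu> h h * e l"
        unfolding \<nu>0_def
        by (simp add: algebra_simps sum_distrib_left sum.distrib sum_subtractf)
      also have "\<dots> = (\<Sum>j\<in>G. \<nu> j * e j)"
      proof -
        have "(\<Sum>j\<in>G. \<nu> j * e j) = (\<Sum>j\<in>G. \<nu>0 j * e j + (if j = l then z ^ k * \<mu> h h * e l else 0))"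
          by (intro sum.cong) (auto simp: \<nu>_def algebra_simps)
        then show ?thesis using insert.hyps l by (simp add: sum.distrib)
      qed
      finally show ?thesis using mem by blast
    qed
    then show ?thesis using insert.IH[OF True, of "2 * k"] insert.prems(2) by simp
  qed
qed simp

section \<open>Root-closed subrings that are maximal without a given element\<close>

definition root_closed :: "nat \<Rightarrow> 'a::comm_ring_1 set \<Rightarrow> bool" where
  "root_closed p R \<longleftrightarrow> (\<forall>z. z ^ p \<in> R \<longrightarrow> z \<in> R)"

lemma root_closedD: "root_closed p R \<Longrightarrow> z ^ (p ^ n) \<in> R \<Longrightarrow> z \<in> R"
proof (induction n)
  case (Suc n)
  then have "(z ^ (p ^ n)) ^ p \<in> R" by (simp add: power_mult mult.commute flip: power_mult)
  then show ?case using Suc unfolding root_closed_def by blast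
qed simp

locale maximal_avoiding =
  fixes R :: "'a::field set" and s :: 'a and p :: nat
  assumes prime_p: "prime p" and char: "CHAR('a) = p"
    and ring: "unital_subring R" and closed: "root_closed p R" and s_notin: "s \<notin> R"
    and maximal: "\<And>R'. unital_subring R' \<Longrightarrow> R \<subseteq> R' \<Longrightarrow> root_closed p R' \<Longrightarrow> s \<notin> R' \<Longrightarrow> R' = R"
begin

lemmas R_simps [simp] = unital_subringD[OF ring] subring_power[OF ring]

lemma prime_char: "prime CHAR('a)"
  using prime_p char by simp

lemma ex_power_ge: "\<exists>e. p ^ e \<ge> n"
  using power_gt_expt[of p n] prime_gt_1_nat[OF prime_p] by (auto intro: less_imp_le)

text \<open>R[1/r] is again root-closed: from r^n z^p in R one gets (r^n z)^p in R by raising the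
  exponent of r. If r is not a unit, this ring is strictly larger than R, and maximality forces s
  into it.\<close>

lemma nonunit_power:
  assumes r: "r \<in> R" and nonunit: "r = 0 \<or> inverse r \<notin> R"
  shows "\<exists>n. r ^ n * s \<in> R"
proof (cases "r = 0")
  case True
  then have "r ^ 1 * s \<in> R" by simp
  then show ?thesis by blast
next
  case False
  define R' where "R' = {z. \<exists>n. r ^ n * z \<in> R}"
  have up: "r ^ (m + n) * z \<in> R" if "r ^ n * z \<in> R" for m n z
    using that r by (simp add: power_add mult.assoc)
  have "unital_subring R'"
    unfolding unital_subring_def
  proof (intro conjI ballI)
    show "1 \<in> R'" unfolding R'_def by (auto intro: exI[of _ 0])
    fix a b assume "a \<in> R'" "b \<in> R'"
    then obtain m n where mn: "r ^ m * a \<in> R" "r ^ n * b \<in> R" unfolding R'_def by blast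
    have "r ^ (m + n) * (a - b) \<in> R"
      using up[OF mn(1), of n] up[OF mn(2), of m] by (simp add: right_diff_distrib add.commute)
    then show "a - b \<in> R'" unfolding R'_def by blast
    have "(r ^ m * a) * (r ^ n * b) \<in> R" using mn by simp
    then have "r ^ (m + n) * (a * b) \<in> R" by (simp add: power_add ac_simps)
    then show "a * b \<in> R'" unfolding R'_def by blast
  qed
  moreover have "R \<subseteq> R'" unfolding R'_def by (auto intro: exI[of _ 0])
  moreover have "root_closed p R'"
    unfolding root_closed_def
  proof (intro allI impI)
    fix z assume "z ^ p \<in> R'"
    then obtain n where n: "r ^ n * z ^ p \<in> R" unfolding R'_def by blast
    have "n * p = (n * p - n) + n" using prime_gt_0_nat[OF prime_p] by simp
    then have "r ^ (n * p) * z ^ p \<in> R" using up[OF n, of "n * p - n"] by metis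
    then have "(r ^ n * z) ^ p \<in> R" by (simp add: power_mult_distrib power_mult)
    then show "z \<in> R'" using closed unfolding root_closed_def R'_def by blast
  qed
  moreover have "inverse r \<in> R'"
    using False unfolding R'_def by (auto intro!: exI[of _ 1])
  ultimately have "s \<in> R'" using maximal[of R'] False nonunit by blast
  then show ?thesis unfolding R'_def by blast
qed

text \<open>
  The conductor of \<open>R[s]\<close> into \<open>R\<close>. As \<open>R\<close> is maximal, this is the set of nonunits of \<open>R\<close>.
\<close>

definition \<mm> :: "'a set" where
  "\<mm> = {r. \<forall>j. r * s ^ j \<in> R}"

lemma mm_R: "r \<in> \<mm> \<Longrightarrow> r \<in> R"
  unfolding \<mm>_def by (metis (mono_tags) mem_Collect_eq mult.right_neutral power_0)

lemma mm_zero [simp]: "0 \<in> \<mm>" by (simp add: \<mm>_def)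
lemma mm_add [simp]: "a \<in> \<mm> \<Longrightarrow> b \<in> \<mm> \<Longrightarrow> a + b \<in> \<mm>" by (simp add: \<mm>_def distrib_right)
lemma mm_diff [simp]: "a \<in> \<mm> \<Longrightarrow> b \<in> \<mm> \<Longrightarrow> a - b \<in> \<mm>" by (simp add: \<mm>_def left_diff_distrib)
lemma mm_uminus [simp]: "a \<in> \<mm> \<Longrightarrow> - a \<in> \<mm>" by (simp add: \<mm>_def)
lemma mm_mult_left [simp]: "a \<in> R \<Longrightarrow> b \<in> \<mm> \<Longrightarrow> a * b \<in> \<mm>" by (simp add: \<mm>_def mult.assoc)
lemma mm_mult_right [simp]: "a \<in> \<mm> \<Longrightarrow> b \<in> R \<Longrightarrow> a * b \<in> \<mm>" by (metis mm_mult_left mult.commute)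
lemma mm_s: "a \<in> \<mm> \<Longrightarrow> s * a \<in> \<mm>"
proof -
  assume "a \<in> \<mm>"
  then have "a * s ^ Suc j \<in> R" for j unfolding \<mm>_def by blast
  then show ?thesis by (simp add: \<mm>_def ac_simps)
qed

lemma mm_s_power: "a \<in> \<mm> \<Longrightarrow> s ^ n * a \<in> \<mm>"
  by (induction n) (auto simp: mult.assoc intro: mm_s)

definition polys_in :: "nat \<Rightarrow> 'a set" where
  "polys_in k = {poly P s | P. (\<forall>i. coeff P i \<in> R) \<and> (\<forall>i\<ge>k. coeff P i = 0)}"

lemma polys_inI: "(\<And>i. coeff P i \<in> R) \<Longrightarrow> (\<And>i. i \<ge> k \<Longrightarrow> coeff P i = 0) \<Longrightarrow> z = poly P s \<Longrightarrow> z \<in> polys_in k"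
  unfolding polys_in_def by blast

text \<open>The hypothesis makes s integral over R, as s stabilizes a nonzero finitely generated
  module. Hence finitely many powers of s generate all others, one power of r clears all
  denominators, and extracting a p-power root replaces this power by r itself.\<close>

lemma integral_imp_mm:
  assumes "finite G" "\<exists>l\<in>G. e l \<noteq> 0"
    and "\<And>l. l \<in> G \<Longrightarrow> \<exists>\<mu>. (\<forall>j\<in>G. \<mu> j \<in> R) \<and> s * e l = (\<Sum>j\<in>G. \<mu> j * e j)"
    and r: "r \<in> R" and nonunit: "r = 0 \<or> inverse r \<notin> R"
  shows "r \<in> \<mm>"
proof -
  have "\<exists>g\<ge>1. s ^ g \<in> polys_in g"
  proof (rule elimination[where k = 1, OF _ _ _ _ assms(1,2)])
    fix k a b assume "a \<in> polys_in k" "b \<in> polys_in k"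
    then obtain P Q where P: "a = poly P s" "\<And>i. coeff P i \<in> R" "\<And>i. i \<ge> k \<Longrightarrow> coeff P i = 0"
      and Q: "b = poly Q s" "\<And>i. coeff Q i \<in> R" "\<And>i. i \<ge> k \<Longrightarrow> coeff Q i = 0"
      unfolding polys_in_def by blast
    show "a + b \<in> polys_in k" by (rule polys_inI[of "P + Q"]) (simp_all add: P Q)
    show "a - b \<in> polys_in k" by (rule polys_inI[of "P - Q"]) (simp_all add: P Q)
    show "a * b \<in> polys_in (2 * k)"
    proof (rule polys_inI[of "P * Q"])
      show "coeff (P * Q) i \<in> R" for i
        unfolding coeff_mult by (intro subring_sum[OF ring]) (simp add: P Q)
      show "coeff (P * Q) i = 0" if "i \<ge> 2 * k" for i
        unfolding coeff_mult
      proof (rule sum.neutral, rule ballI)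
        fix j assume "j \<in> {..i}"
        then have "j \<ge> k \<or> i - j \<ge> k" using that by auto
        then show "coeff P j * coeff Q (i - j) = 0" using P(3) Q(3) by auto
      qed
    qed (simp add: P Q)
  next
    fix k a assume "a \<in> polys_in k"
    then obtain P where P: "a = poly P s" "\<And>i. coeff P i \<in> R" "\<And>i. i \<ge> k \<Longrightarrow> coeff P i = 0"
      unfolding polys_in_def by blast
    show "s ^ k * a \<in> polys_in (2 * k)"
      by (rule polys_inI[of "Polynomial.monom 1 k * P"]) (auto simp: P coeff_monom_mult poly_monom)
  next
    fix l assume "l \<in> G"
    then obtain \<mu> where \<mu>: "\<forall>j\<in>G. \<mu> j \<in> R" "s * e l = (\<Sum>j\<in>G. \<mu> j * e j)"
      using assms(3) by blast
    have "\<mu> j \<in> polys_in 1" if "j \<in> G" for j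
      by (rule polys_inI[of "[:\<mu> j:]"]) (use \<mu> that in \<open>auto simp: coeff_pCons split: nat.splits\<close>)
    then show "\<exists>\<mu>. (\<forall>j\<in>G. \<mu> j \<in> polys_in 1) \<and> s ^ 1 * e l = (\<Sum>j\<in>G. \<mu> j * e j)"
      using \<mu>(2) by auto
  qed simp
  then obtain g P where P: "s ^ g = poly P s" "\<And>i. coeff P i \<in> R" "\<And>i. i \<ge> g \<Longrightarrow> coeff P i = 0"
    unfolding polys_in_def by blast
  have sg: "s ^ g = (\<Sum>i<g. coeff P i * s ^ i)"
  proof -
    have "poly P s = (\<Sum>i\<le>max g (degree P). coeff P i * s ^ i)"
      by (subst poly_altdef, rule sum.mono_neutral_left) (auto simp: coeff_eq_0)
    also have "\<dots> = (\<Sum>i<g. coeff P i * s ^ i)"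
      by (rule sum.mono_neutral_right) (auto simp: P(3))
    finally show ?thesis by (simp add: P(1))
  qed
  obtain n where n: "r ^ n * s \<in> R" using nonunit_power[OF r nonunit] by blast
  have small: "r ^ (n * g) * s ^ j \<in> R" if "j \<le> g" for j
  proof -
    have "(r ^ n * s) ^ j * r ^ (n * (g - j)) \<in> R" using n r by simp
    moreover have "(r ^ n * s) ^ j * r ^ (n * (g - j)) = r ^ (n * j + n * (g - j)) * s ^ j"
      by (simp add: power_mult_distrib power_add ac_simps flip: power_mult)
    moreover have "n * j + n * (g - j) = n * g" using that by (simp flip: distrib_left)
    ultimately show ?thesis by simp
  qed
  have all: "r ^ (n * g) * s ^ j \<in> R" for j
  proof (induction j rule: less_induct)
    case (less j)
    show ?case
    proof (cases "j < g")
      case False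
      then have "s ^ j = s ^ (j - g) * s ^ g" by (simp flip: power_add)
      also have "r ^ (n * g) * \<dots> = (\<Sum>i<g. coeff P i * (r ^ (n * g) * s ^ (j - g + i)))"
        unfolding sg by (simp add: sum_distrib_left power_add ac_simps)
      also have "\<dots> \<in> R"
        using less False P(2) by (intro subring_sum[OF ring]) auto
      finally show ?thesis .
    qed (use small in auto)
  qed
  obtain a where a: "p ^ a \<ge> n * g" using ex_power_ge by blast
  have "r * s ^ j \<in> R" for j
  proof -
    have "r ^ (p ^ a - n * g) * (r ^ (n * g) * s ^ (j * p ^ a)) \<in> R" using all r by simp
    then have "r ^ (p ^ a) * s ^ (j * p ^ a) \<in> R" using a by (simp flip: power_add mult.assoc)
    then have "(r * s ^ j) ^ (p ^ a) \<in> R" by (simp add: power_mult_distrib power_mult)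
    then show ?thesis by (rule root_closedD[OF closed])
  qed
  then show ?thesis by (simp add: \<mm>_def)
qed

end

text \<open>
  The coefficients of three bihomogeneous forms \<open>a\<close>, \<open>b\<close>, \<open>c\<close> of bidegree \<open>(q, q)\<close> in \<open>V\<close> and \<open>W\<close>
  with \<open>a(v, W) = s m(v, W)\<^sup>q\<close>, \<open>a(V, v) = b(V, v)\<close>, \<open>b(v, W) = c(v, W)\<close> and \<open>c(V, v) = s m(V, v)\<^sup>q\<close>, where
  \<open>m = V\<^sub>i W\<^sub>j - V\<^sub>j W\<^sub>i\<close> and \<open>q\<close> is a power of the characteristic.
\<close>

definition overlap_forms ::
    "'a::field \<Rightarrow> ('d::finite \<Rightarrow> 'a) \<Rightarrow> nat \<Rightarrow> 'd \<Rightarrow> 'd \<Rightarrow> ('d multiset \<Rightarrow> 'd multiset \<Rightarrow> 'a) \<Rightarrow>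
      ('d multiset \<Rightarrow> 'd multiset \<Rightarrow> 'a) \<Rightarrow> ('d multiset \<Rightarrow> 'd multiset \<Rightarrow> 'a) \<Rightarrow> bool" where
  "overlap_forms s v q i j a b c \<longleftrightarrow>
    (\<forall>J. size J = q \<longrightarrow> (\<Sum>I | size I = q. a I J * mon_at v I) =
      s * (if J = replicate_mset q j then v i ^ q else 0) - s * (if J = replicate_mset q i then v j ^ q else 0)) \<and>
    (\<forall>I. size I = q \<longrightarrow> (\<Sum>J | size J = q. a I J * mon_at v J) = (\<Sum>J | size J = q. b I J * mon_at v J)) \<and>
    (\<forall>J. size J = q \<longrightarrow> (\<Sum>I | size I = q. b I J * mon_at v I) = (\<Sum>I | size I = q. c I J * mon_at v I)) \<and>
    (\<forall>I. size I = q \<longrightarrow> (\<Sum>J | size J = q. c I J * mon_at v J) =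
      s * (if I = replicate_mset q i then v j ^ q else 0) - s * (if I = replicate_mset q j then v i ^ q else 0))"

definition overlap_data :: "'a::field set \<Rightarrow> 'a \<Rightarrow> ('d::finite \<Rightarrow> 'a) \<Rightarrow> nat \<Rightarrow> 'd \<Rightarrow> 'd \<Rightarrow> bool" where
  "overlap_data R s v q i j \<longleftrightarrow>
    (\<exists>a b c. (\<forall>I J. a I J \<in> R \<and> b I J \<in> R \<and> c I J \<in> R) \<and> overlap_forms s v q i j a b c)"

lemma overlap_data_mono: "overlap_data R s v q i j \<Longrightarrow> R \<subseteq> R' \<Longrightarrow> overlap_data R' s v q i j"
  unfolding overlap_data_def by blast

text \<open>\<open>chart\<close> writes s, where v i is invertible, as a form of degree q divided by
  v i ^ q. \<open>overlap\<close> compares the two pullbacks of s to the product of the blow-up with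
  itself.\<close>

locale modification = maximal_avoiding R s p
  for R :: "'a::field set" and s :: 'a and p :: nat +
  fixes v :: "'d::finite \<Rightarrow> 'a" and q e :: nat
  assumes v_ne_0: "\<exists>i. v i \<noteq> 0" and q: "q = p ^ e"
    and chart: "\<And>i. \<exists>c. (\<forall>I. c I \<in> R) \<and> s * v i ^ q = (\<Sum>I | size I = q. c I * mon_at v I)"
    and overlap: "\<And>i j. i \<noteq> j \<Longrightarrow> v i \<noteq> 0 \<Longrightarrow> v j \<noteq> 0 \<Longrightarrow> overlap_data R s v q i j"
begin

lemma q_pos: "q > 0"
  using q prime_gt_0_nat[OF prime_p] by simp

definition Forms :: "nat \<Rightarrow> 'a set" where
  "Forms N = {a. \<exists>c. (\<forall>I. c I \<in> R) \<and> a = (\<Sum>I | size I = N. c I * mon_at v I)}"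

lemma Forms_0 [simp]: "0 \<in> Forms N"
  unfolding Forms_def by (auto intro!: exI[of _ "\<lambda>_. 0"])

lemma Forms_add [simp]:
  assumes "a \<in> Forms N" "b \<in> Forms N"
  shows "a + b \<in> Forms N"
proof -
  from assms obtain c d where "\<forall>I. c I \<in> R" "\<forall>I. d I \<in> R"
    "a = (\<Sum>I | size I = N. c I * mon_at v I)" "b = (\<Sum>I | size I = N. d I * mon_at v I)"
    unfolding Forms_def by blast
  then show ?thesis unfolding Forms_def
    by (auto intro!: exI[of _ "\<lambda>I. c I + d I"] simp: distrib_right sum.distrib)
qed

lemma Forms_mult [simp]:
  assumes "r \<in> R" "a \<in> Forms N"
  shows "r * a \<in> Forms N"
proof -
  from assms(2) obtain c where "\<forall>I. c I \<in> R" "a = (\<Sum>I | size I = N. c I * mon_at v I)"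
    unfolding Forms_def by blast
  then show ?thesis unfolding Forms_def using assms(1)
    by (auto intro!: exI[of _ "\<lambda>I. r * c I"] simp: sum_distrib_left mult.assoc)
qed

lemma Forms_sum: "(\<And>t. t \<in> T \<Longrightarrow> a t \<in> Forms N) \<Longrightarrow> (\<Sum>t\<in>T. a t) \<in> Forms N"
  by (induction T rule: infinite_finite_induct) auto

lemma Forms_mon [simp]: "size J = N \<Longrightarrow> mon_at v J \<in> Forms N"
  unfolding Forms_def
  by (auto intro!: exI[of _ "\<lambda>I. if I = J then 1 else 0"] simp: if_distrib[of "\<lambda>x. x * _"] sum.delta cong: if_cong)

lemma Forms_induct:
  assumes "a \<in> Forms N" and "\<And>J. size J = N \<Longrightarrow> h * mon_at v J \<in> Forms N'"
  shows "h * a \<in> Forms N'"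
proof -
  from assms(1) obtain c where c: "\<forall>I. c I \<in> R" "a = (\<Sum>I | size I = N. c I * mon_at v I)"
    unfolding Forms_def by blast
  have "h * a = (\<Sum>I | size I = N. c I * (h * mon_at v I))"
    unfolding c(2) by (simp add: sum_distrib_left ac_simps)
  also have "\<dots> \<in> Forms N'" by (rule Forms_sum, rule Forms_mult) (use c(1) assms(2) in auto)
  finally show ?thesis .
qed

lemma Forms_mon_mult: "a \<in> Forms N \<Longrightarrow> mon_at v J * a \<in> Forms (size J + N)"
proof (erule Forms_induct)
  fix I :: "'d multiset" assume "size I = N"
  then have "mon_at v (J + I) \<in> Forms (size J + N)" by (intro Forms_mon) simp
  then show "mon_at v J * mon_at v I \<in> Forms (size J + N)" by simp
qed

lemma Forms_s_chart: "s * v i ^ q \<in> Forms q"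
  using chart[of i] unfolding Forms_def by blast

text \<open>In this degree some v i ^ q splits off every monomial, and the chart equation absorbs s
  into it. So the graded pieces of large degree are modules over R[s].\<close>

lemma Forms_s:
  assumes "a \<in> Forms N" "N \<ge> CARD('d) * q"
  shows "s * a \<in> Forms N"
proof (rule Forms_induct[OF assms(1)])
  fix J :: "'d multiset" assume J: "size J = N"
  then obtain i where "count J i \<ge> q" using ex_large_count[of q J] assms(2) q_pos by auto
  then obtain I where I: "J = I + replicate_mset q i" by (rule replicate_mset_split)
  have "mon_at v I * (s * v i ^ q) \<in> Forms (size I + q)" by (intro Forms_mon_mult Forms_s_chart)
  then show "s * mon_at v J \<in> Forms N" using I J by (simp add: ac_simps)
qed

lemma Forms_s_power: "a \<in> Forms N \<Longrightarrow> N \<ge> CARD('d) * q \<Longrightarrow> s ^ u * a \<in> Forms N"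
  by (induction u) (auto simp: mult.assoc intro: Forms_s)

section \<open>Functionals on forms modulo the maximal ideal\<close>

definition cong :: "'a \<Rightarrow> 'a \<Rightarrow> bool" (infix "\<approx>\<^sub>m" 50) where
  "a \<approx>\<^sub>m b \<longleftrightarrow> a - b \<in> \<mm>"

lemma cong_refl [simp]: "a \<approx>\<^sub>m a" by (simp add: cong_def)
lemma cong_sym: "a \<approx>\<^sub>m b \<Longrightarrow> b \<approx>\<^sub>m a" using mm_uminus[of "a - b"] by (simp add: cong_def)
lemma cong_trans [trans]: "a \<approx>\<^sub>m b \<Longrightarrow> b \<approx>\<^sub>m c \<Longrightarrow> a \<approx>\<^sub>m c"
  using mm_add[of "a - b" "b - c"] by (simp add: cong_def)
lemma cong_add: "a \<approx>\<^sub>m b \<Longrightarrow> c \<approx>\<^sub>m d \<Longrightarrow> a + c \<approx>\<^sub>m b + d"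
  using mm_add[of "a - b" "c - d"] by (simp add: cong_def algebra_simps)
lemma cong_diff: "a \<approx>\<^sub>m b \<Longrightarrow> c \<approx>\<^sub>m d \<Longrightarrow> a - c \<approx>\<^sub>m b - d"
  using mm_diff[of "a - b" "c - d"] by (simp add: cong_def algebra_simps)
lemma cong_mult_left: "r \<in> R \<Longrightarrow> a \<approx>\<^sub>m b \<Longrightarrow> r * a \<approx>\<^sub>m r * b"
  using mm_mult_left[of r "a - b"] by (simp add: cong_def algebra_simps)
lemma cong_mult_right: "r \<in> R \<Longrightarrow> a \<approx>\<^sub>m b \<Longrightarrow> a * r \<approx>\<^sub>m b * r"
  using cong_mult_left[of r a b] by (simp add: mult.commute)
lemma cong_sum: "(\<And>t. t \<in> T \<Longrightarrow> f t \<approx>\<^sub>m g t) \<Longrightarrow> (\<Sum>t\<in>T. f t) \<approx>\<^sub>m (\<Sum>t\<in>T. g t)"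
  by (induction T rule: infinite_finite_induct) (auto intro: cong_add)
lemma cong_diff_0_iff: "a - b \<approx>\<^sub>m 0 \<longleftrightarrow> a \<approx>\<^sub>m b" by (simp add: cong_def)

text \<open>Such f represent linear functionals on \<open>Forms N\<close> with values in the residue
  field. Linearity is asked only modulo \<open>\<mm>\<close>, because the examples are coordinates
  with respect to a minimal generating set, which are unique only modulo
  \<open>\<mm>\<close>.\<close>

definition lin :: "nat \<Rightarrow> ('a \<Rightarrow> 'a) \<Rightarrow> bool" where
  "lin N f \<longleftrightarrow> (\<forall>a\<in>Forms N. f a \<in> R) \<and> (\<forall>a\<in>Forms N. \<forall>b\<in>Forms N. f (a + b) \<approx>\<^sub>m f a + f b) \<and>
    (\<forall>r\<in>R. \<forall>a\<in>Forms N. f (r * a) \<approx>\<^sub>m r * f a)"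

lemma linD:
  assumes "lin N f"
  shows "a \<in> Forms N \<Longrightarrow> f a \<in> R" "a \<in> Forms N \<Longrightarrow> b \<in> Forms N \<Longrightarrow> f (a + b) \<approx>\<^sub>m f a + f b"
    "r \<in> R \<Longrightarrow> a \<in> Forms N \<Longrightarrow> f (r * a) \<approx>\<^sub>m r * f a"
  using assms unfolding lin_def by blast+

lemma lin_0: "lin N f \<Longrightarrow> f 0 \<approx>\<^sub>m 0"
  using linD(3)[of N f 0 0] by simp

lemma lin_sum:
  assumes f: "lin N f" and "\<And>t. t \<in> T \<Longrightarrow> r t \<in> R" "\<And>t. t \<in> T \<Longrightarrow> a t \<in> Forms N"
  shows "f (\<Sum>t\<in>T. r t * a t) \<approx>\<^sub>m (\<Sum>t\<in>T. r t * f (a t))"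
  using assms(2,3)
proof (induction T rule: infinite_finite_induct)
  case (insert t T)
  have "f (\<Sum>t\<in>insert t T. r t * a t) = f (r t * a t + (\<Sum>t\<in>T. r t * a t))"
    using insert.hyps by simp
  also have "\<dots> \<approx>\<^sub>m f (r t * a t) + f (\<Sum>t\<in>T. r t * a t)"
    using insert.prems by (intro linD[OF f] Forms_mult Forms_sum) auto
  also have "\<dots> \<approx>\<^sub>m r t * f (a t) + (\<Sum>t\<in>T. r t * f (a t))"
    using insert by (intro cong_add linD(3)[OF f]) auto
  finally show ?case using insert.hyps by simp
qed (simp_all add: lin_0[OF f])

lemma lin_diff:
  assumes f: "lin N f" and "a \<in> Forms N" "b \<in> Forms N"
  shows "f (a - b) \<approx>\<^sub>m f a - f b"
proof -
  have "f (a + (-1) * b) \<approx>\<^sub>m f a + f ((-1) * b)"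
    using assms(2,3) by (intro linD[OF f] Forms_mult) auto
  also have "\<dots> \<approx>\<^sub>m f a + (-1) * f b"
    using assms(2,3) by (intro cong_add linD(3)[OF f]) auto
  finally show ?thesis by simp
qed

lemma lin_comp:
  assumes f: "lin N f" and h: "\<And>a. a \<in> Forms N' \<Longrightarrow> h * a \<in> Forms N"
  shows "lin N' (\<lambda>a. f (h * a))"
  unfolding lin_def
proof (intro conjI ballI)
  fix a assume a: "a \<in> Forms N'"
  show "f (h * a) \<in> R" using linD(1)[OF f h[OF a]] .
  show "f (h * (a + b)) \<approx>\<^sub>m f (h * a) + f (h * b)" if "b \<in> Forms N'" for b
    using linD(2)[OF f h[OF a] h[OF that]] by (simp add: distrib_left)
  show "f (h * (r * a)) \<approx>\<^sub>m r * f (h * a)" if "r \<in> R" for r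
    using linD(3)[OF f that h[OF a]] by (simp add: ac_simps)
qed

text \<open>In tensor notation, s \<otimes> 1 - 1 \<otimes> s annihilates v_i^q \<otimes> v_j^q -
  v_j^q \<otimes> v_i^q modulo \<open>\<mm>\<close>. The forms a, b, c lead from one side to the
  other, each change being invisible after substituting v in one of the two sets of
  variables.\<close>

lemma overlap_identity:
  assumes f: "lin q f" and g: "lin q g"
  shows "f (s * v i ^ q) * g (v j ^ q) - f (s * v j ^ q) * g (v i ^ q)
    \<approx>\<^sub>m f (v i ^ q) * g (s * v j ^ q) - f (v j ^ q) * g (s * v i ^ q)"
proof -
  have mem: "v l ^ q \<in> Forms q" for l
    using Forms_mon[of "replicate_mset q l" q] by simp
  note mem = mem Forms_s_chart
  have R: "f (v l ^ q) \<in> R" "f (s * v l ^ q) \<in> R" "g (v l ^ q) \<in> R" "g (s * v l ^ q) \<in> R" for l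
    using linD(1)[OF f] linD(1)[OF g] mem by auto
  \<comment> \<open>Overlap data exist only for distinct indices with nonzero coordinates; in the
    other cases both sides vanish modulo \<open>\<mm>\<close>.\<close>
  consider "i = j" | "v i = 0" | "v j = 0" | "i \<noteq> j" "v i \<noteq> 0" "v j \<noteq> 0" by blast
  then show ?thesis
  proof cases
    case 2
    then have "s * v i ^ q = 0" "v i ^ q = 0" using q_pos by auto
    moreover have "f 0 \<in> \<mm>" "g 0 \<in> \<mm>" using lin_0[OF f] lin_0[OF g] by (simp_all add: cong_def)
    ultimately show ?thesis using R q_pos unfolding cong_def by (intro mm_diff) (auto simp: power_0_left)
  next
    case 3
    then have "s * v j ^ q = 0" "v j ^ q = 0" using q_pos by auto
    moreover have "f 0 \<in> \<mm>" "g 0 \<in> \<mm>" using lin_0[OF f] lin_0[OF g] by (simp_all add: cong_def)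
    ultimately show ?thesis using R q_pos unfolding cong_def by (intro mm_diff) (auto simp: power_0_left)
  next
    case 4
    from overlap[OF this, unfolded overlap_data_def overlap_forms_def] obtain a b c where R3: "\<forall>I J. a I J \<in> R \<and> b I J \<in> R \<and> c I J \<in> R"
      and e1: "\<forall>J. size J = q \<longrightarrow> (\<Sum>I | size I = q. a I J * mon_at v I) =
          s * (if J = replicate_mset q j then v i ^ q else 0) - s * (if J = replicate_mset q i then v j ^ q else 0)"
      and e2: "\<forall>I. size I = q \<longrightarrow> (\<Sum>J | size J = q. a I J * mon_at v J) = (\<Sum>J | size J = q. b I J * mon_at v J)"
      and e3: "\<forall>J. size J = q \<longrightarrow> (\<Sum>I | size I = q. b I J * mon_at v I) = (\<Sum>I | size I = q. c I J * mon_at v I)"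
      and e4: "\<forall>I. size I = q \<longrightarrow> (\<Sum>J | size J = q. c I J * mon_at v J) =
          s * (if I = replicate_mset q i then v j ^ q else 0) - s * (if I = replicate_mset q j then v i ^ q else 0)"
      by (elim exE conjE) (rule that)
    have R3: "\<And>I J. a I J \<in> R" "\<And>I J. b I J \<in> R" "\<And>I J. c I J \<in> R" using R3 by blast+
    note e1 = e1[rule_format] and e2 = e2[rule_format] and e3 = e3[rule_format] and e4 = e4[rule_format]
    \<comment> \<open>The pairing of f \<otimes> g with a bihomogeneous form. By linearity it can be
      computed by substituting v first in either set of variables, and the four conditions on a, b,
      c concern these substitutions.\<close>
    define pair where "pair r = (\<Sum>I | size I = q. \<Sum>J | size J = q. r I J * (f (mon_at v I) * g (mon_at v J)))"
      for r :: "'d multiset \<Rightarrow> 'd multiset \<Rightarrow> 'a"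
    have fR: "f (mon_at v I) \<in> R" and gR: "g (mon_at v I) \<in> R" if "size I = q" for I
      using linD(1)[OF f] linD(1)[OF g] that by auto
    have left: "pair r \<approx>\<^sub>m (\<Sum>J | size J = q. f (\<Sum>I | size I = q. r I J * mon_at v I) * g (mon_at v J))"
      if r: "\<And>I J. r I J \<in> R" for r
    proof -
      have "pair r = (\<Sum>J | size J = q. (\<Sum>I | size I = q. r I J * f (mon_at v I)) * g (mon_at v J))"
        unfolding pair_def by (subst sum.swap) (simp add: sum_distrib_right mult.assoc)
      also have "\<dots> \<approx>\<^sub>m (\<Sum>J | size J = q. f (\<Sum>I | size I = q. r I J * mon_at v I) * g (mon_at v J))"
        using gR r by (intro cong_sum cong_mult_right cong_sym[OF lin_sum[OF f]]) auto
      finally show ?thesis .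
    qed
    have right: "pair r \<approx>\<^sub>m (\<Sum>I | size I = q. f (mon_at v I) * g (\<Sum>J | size J = q. r I J * mon_at v J))"
      if r: "\<And>I J. r I J \<in> R" for r
    proof -
      have "pair r = (\<Sum>I | size I = q. f (mon_at v I) * (\<Sum>J | size J = q. r I J * g (mon_at v J)))"
        unfolding pair_def by (simp add: sum_distrib_left ac_simps)
      also have "\<dots> \<approx>\<^sub>m (\<Sum>I | size I = q. f (mon_at v I) * g (\<Sum>J | size J = q. r I J * mon_at v J))"
        using fR r by (intro cong_sum cong_mult_left cong_sym[OF lin_sum[OF g]]) auto
      finally show ?thesis .
    qed
    have ne: "replicate_mset q i \<noteq> replicate_mset q j"
      using 4(1) q_pos by (metis count_replicate_mset less_irrefl)
    let ?i = "replicate_mset q i" and ?j = "replicate_mset q j"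
    have two_terms: "h (s * (if J = A then x else 0) - s * (if J = B then y else 0)) * kk J
        \<approx>\<^sub>m (if J = A then h (s * x) * kk J else 0) - (if J = B then h (s * y) * kk J else 0)"
      if "A \<noteq> B" "lin q h" "kk J \<in> R" "s * x \<in> Forms q" "s * y \<in> Forms q" for h kk x y J A B
    proof -
      have h0: "h 0 \<approx>\<^sub>m 0" using lin_0[OF that(2)] .
      have "h (0 - s * y) \<approx>\<^sub>m h 0 - h (s * y)" using that by (intro lin_diff) auto
      also have "\<dots> \<approx>\<^sub>m 0 - h (s * y)" by (intro cong_diff h0) simp
      finally have "h (- (s * y)) * kk J \<approx>\<^sub>m (- h (s * y)) * kk J" using that(3) by (intro cong_mult_right) auto
      moreover have "h 0 * kk J \<approx>\<^sub>m 0 * kk J" using that(3) h0 by (intro cong_mult_right) auto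
      ultimately show ?thesis using that(1) by auto
    qed
    have "f (s * v i ^ q) * g (v j ^ q) - f (s * v j ^ q) * g (v i ^ q)
        = (\<Sum>J | size J = q. (if J = ?j then f (s * v i ^ q) * g (mon_at v J) else 0)
            - (if J = ?i then f (s * v j ^ q) * g (mon_at v J) else 0))"
      by (simp add: sum_subtractf sum.delta)
    also have "\<dots> \<approx>\<^sub>m (\<Sum>J | size J = q. f (\<Sum>I | size I = q. a I J * mon_at v I) * g (mon_at v J))"
    proof (rule cong_sum)
      fix J :: "'d multiset" assume "J \<in> {J. size J = q}"
      then have J: "size J = q" by simp
      show "(if J = ?j then f (s * v i ^ q) * g (mon_at v J) else 0) - (if J = ?i then f (s * v j ^ q) * g (mon_at v J) else 0)
          \<approx>\<^sub>m f (\<Sum>I | size I = q. a I J * mon_at v I) * g (mon_at v J)"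
        unfolding e1[OF J]
        by (rule cong_sym, rule two_terms[of _ _ f "\<lambda>J. g (mon_at v J)" J, OF ne[symmetric] f gR[OF J] Forms_s_chart Forms_s_chart])
    qed
    also have "\<dots> \<approx>\<^sub>m pair a" by (rule cong_sym[OF left[OF R3(1)]])
    also have "\<dots> \<approx>\<^sub>m (\<Sum>I | size I = q. f (mon_at v I) * g (\<Sum>J | size J = q. a I J * mon_at v J))" by (rule right[OF R3(1)])
    also have "\<dots> = (\<Sum>I | size I = q. f (mon_at v I) * g (\<Sum>J | size J = q. b I J * mon_at v J))"
      using e2 by simp
    also have "\<dots> \<approx>\<^sub>m pair b" by (rule cong_sym[OF right[OF R3(2)]])
    also have "\<dots> \<approx>\<^sub>m (\<Sum>J | size J = q. f (\<Sum>I | size I = q. b I J * mon_at v I) * g (mon_at v J))" by (rule left[OF R3(2)])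
    also have "\<dots> = (\<Sum>J | size J = q. f (\<Sum>I | size I = q. c I J * mon_at v I) * g (mon_at v J))"
      using e3 by simp
    also have "\<dots> \<approx>\<^sub>m pair c" by (rule cong_sym[OF left[OF R3(3)]])
    also have "\<dots> \<approx>\<^sub>m (\<Sum>I | size I = q. f (mon_at v I) * g (\<Sum>J | size J = q. c I J * mon_at v J))" by (rule right[OF R3(3)])
    also have "\<dots> \<approx>\<^sub>m (\<Sum>I | size I = q. (if I = ?i then g (s * v j ^ q) * f (mon_at v I) else 0)
            - (if I = ?j then g (s * v i ^ q) * f (mon_at v I) else 0))"
    proof (rule cong_sum)
      fix I :: "'d multiset" assume "I \<in> {J. size J = q}"
      then have I: "size I = q" by simp
      show "f (mon_at v I) * g (\<Sum>J | size J = q. c I J * mon_at v J) \<approx>\<^sub>m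
          (if I = ?i then g (s * v j ^ q) * f (mon_at v I) else 0) - (if I = ?j then g (s * v i ^ q) * f (mon_at v I) else 0)"
        unfolding e4[OF I] mult.commute[of "f (mon_at v I)"]
        by (rule two_terms[of _ _ g "\<lambda>I. f (mon_at v I)" I, OF ne g fR[OF I] Forms_s_chart Forms_s_chart])
    qed
    also have "\<dots> = f (v i ^ q) * g (s * v j ^ q) - f (v j ^ q) * g (s * v i ^ q)"
      by (simp add: sum_subtractf sum.delta mult.commute)
    finally show ?thesis .
  qed simp
qed

end

lemma repeat_mset_replicate [simp]: "repeat_mset n (replicate_mset k i) = replicate_mset (n * k) i"
  by (rule multiset_eqI) simp

lemma repeat_mset_add_mset: "repeat_mset n (add_mset i I) = replicate_mset n i + repeat_mset n I"
  by (rule multiset_eqI) auto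

context modification
begin

text \<open>The factors s are carried over one at a time, s^k \<otimes> 1 - 1 \<otimes> s^k being
  divisible by s \<otimes> 1 - 1 \<otimes> s. The cofactors J and J' raise the degree to N, where
  multiplication by s is available.\<close>

lemma overlap_identity_power:
  assumes f: "lin N f" and g: "lin N g" and N: "N \<ge> CARD('d) * q"
    and J: "size J + q = N" "size J' + q = N"
  shows "f (s ^ (u + k) * (mon_at v J * v i ^ q)) * g (s ^ w * (mon_at v J' * v j ^ q))
      - f (s ^ (u + k) * (mon_at v J * v j ^ q)) * g (s ^ w * (mon_at v J' * v i ^ q))
    \<approx>\<^sub>m f (s ^ u * (mon_at v J * v i ^ q)) * g (s ^ (w + k) * (mon_at v J' * v j ^ q))
      - f (s ^ u * (mon_at v J * v j ^ q)) * g (s ^ (w + k) * (mon_at v J' * v i ^ q))"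
proof (induction k arbitrary: w)
  case (Suc k)
  have mem: "s ^ n * mon_at v I * a \<in> Forms N" if "a \<in> Forms q" "size I + q = N" for n I a
    using Forms_s_power[OF Forms_mon_mult[OF that(1), of I], of n] that(2) N by (simp add: mult.assoc)
  have "f (s ^ (u + Suc k) * (mon_at v J * v i ^ q)) * g (s ^ w * (mon_at v J' * v j ^ q))
      - f (s ^ (u + Suc k) * (mon_at v J * v j ^ q)) * g (s ^ w * (mon_at v J' * v i ^ q))
    = f ((s ^ (u + k) * mon_at v J) * (s * v i ^ q)) * g ((s ^ w * mon_at v J') * v j ^ q)
      - f ((s ^ (u + k) * mon_at v J) * (s * v j ^ q)) * g ((s ^ w * mon_at v J') * v i ^ q)"
    by (simp add: ac_simps)
  also have "\<dots> \<approx>\<^sub>m f ((s ^ (u + k) * mon_at v J) * v i ^ q) * g ((s ^ w * mon_at v J') * (s * v j ^ q))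
      - f ((s ^ (u + k) * mon_at v J) * v j ^ q) * g ((s ^ w * mon_at v J') * (s * v i ^ q))"
    using mem J by (intro overlap_identity lin_comp[OF f] lin_comp[OF g]) auto
  also have "\<dots> = f (s ^ (u + k) * (mon_at v J * v i ^ q)) * g (s ^ Suc w * (mon_at v J' * v j ^ q))
      - f (s ^ (u + k) * (mon_at v J * v j ^ q)) * g (s ^ Suc w * (mon_at v J' * v i ^ q))"
    by (simp add: ac_simps)
  also note Suc[of "Suc w"]
  finally show ?case by simp
qed simp

text \<open>
  With \<open>t = s\<^sup>q\<close> and \<open>\<delta> = t \<otimes> 1 - 1 \<otimes> t\<close>, \<open>D1\<close> evaluates \<open>f \<otimes> g\<close> after \<open>\<delta>\<close>, and \<open>D2\<close> evaluates it after
  \<open>\<delta>\<^sup>2\<close>. The latter is \<open>0\<close> on monomials of large degree, so that \<open>\<delta>\<^sup>p = 0\<close> there.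
\<close>

definition D1 :: "('a \<Rightarrow> 'a) \<Rightarrow> ('a \<Rightarrow> 'a) \<Rightarrow> nat \<Rightarrow> nat \<Rightarrow> 'd multiset \<Rightarrow> 'd multiset \<Rightarrow> 'a" where
  "D1 f g u w J J' = f (s ^ (u + q) * mon_at v J) * g (s ^ w * mon_at v J')
    - f (s ^ u * mon_at v J) * g (s ^ (w + q) * mon_at v J')"

text \<open>\<delta> annihilates v_i^q \<otimes> v_j^q - v_j^q \<otimes> v_i^q. So after \<delta> a
  block v_i^q of one factor may be exchanged for a block v_j^q of the other.\<close>

lemma D1_swap_single:
  assumes "lin N f" "lin N g" "N \<ge> CARD('d) * q" "size J + q = N" "size J' + q = N"
  shows "D1 f g u w (J + replicate_mset q i) (J' + replicate_mset q j)
    \<approx>\<^sub>m D1 f g u w (J + replicate_mset q j) (J' + replicate_mset q i)"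
  using overlap_identity_power[OF assms, where u = u and w = w and k = q and i = i and j = j]
  unfolding D1_def cong_def by (simp add: algebra_simps)

lemma D1_swap:
  assumes f: "lin N f" and g: "lin N g" and N: "N \<ge> CARD('d) * q"
    and "size J + q * size I = N" "size J' + q * size I = N"
  shows "D1 f g u w (J + repeat_mset q I) (J' + replicate_mset (q * size I) i)
    \<approx>\<^sub>m D1 f g u w (J + replicate_mset (q * size I) i) (J' + repeat_mset q I)"
  using assms(4,5)
proof (induction I arbitrary: J J')
  case (add l I)
  have repl: "replicate_mset (q * size (add_mset l I)) i = replicate_mset q i + replicate_mset (q * size I) i"
    by (rule multiset_eqI) simp
  have "D1 f g u w (J + repeat_mset q (add_mset l I)) (J' + replicate_mset (q * size (add_mset l I)) i)
      = D1 f g u w ((J + repeat_mset q I) + replicate_mset q l)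
          ((J' + replicate_mset (q * size I) i) + replicate_mset q i)"
    unfolding repl repeat_mset_add_mset by (simp add: ac_simps)
  also have "\<dots> \<approx>\<^sub>m D1 f g u w ((J + repeat_mset q I) + replicate_mset q i)
          ((J' + replicate_mset (q * size I) i) + replicate_mset q l)"
    using add.prems by (intro D1_swap_single[OF f g N]) auto
  also have "\<dots> = D1 f g u w ((J + replicate_mset q i) + repeat_mset q I)
          ((J' + replicate_mset q l) + replicate_mset (q * size I) i)"
    by (simp add: ac_simps)
  also have "\<dots> \<approx>\<^sub>m D1 f g u w ((J + replicate_mset q i) + replicate_mset (q * size I) i)
          ((J' + replicate_mset q l) + repeat_mset q I)"
    using add.prems by (intro add.IH) auto
  also have "\<dots> = D1 f g u w (J + replicate_mset (q * size (add_mset l I)) i) (J' + repeat_mset q (add_mset l I))"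
    unfolding repl repeat_mset_add_mset by (simp add: ac_simps)
  finally show ?case .
qed simp

text \<open>Frobenius applied to the chart equation. Only q-th powers of monomials occur on the
  right, and these can be moved by \<open>D1_swap\<close>; this is the reason for working with t =
  s^q in place of s.\<close>

lemma chart_power:
  "\<exists>c. (\<forall>I. c I \<in> R) \<and> s ^ q * v i ^ (q * q) = (\<Sum>I | size I = q. c I * mon_at v (repeat_mset q I))"
proof -
  obtain c where c: "\<forall>I. c I \<in> R" "s * v i ^ q = (\<Sum>I | size I = q. c I * mon_at v I)"
    using chart[of i] by blast
  have "s ^ q * v i ^ (q * q) = (s * v i ^ q) ^ q" by (simp add: power_mult_distrib power_mult)
  also have "\<dots> = (\<Sum>I | size I = q. (c I * mon_at v I) ^ q)"
    unfolding c(2) using q char prime_char by (intro freshmans_dream_sum') auto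
  finally show ?thesis using c(1)
    by (intro exI[of _ "\<lambda>I. c I ^ q"]) (simp add: power_mult_distrib)
qed

definition D2 :: "('a \<Rightarrow> 'a) \<Rightarrow> ('a \<Rightarrow> 'a) \<Rightarrow> nat \<Rightarrow> nat \<Rightarrow> 'd multiset \<Rightarrow> 'd multiset \<Rightarrow> 'a" where
  "D2 f g u w J J' = D1 f g (u + q) w J J' - D1 f g u (w + q) J J'"

text \<open>Expanding t in the left factor of v_i^(q^2) \<otimes> v_i^(q^2) gives the sum of the c I
  v^(q I) \<otimes> v_i^(q^2), and expanding it in the right factor gives the same sum with the
  factors exchanged. One remaining \<delta> makes the two equal, so \<delta>^2 vanishes
  here.\<close>

lemma D2_same:
  assumes f: "lin N f" and g: "lin N g" and N: "N \<ge> CARD('d) * q"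
    and J: "size J + q * q = N" "size J' + q * q = N"
  shows "D2 f g u w (J + replicate_mset (q * q) i) (J' + replicate_mset (q * q) i) \<approx>\<^sub>m 0"
proof -
  obtain c where c: "\<And>I. c I \<in> R"
    "s ^ q * v i ^ (q * q) = (\<Sum>I | size I = q. c I * mon_at v (repeat_mset q I))"
    using chart_power[of i] by blast
  have mem: "s ^ n * mon_at v I \<in> Forms N" if "size I = N" for n I
    using Forms_s_power[OF Forms_mon[OF that] N] .
  have expand: "h (s ^ (n + q) * mon_at v (K + replicate_mset (q * q) i))
      \<approx>\<^sub>m (\<Sum>I | size I = q. c I * h (s ^ n * mon_at v (K + repeat_mset q I)))"
    if h: "lin N h" and K: "size K + q * q = N" for h n K
  proof -
    have "s ^ (n + q) * mon_at v (K + replicate_mset (q * q) i) = (s ^ n * mon_at v K) * (s ^ q * v i ^ (q * q))"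
      by (simp add: power_add ac_simps)
    also have "\<dots> = (\<Sum>I | size I = q. c I * (s ^ n * mon_at v (K + repeat_mset q I)))"
      unfolding c(2) by (simp add: sum_distrib_left ac_simps)
    finally have e: "s ^ (n + q) * mon_at v (K + replicate_mset (q * q) i)
      = (\<Sum>I | size I = q. c I * (s ^ n * mon_at v (K + repeat_mset q I)))" .
    show ?thesis
      unfolding e by (rule lin_sum[OF h c(1)], rule mem) (use K in simp)
  qed
  let ?a = "J + replicate_mset (q * q) i" and ?b = "J' + replicate_mset (q * q) i"
  have fR: "f (s ^ n * mon_at v I) \<in> R" and gR: "g (s ^ n * mon_at v I) \<in> R" if "size I = N" for n I
    using linD(1)[OF f mem[OF that]] linD(1)[OF g mem[OF that]] .
  have "D1 f g (u + q) w ?a ?b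
      \<approx>\<^sub>m (\<Sum>I | size I = q. c I * f (s ^ (u + q) * mon_at v (J + repeat_mset q I))) * g (s ^ w * mon_at v ?b)
        - (\<Sum>I | size I = q. c I * f (s ^ u * mon_at v (J + repeat_mset q I))) * g (s ^ (w + q) * mon_at v ?b)"
    unfolding D1_def by (intro cong_diff cong_mult_right expand[OF f J(1)] gR) (use J in simp_all)
  also have "\<dots> = (\<Sum>I | size I = q. c I * D1 f g u w (J + repeat_mset q I) ?b)"
    unfolding D1_def by (simp add: sum_distrib_left sum_distrib_right sum_subtractf algebra_simps)
  finally have 1: "D1 f g (u + q) w ?a ?b \<approx>\<^sub>m (\<Sum>I | size I = q. c I * D1 f g u w (J + repeat_mset q I) ?b)" .
  have "D1 f g u (w + q) ?a ?b
      \<approx>\<^sub>m f (s ^ (u + q) * mon_at v ?a) * (\<Sum>I | size I = q. c I * g (s ^ w * mon_at v (J' + repeat_mset q I)))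
        - f (s ^ u * mon_at v ?a) * (\<Sum>I | size I = q. c I * g (s ^ (w + q) * mon_at v (J' + repeat_mset q I)))"
    unfolding D1_def by (intro cong_diff cong_mult_left expand[OF g J(2)] fR) (use J in simp_all)
  also have "\<dots> = (\<Sum>I | size I = q. c I * D1 f g u w ?a (J' + repeat_mset q I))"
    unfolding D1_def by (simp add: sum_distrib_left sum_distrib_right sum_subtractf algebra_simps)
  finally have 2: "D1 f g u (w + q) ?a ?b \<approx>\<^sub>m (\<Sum>I | size I = q. c I * D1 f g u w ?a (J' + repeat_mset q I))" .
  have "(\<Sum>I | size I = q. c I * D1 f g u w (J + repeat_mset q I) ?b)
      \<approx>\<^sub>m (\<Sum>I | size I = q. c I * D1 f g u w ?a (J' + repeat_mset q I))"
  proof (intro cong_sum cong_mult_left c(1))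
    fix I :: "'d multiset" assume "I \<in> {I. size I = q}"
    then show "D1 f g u w (J + repeat_mset q I) ?b \<approx>\<^sub>m D1 f g u w ?a (J' + repeat_mset q I)"
      using D1_swap[OF f g N, of J I J' u w i] J by simp
  qed
  with 1 2 have "D1 f g (u + q) w ?a ?b \<approx>\<^sub>m D1 f g u (w + q) ?a ?b"
    using cong_sym cong_trans by blast
  then show ?thesis by (simp add: D2_def cong_diff_0_iff)
qed

text \<open>Each factor contains some variable with exponent 2 q^2, but the two variables may
  differ. Exchanging a block of exponent q^2 puts v_i^(q^2) into both, and \<open>D2_same\<close>
  applies; the 2 leaves a second block in place.\<close>

lemma D2_zero:
  assumes f: "lin N f" and g: "lin N g" and N: "N \<ge> CARD('d) * (2 * (q * q))"
    and J: "size J = N" "size J' = N"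
  shows "D2 f g u w J J' \<approx>\<^sub>m 0"
proof -
  have "q \<le> 2 * (q * q)" by (cases q) auto
  then have "CARD('d) * q \<le> CARD('d) * (2 * (q * q))" by (rule mult_left_mono) simp
  then have N': "N \<ge> CARD('d) * q" using N by (rule order_trans)
  have pos: "2 * (q * q) > 0" using q_pos by simp
  obtain i j where "count J i \<ge> 2 * (q * q)" "count J' j \<ge> 2 * (q * q)"
    using ex_large_count[of "2 * (q * q)" J] ex_large_count[of "2 * (q * q)" J'] N J pos by auto
  then obtain K K' where K: "J = K + replicate_mset (2 * (q * q)) i" "J' = K' + replicate_mset (2 * (q * q)) j"
    by (metis replicate_mset_split)
  have twice: "replicate_mset (2 * (q * q)) l = replicate_mset (q * q) l + replicate_mset (q * q) l" for l :: 'd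
    by (rule multiset_eqI) simp
  let ?Q = "\<lambda>l. replicate_mset (q * q) l"
  have swap: "D1 f g u w J J' \<approx>\<^sub>m D1 f g u w ((K + ?Q j) + ?Q i) ((K' + ?Q j) + ?Q i)" for u w
  proof -
    have "D1 f g u w ((K + ?Q i) + repeat_mset q (replicate_mset q j)) ((K' + ?Q j) + replicate_mset (q * size (replicate_mset q j)) i)
      \<approx>\<^sub>m D1 f g u w ((K + ?Q i) + replicate_mset (q * size (replicate_mset q j)) i) ((K' + ?Q j) + repeat_mset q (replicate_mset q j))"
      using J K by (intro D1_swap[OF f g N']) auto
    then show ?thesis unfolding K twice by (simp add: ac_simps cong_sym)
  qed
  have "D2 f g u w J J' \<approx>\<^sub>m D2 f g u w ((K + ?Q j) + ?Q i) ((K' + ?Q j) + ?Q i)"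
    unfolding D2_def by (intro cong_diff swap)
  also have "\<dots> \<approx>\<^sub>m 0"
    using J K by (intro D2_same[OF f g N']) auto
  finally show ?thesis .
qed

text \<open>As \<delta>^2 = 0, the values c n form an arithmetic progression modulo
  \<open>\<mm>\<close>; over p steps its increment is p times c 1 - c 0, which is zero.\<close>

lemma shift_power:
  assumes f: "lin N f" and g: "lin N g" and N: "N \<ge> CARD('d) * (2 * (q * q))"
    and J: "size J = N" "size J' = N"
  shows "f (s ^ (p * q) * mon_at v J) * g (mon_at v J') \<approx>\<^sub>m f (mon_at v J) * g (s ^ (p * q) * mon_at v J')"
proof -
  define c where "c n = f (s ^ (n * q) * mon_at v J) * g (s ^ ((p - n) * q) * mon_at v J')" for n
  have step: "c (Suc (Suc n)) - c (Suc n) \<approx>\<^sub>m c (Suc n) - c n" if n: "n + 2 \<le> p" for n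
  proof -
    have e: "Suc (Suc n) * q = n * q + q + q" "Suc n * q = n * q + q"
      by (simp_all add: algebra_simps)
    obtain k where k: "p = n + 2 + k" using n le_Suc_ex by blast
    have e': "(p - Suc (Suc n)) * q = k * q" "(p - Suc n) * q = k * q + q" "(p - n) * q = k * q + q + q"
      unfolding k by (simp_all add: algebra_simps)
    show ?thesis
      using D2_zero[OF f g N J, of "n * q" "k * q"]
      unfolding D2_def D1_def c_def e e' cong_diff_0_iff .
  qed
  have d: "c (Suc n) - c n \<approx>\<^sub>m c 1 - c 0" if "n < p" for n
    using that
  proof (induction n)
    case (Suc n)
    have "c (Suc (Suc n)) - c (Suc n) \<approx>\<^sub>m c (Suc n) - c n" using Suc.prems by (intro step) simp
    also have "\<dots> \<approx>\<^sub>m c 1 - c 0" using Suc by simp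
    finally show ?case .
  qed simp
  have "c p - c 0 = (\<Sum>n<p. c (Suc n) - c n)" by (rule sum_lessThan_telescope[symmetric])
  also have "\<dots> \<approx>\<^sub>m (\<Sum>n<p. c 1 - c 0)" by (intro cong_sum d) simp
  also have "\<dots> = of_nat CHAR('a) * (c 1 - c 0)" by (simp add: char)
  also have "\<dots> = 0" by (simp only: of_nat_CHAR mult_zero_left)
  finally show ?thesis by (simp add: c_def cong_diff_0_iff)
qed

lemma contradiction: False
proof -
  define N where "N = CARD('d) * (2 * (q * q))"
  have "q \<le> 2 * (q * q)" by (cases q) auto
  then have N: "N \<ge> CARD('d) * q" unfolding N_def by (rule mult_left_mono) simp
  let ?E = "{I :: 'd multiset. size I = N}"
  obtain i0 where i0: "v i0 \<noteq> 0" using v_ne_0 by blast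
  have nonunit_mm: "r \<in> \<mm>" if "r \<in> R" "r = 0 \<or> inverse r \<notin> R" for r
  proof (rule integral_imp_mm[of ?E "mon_at v", OF _ _ _ that])
    show "\<exists>I\<in>?E. mon_at v I \<noteq> 0"
      by (rule bexI[of _ "replicate_mset N i0"]) (simp_all add: i0)
    fix I assume "I \<in> ?E"
    then have "s * mon_at v I \<in> Forms N" using N by (intro Forms_s Forms_mon) auto
    then show "\<exists>\<mu>. (\<forall>j\<in>?E. \<mu> j \<in> R) \<and> s * mon_at v I = (\<Sum>j\<in>?E. \<mu> j * mon_at v j)"
      unfolding Forms_def by blast
  qed simp
  \<comment> \<open>The generators are values of monomials, not multisets, because different
    multisets may have the same value at v. A generating set of least cardinality is chosen, as in
    Nakayama's lemma.\<close>
  define gen where "gen G \<longleftrightarrow> G \<subseteq> mon_at v ` ?E \<and>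
    (\<forall>a\<in>Forms N. \<exists>c. (\<forall>l. c l \<in> R) \<and> a = (\<Sum>l\<in>G. c l * l))" for G
  have "gen (mon_at v ` ?E)"
    unfolding gen_def
  proof (intro conjI ballI)
    fix a assume "a \<in> Forms N"
    then obtain c where c: "\<forall>I. c I \<in> R" "a = (\<Sum>I\<in>?E. c I * mon_at v I)" unfolding Forms_def by blast
    have "a = (\<Sum>l\<in>mon_at v ` ?E. \<Sum>I\<in>{I\<in>?E. mon_at v I = l}. c I * mon_at v I)"
      unfolding c(2) by (rule sum.image_gen) simp
    also have "\<dots> = (\<Sum>l\<in>mon_at v ` ?E. (\<Sum>I\<in>{I\<in>?E. mon_at v I = l}. c I) * l)"
      by (intro sum.cong refl) (simp add: sum_distrib_right)
    finally show "\<exists>c. (\<forall>l. c l \<in> R) \<and> a = (\<Sum>l\<in>mon_at v ` ?E. c l * l)"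
      using c(1) by (intro exI[of _ "\<lambda>l. \<Sum>I\<in>{I\<in>?E. mon_at v I = l}. c I"]) (auto intro!: subring_sum[OF ring])
  qed simp
  then obtain G where G: "gen G" and least: "\<And>G'. gen G' \<Longrightarrow> card G \<le> card G'"
    using ex_has_least_nat[of gen "mon_at v ` ?E" card] by blast
  have G_sub: "G \<subseteq> mon_at v ` ?E" using G unfolding gen_def by blast
  then have fin: "finite G" by (rule finite_subset) simp
  have G_Forms: "l \<in> Forms N" if "l \<in> G" for l using G_sub that by auto
  have relation: "c l0 \<in> \<mm>" if c: "\<And>l. c l \<in> R" and zero: "(\<Sum>l\<in>G. c l * l) = 0" and l0: "l0 \<in> G" for c l0
  proof (rule ccontr)
    assume "c l0 \<notin> \<mm>"
    then have unit: "c l0 \<noteq> 0" "inverse (c l0) \<in> R" using nonunit_mm[OF c[of l0]] by auto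
    have "c l0 * l0 = - (\<Sum>l\<in>G - {l0}. c l * l)"
      using zero sum.remove[OF fin l0, of "\<lambda>l. c l * l"] by (simp add: eq_neg_iff_add_eq_0)
    then have "inverse (c l0) * (c l0 * l0) = inverse (c l0) * - (\<Sum>l\<in>G - {l0}. c l * l)" by simp
    then have l0_eq: "l0 = (\<Sum>l\<in>G - {l0}. (- inverse (c l0) * c l) * l)"
      using unit(1) by (simp add: sum_distrib_left mult.assoc sum_negf flip: mult.assoc[of "inverse (c l0)" "c l0" l0])
    have "gen (G - {l0})"
      unfolding gen_def
    proof (intro conjI ballI)
      fix a assume "a \<in> Forms N"
      then obtain d where d: "\<And>l. d l \<in> R" "a = (\<Sum>l\<in>G. d l * l)" using G unfolding gen_def by blast
      have "a = d l0 * l0 + (\<Sum>l\<in>G - {l0}. d l * l)"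
        unfolding d(2) using fin l0 by (simp add: sum.remove)
      also have "\<dots> = (\<Sum>l\<in>G - {l0}. (d l0 * (- inverse (c l0) * c l) + d l) * l)"
        using arg_cong[OF l0_eq, of "\<lambda>x. d l0 * x"]
        by (simp only: sum_distrib_left distrib_right sum.distrib mult.assoc)
      finally show "\<exists>c. (\<forall>l. c l \<in> R) \<and> a = (\<Sum>l\<in>G - {l0}. c l * l)"
        using d(1) c unit(2) by (intro exI[of _ "\<lambda>l. d l0 * (- inverse (c l0) * c l) + d l"]) auto
    qed (use G_sub in auto)
    then have "card G \<le> card (G - {l0})" by (rule least)
    then show False using card_Diff1_less[OF fin l0] by simp
  qed
  have "\<forall>a. \<exists>c. a \<in> Forms N \<longrightarrow> (\<forall>l. c l \<in> R) \<and> a = (\<Sum>l\<in>G. c l * l)" using G unfolding gen_def by blast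
  then obtain C where C: "\<And>a l. a \<in> Forms N \<Longrightarrow> C a l \<in> R" "\<And>a. a \<in> Forms N \<Longrightarrow> a = (\<Sum>l\<in>G. C a l * l)"
    by metis
  have unique: "C a l \<approx>\<^sub>m c l" if "a \<in> Forms N" "\<And>l. c l \<in> R" "a = (\<Sum>l\<in>G. c l * l)" "l \<in> G" for a c l
  proof -
    have "(\<Sum>l\<in>G. (C a l - c l) * l) = (\<Sum>l\<in>G. C a l * l) - (\<Sum>l\<in>G. c l * l)"
      by (simp add: left_diff_distrib sum_subtractf)
    also have "\<dots> = 0" using C(2)[OF that(1)] that(3) by simp
    finally have "C a l - c l \<in> \<mm>"
      using C(1)[OF that(1)] that(2,4) by (intro relation[of "\<lambda>l. C a l - c l"]) auto
    then show ?thesis by (simp add: cong_def)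
  qed
  have lin: "lin N (\<lambda>a. C a l)" if l: "l \<in> G" for l
    unfolding lin_def
  proof (intro conjI ballI)
    fix a assume a: "a \<in> Forms N"
    show "C a l \<in> R" by (rule C(1)[OF a])
    show "C (a + b) l \<approx>\<^sub>m C a l + C b l" if b: "b \<in> Forms N" for b
    proof (rule unique[OF _ _ _ l])
      show "a + b = (\<Sum>l\<in>G. (C a l + C b l) * l)"
        using C(2)[OF a] C(2)[OF b] by (simp add: distrib_right sum.distrib)
    qed (use a b C(1) in auto)
    show "C (r * a) l \<approx>\<^sub>m r * C a l" if r: "r \<in> R" for r
    proof (rule unique[OF _ _ _ l])
      show "r * a = (\<Sum>l\<in>G. (r * C a l) * l)"
        by (subst C(2)[OF a]) (simp add: sum_distrib_left mult.assoc)
    qed (use a r C(1) in auto)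
  qed
  have C_gen: "C l' l \<approx>\<^sub>m (if l = l' then 1 else 0)" if "l' \<in> G" "l \<in> G" for l l'
    by (rule unique[OF G_Forms[OF that(1)] _ _ that(2)])
       (use that fin in \<open>auto simp: if_distrib[of "\<lambda>x. x * _"] sum.delta cong: if_cong\<close>)
  have "G \<noteq> {}"
  proof
    assume "G = {}"
    then have "mon_at v (replicate_mset N i0) = 0"
      using C(2)[OF Forms_mon[of "replicate_mset N i0" N]] by simp
    then show False using i0 by simp
  qed
  then obtain j0 where j0: "j0 \<in> G" by blast
  define u where "u = s ^ (p * q)"
  have u_Forms: "u * l \<in> Forms N" if "l \<in> G" for l
    unfolding u_def using Forms_s_power[OF G_Forms[OF that] N] .
  define a0 where "a0 = C (u * j0) j0"
  have a0: "a0 \<in> R" unfolding a0_def using C(1) u_Forms[OF j0] by simp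
  \<comment> \<open>\<open>shift_power\<close> for the coordinates at l and j0, applied to l' and
    j0, compares the matrix of u with the identity matrix: modulo \<open>\<mm>\<close>, u acts as
    the scalar a0.\<close>
  have diag: "C (u * l') l - (if l = l' then a0 else 0) \<in> \<mm>" if l: "l' \<in> G" "l \<in> G" for l l'
  proof -
    obtain J J' where J: "size J = N" "l' = mon_at v J" "size J' = N" "j0 = mon_at v J'"
      using G_sub l(1) j0 by blast
    have R: "C (u * l') l \<in> R" using C(1) u_Forms l by simp
    have "C (u * l') l = C (u * l') l * 1" by simp
    also have "\<dots> \<approx>\<^sub>m C (u * l') l * C j0 j0"
      using C_gen[OF j0 j0] by (intro cong_mult_left[OF R] cong_sym[of "C j0 j0"]) simp
    also have "\<dots> \<approx>\<^sub>m C l' l * C (u * j0) j0"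
      using shift_power[OF lin[OF l(2)] lin[OF j0] _ J(1,3)] unfolding u_def J(2,4) N_def by simp
    also have "\<dots> \<approx>\<^sub>m (if l = l' then 1 else 0) * C (u * j0) j0"
      using C_gen[OF l] a0 unfolding a0_def by (intro cong_mult_right) auto
    also have "\<dots> = (if l = l' then a0 else 0)" by (simp add: a0_def)
    finally show ?thesis by (simp add: cong_def)
  qed
  define z where "z = u - a0"
  have z_mm: "z ^ k * a \<in> \<mm>" if "a \<in> \<mm>" for k a
  proof (induction k)
    case (Suc k)
    have "u * (z ^ k * a) - a0 * (z ^ k * a) \<in> \<mm>"
      unfolding u_def by (rule mm_diff[OF mm_s_power[OF Suc] mm_mult_left[OF a0 Suc]])
    then show ?case by (simp add: z_def algebra_simps)
  qed (simp add: that)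
  \<comment> \<open>z maps every generator into \<open>\<mm>\<close> times the module, and powers of
    z preserve \<open>\<mm>\<close> because s does.\<close>
  have "\<exists>k\<ge>1. z ^ k \<in> \<mm>"
  proof (rule elimination[where Q = "\<lambda>_. \<mm>" and k = 1 and G = G and e = "\<lambda>l. l"])
    show "\<exists>l\<in>G. l \<noteq> 0"
    proof (rule ccontr)
      assume "\<not> ?thesis"
      then have "(\<Sum>l\<in>G. 1 * l) = 0" by (intro sum.neutral) auto
      then have "1 \<in> \<mm>" using relation[of "\<lambda>_. 1"] j0 by auto
      then have "1 * s ^ 1 \<in> R" unfolding \<mm>_def by blast
      then show False using s_notin by simp
    qed
    fix l assume l: "l \<in> G"
    let ?\<mu> = "\<lambda>j. C (u * l) j - (if j = l then a0 else 0)"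
    have "z ^ 1 * l = (\<Sum>j\<in>G. C (u * l) j * j) - a0 * l"
      using C(2)[OF u_Forms[OF l]] by (simp add: z_def left_diff_distrib)
    also have "a0 * l = (\<Sum>j\<in>G. (if j = l then a0 else 0) * j)"
      using fin l by (simp add: if_distrib[of "\<lambda>x. x * _"] sum.delta cong: if_cong)
    finally have "z ^ 1 * l = (\<Sum>j\<in>G. ?\<mu> j * j)" by (simp add: left_diff_distrib sum_subtractf)
    then show "\<exists>\<mu>. (\<forall>j\<in>G. \<mu> j \<in> \<mm>) \<and> z ^ 1 * l = (\<Sum>j\<in>G. \<mu> j * j)"
      using diag[OF l] by (intro exI[of _ ?\<mu>]) blast
  qed (use fin z_mm mm_R in auto)
  then obtain k where k: "z ^ k \<in> \<mm>" by blast
  obtain m where m: "p ^ m \<ge> k" using ex_power_ge by blast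
  have "z ^ (p ^ m - k) * z ^ k \<in> R" using mm_R[OF z_mm[OF k]] .
  then have "z ^ (p ^ m) \<in> R" using m by (simp flip: power_add)
  then have "z \<in> R" by (rule root_closedD[OF closed])
  then have "z + a0 \<in> R" using a0 by simp
  then have "s ^ (p ^ Suc e) \<in> R" by (simp add: z_def u_def q)
  then have "s \<in> R" by (rule root_closedD[OF closed])
  then show False using s_notin by simp
qed

end

text \<open>The chart and overlap conditions persist when R is enlarged, so Zorn's lemma may replace
  R by a maximal root-closed subring without s. Root-closedness survives unions of chains because it
  concerns one element at a time.\<close>

theorem root_closed_descent:
  fixes R :: "'a::field set" and v :: "'d::finite \<Rightarrow> 'a"
  assumes prime: "prime p" and char: "CHAR('a) = p"
    and ring: "unital_subring R" and closed: "root_closed p R"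
    and v: "\<exists>i. v i \<noteq> 0" and q: "q = p ^ e"
    and chart: "\<And>i. \<exists>c. (\<forall>I. c I \<in> R) \<and> s * v i ^ q = (\<Sum>I | size I = q. c I * mon_at v I)"
    and overlap: "\<And>i j. i \<noteq> j \<Longrightarrow> v i \<noteq> 0 \<Longrightarrow> v j \<noteq> 0 \<Longrightarrow> overlap_data R s v q i j"
  shows "s \<in> R"
proof (rule ccontr)
  assume s: "s \<notin> R"
  define \<A> where "\<A> = {R'. unital_subring R' \<and> root_closed p R' \<and> R \<subseteq> R' \<and> s \<notin> R'}"
  have "\<exists>M\<in>\<A>. \<forall>X\<in>\<A>. M \<subseteq> X \<longrightarrow> X = M"
  proof (rule subset_Zorn_nonempty)
    show "\<A> \<noteq> {}" using ring closed s unfolding \<A>_def by blast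
    fix \<C> assume ne: "\<C> \<noteq> {}" and chain: "subset.chain \<A> \<C>"
    have \<C>: "unital_subring X" "root_closed p X" "R \<subseteq> X" "s \<notin> X" if "X \<in> \<C>" for X
      using chain that unfolding subset.chain_def \<A>_def by blast+
    have two: "\<exists>X\<in>\<C>. a \<in> X \<and> b \<in> X" if "a \<in> \<Union>\<C>" "b \<in> \<Union>\<C>" for a b
      using that chain unfolding subset.chain_def by blast
    have "unital_subring (\<Union>\<C>)"
      unfolding unital_subring_def
    proof (intro conjI ballI)
      show "1 \<in> \<Union>\<C>" using ne \<C>(1) unital_subringD(1) by blast
      fix a b assume "a \<in> \<Union>\<C>" "b \<in> \<Union>\<C>"
      then obtain X where X: "X \<in> \<C>" "a \<in> X" "b \<in> X" using two by blast
      show "a - b \<in> \<Union>\<C>" "a * b \<in> \<Union>\<C>"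
        using unital_subringD(3,4)[OF \<C>(1)[OF X(1)] X(2,3)] X(1) by blast+
    qed
    moreover have "root_closed p (\<Union>\<C>)" using \<C>(2) unfolding root_closed_def by blast
    ultimately show "\<Union>\<C> \<in> \<A>" unfolding \<A>_def using ne \<C>(3,4) by blast
  qed
  then obtain M where "M \<in> \<A>" and max: "\<And>X. X \<in> \<A> \<Longrightarrow> M \<subseteq> X \<Longrightarrow> X = M" by blast
  then have M: "unital_subring M" "root_closed p M" "R \<subseteq> M" "s \<notin> M" unfolding \<A>_def by blast+
  interpret maximal_avoiding M s p
    by unfold_locales (use M prime char max in \<open>auto simp: \<A>_def\<close>)
  interpret modification M s p v q e
  proof unfold_locales
    show "\<exists>i. v i \<noteq> 0" by (rule v)
    show "q = p ^ e" by (rule q)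
    show "\<exists>c. (\<forall>I. c I \<in> M) \<and> s * v i ^ q = (\<Sum>I | size I = q. c I * mon_at v I)" for i
      using chart[of i] M(3) by blast
    show "overlap_data M s v q i j" if "i \<noteq> j" "v i \<noteq> 0" "v j \<noteq> 0" for i j
      using overlap_data_mono[OF overlap[OF that] M(3)] .
  qed
  show False by (rule contradiction)
qed

section \<open>Homogenized polynomial functions\<close>

lemma ex_null_vector:
  fixes X :: "'r \<Rightarrow> 'd \<Rightarrow> 'a::field"
  assumes "finite T" "finite S" "card T < card S"
  shows "\<exists>v. (\<forall>l. l \<notin> S \<longrightarrow> v l = 0) \<and> (\<exists>l. v l \<noteq> 0) \<and> (\<forall>r\<in>T. (\<Sum>l\<in>S. X r l * v l) = 0)"
  using assms
proof (induction T arbitrary: S X rule: finite_induct)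
  case empty
  then obtain l where "l \<in> S" by fastforce
  then show ?case by (intro exI[of _ "\<lambda>k. if k = l then 1 else 0"]) auto
next
  case (insert r T)
  show ?case
  proof (cases "\<forall>l\<in>S. X r l = 0")
    case True
    obtain v where "\<forall>l. l \<notin> S \<longrightarrow> v l = 0" "\<exists>l. v l \<noteq> 0" "\<forall>r\<in>T. (\<Sum>l\<in>S. X r l * v l) = 0"
      using insert.IH[of S X] insert.prems insert.hyps by auto
    then show ?thesis using True by (intro exI[of _ v]) auto
  next
    case False
    then obtain l0 where l0: "l0 \<in> S" "X r l0 \<noteq> 0" by blast
    define X' where "X' t l = X t l - X t l0 * X r l / X r l0" for t l
    have "card T < card (S - {l0})" using insert.prems insert.hyps l0(1) by simp
    then obtain v where v: "\<And>l. l \<notin> S - {l0} \<Longrightarrow> v l = 0" "\<exists>l. v l \<noteq> 0"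
      "\<And>t. t \<in> T \<Longrightarrow> (\<Sum>l\<in>S - {l0}. X' t l * v l) = 0"
      using insert.IH[of "S - {l0}" X'] insert.prems by blast
    define y where "y = (\<Sum>l\<in>S - {l0}. X r l * v l)"
    define w where "w l = (if l = l0 then - y / X r l0 else v l)" for l
    have sum_w: "(\<Sum>l\<in>S. X t l * w l) = X t l0 * (- y / X r l0) + (\<Sum>l\<in>S - {l0}. X t l * v l)" for t
    proof -
      have "(\<Sum>l\<in>S. X t l * w l) = X t l0 * w l0 + (\<Sum>l\<in>S - {l0}. X t l * w l)"
        using insert.prems l0(1) by (simp add: sum.remove)
      also have "(\<Sum>l\<in>S - {l0}. X t l * w l) = (\<Sum>l\<in>S - {l0}. X t l * v l)"
        by (intro sum.cong) (auto simp: w_def)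
      finally show ?thesis by (simp add: w_def)
    qed
    have "(\<Sum>l\<in>S. X t l * w l) = 0" if t: "t \<in> insert r T" for t
    proof (cases "t = r")
      case True
      then show ?thesis using l0(2) unfolding sum_w by (simp add: y_def)
    next
      case False
      have "0 = (\<Sum>l\<in>S - {l0}. X' t l * v l)" using v(3)[of t] t False by simp
      also have "\<dots> = (\<Sum>l\<in>S - {l0}. X t l * v l) - X t l0 / X r l0 * y"
        unfolding X'_def y_def by (simp add: left_diff_distrib sum_subtractf sum_distrib_left mult.assoc)
      finally show ?thesis unfolding sum_w by simp
    qed
    moreover have "\<exists>l. w l \<noteq> 0" using v(1,2) by (metis DiffE insertI1 w_def)
    moreover have "w l = 0" if "l \<notin> S" for l using that v(1)[of l] l0(1) by (auto simp: w_def)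
    ultimately show ?thesis by blast
  qed
qed

text \<open>The extra coordinate \<open>None\<close> carries the homogenizing variable.\<close>

definition hcoord :: "('n \<Rightarrow> 'd \<Rightarrow> 'a) \<Rightarrow> 'a \<Rightarrow> ('n \<times> 'd) option \<Rightarrow> 'a" where
  "hcoord Y m o' = (case o' of None \<Rightarrow> m | Some (r, l) \<Rightarrow> Y r l)"

lemma hcoord_simps [simp]: "hcoord Y m None = m" "hcoord Y m (Some (r, l)) = Y r l"
  by (simp_all add: hcoord_def)

lemma hcoord_scale: "hcoord (\<lambda>r l. t * Y r l) (t * m) = (\<lambda>o'. t * hcoord Y m o')"
  by (auto simp: hcoord_def split: option.splits)

lemma hcoord_hom: "hcoord (\<lambda>r l. f (Y r l)) (f m) = (\<lambda>o'. f (hcoord Y m o'))"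
  by (auto simp: hcoord_def split: option.splits)

lemma poly_functions_homogenize:
  assumes "F \<in> poly_functions"
  shows "\<exists>D. \<exists>P\<in>polys {I. size I = D}. \<forall>x. F x = P (hcoord (\<lambda>r l. x $ r $ l) 1)"
  using assms
proof (induction rule: poly_functions.induct)
  case (const a)
  have "(\<lambda>V. a * mon_at V {#}) \<in> polys {I. size I = 0}"
    by (intro polys_scale polys_mon) auto
  then show ?case by (intro exI[of _ 0] bexI) auto
next
  case (coord i c)
  have "(\<lambda>V. mon_at V {#Some (i, c)#}) \<in> polys {I. size I = 1}"
    by (intro polys_mon) auto
  then show ?case by (intro exI[of _ 1] bexI) auto
next
  case (add F G)
  then obtain D P E Q where P: "P \<in> polys {I. size I = D}" "\<And>x. F x = P (hcoord (\<lambda>r l. x $ r $ l) 1)"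
    and Q: "Q \<in> polys {I. size I = E}" "\<And>x. G x = Q (hcoord (\<lambda>r l. x $ r $ l) 1)" by blast
  have "(\<lambda>V. P V * mon_at V (replicate_mset E None)) \<in> polys {I. size I = D + E}"
    by (rule polys_mult[OF P(1) polys_mon[where E = "{I. size I = E}"]]) auto
  moreover have "(\<lambda>V. Q V * mon_at V (replicate_mset D None)) \<in> polys {I. size I = D + E}"
    by (rule polys_mult[OF Q(1) polys_mon[where E = "{I. size I = D}"]]) auto
  ultimately have "(\<lambda>V. P V * mon_at V (replicate_mset E None) + Q V * mon_at V (replicate_mset D None))
      \<in> polys {I. size I = D + E}" by (intro polys_add) auto
  then show ?case using P(2) Q(2) by (intro exI[of _ "D + E"] bexI) auto
next
  case (mult F G)
  then obtain D P E Q where P: "P \<in> polys {I. size I = D}" "\<And>x. F x = P (hcoord (\<lambda>r l. x $ r $ l) 1)"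
    and Q: "Q \<in> polys {I. size I = E}" "\<And>x. G x = Q (hcoord (\<lambda>r l. x $ r $ l) 1)" by blast
  have "(\<lambda>V. P V * Q V) \<in> polys {I. size I = D + E}"
    by (rule polys_mult[OF P(1) Q(1)]) auto
  then show ?case using P(2) Q(2) by (intro exI[of _ "D + E"] bexI) auto
qed

section \<open>Bihomogeneous forms\<close>

definition biforms :: "nat \<Rightarrow> (('d::finite \<Rightarrow> 'a::comm_ring_1) \<Rightarrow> ('d \<Rightarrow> 'a) \<Rightarrow> 'a) set" where
  "biforms D = {P. \<exists>c. \<forall>V W. P V W = (\<Sum>I | size I = D. \<Sum>J | size J = D. c I J * mon_at V I * mon_at W J)}"

lemma biformsI:
  "(\<And>V W. P V W = (\<Sum>I | size I = D. \<Sum>J | size J = D. c I J * mon_at V I * mon_at W J)) \<Longrightarrow> P \<in> biforms D"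
  unfolding biforms_def by blast

lemma biforms_add:
  assumes "P \<in> biforms D" "Q \<in> biforms D"
  shows "(\<lambda>V W. P V W + Q V W) \<in> biforms D"
proof -
  from assms obtain c d where "\<And>V W. P V W = (\<Sum>I | size I = D. \<Sum>J | size J = D. c I J * mon_at V I * mon_at W J)"
    "\<And>V W. Q V W = (\<Sum>I | size I = D. \<Sum>J | size J = D. d I J * mon_at V I * mon_at W J)"
    unfolding biforms_def by blast
  then show ?thesis by (intro biformsI[where c = "\<lambda>I J. c I J + d I J"]) (simp add: distrib_right sum.distrib)
qed

lemma biforms_scale:
  assumes "P \<in> biforms D"
  shows "(\<lambda>V W. a * P V W) \<in> biforms D"
proof -
  from assms obtain c where "\<And>V W. P V W = (\<Sum>I | size I = D. \<Sum>J | size J = D. c I J * mon_at V I * mon_at W J)"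
    unfolding biforms_def by blast
  then show ?thesis by (intro biformsI[where c = "\<lambda>I J. a * c I J"]) (simp add: sum_distrib_left mult.assoc)
qed

lemma biforms_diff: "P \<in> biforms D \<Longrightarrow> Q \<in> biforms D \<Longrightarrow> (\<lambda>V W. P V W - Q V W) \<in> biforms D"
  using biforms_add[of P D "\<lambda>V W. (-1) * Q V W"] biforms_scale[of Q D "-1"] by simp

lemma biforms_zero: "(\<lambda>V W. 0) \<in> biforms D"
  by (rule biformsI[where c = "\<lambda>_ _. 0"]) simp

lemma biforms_sum: "(\<And>t. t \<in> T \<Longrightarrow> P t \<in> biforms D) \<Longrightarrow> (\<lambda>V W. \<Sum>t\<in>T. P t V W) \<in> biforms D"
  by (induction T rule: infinite_finite_induct) (auto intro: biforms_zero biforms_add)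

lemma biforms_mon:
  assumes "size K = D" "size L = D"
  shows "(\<lambda>V W. mon_at V K * mon_at W L) \<in> biforms D"
proof (rule biformsI[where c = "\<lambda>I J. if I = K then if J = L then 1 else 0 else 0"])
  fix V W :: "'a \<Rightarrow> 'b"
  have "(\<Sum>J | size J = D. (if I = K then if J = L then 1 else 0 else 0) * mon_at V I * mon_at W J)
      = (if I = K then mon_at V I * mon_at W L else 0)" for I
    using assms by (simp add: if_distrib[of "\<lambda>x. x * _"] sum.delta cong: if_cong)
  then show "mon_at V K * mon_at W L = (\<Sum>I | size I = D. \<Sum>J | size J = D.
      (if I = K then if J = L then 1 else 0 else 0) * mon_at V I * mon_at W J)"
    using assms by (simp add: sum.delta)
qed

lemma biforms_mult:
  assumes "P \<in> biforms D" "Q \<in> biforms E"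
  shows "(\<lambda>V W. P V W * Q V W) \<in> biforms (D + E)"
proof -
  from assms obtain c d where c: "\<And>V W. P V W = (\<Sum>I | size I = D. \<Sum>J | size J = D. c I J * mon_at V I * mon_at W J)"
    and d: "\<And>V W. Q V W = (\<Sum>I | size I = E. \<Sum>J | size J = E. d I J * mon_at V I * mon_at W J)"
    unfolding biforms_def by blast
  have eq: "P V W * Q V W = (\<Sum>I | size I = D. \<Sum>K | size K = E. \<Sum>J | size J = D. \<Sum>L | size L = E.
      (c I J * d K L) * (mon_at V (I + K) * mon_at W (J + L)))" for V W
    unfolding c d by (simp add: sum_product ac_simps)
  show ?thesis
    unfolding eq by (intro biforms_sum biforms_scale biforms_mon) auto
qed

lemma biforms_one: "(\<lambda>V W. 1) \<in> biforms 0"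
  using biforms_mon[of "{#}" 0 "{#}"] by simp

lemma biforms_power: "P \<in> biforms 1 \<Longrightarrow> (\<lambda>V W. P V W ^ n) \<in> biforms n"
  by (induction n) (use biforms_one biforms_mult[of P 1] in auto)

lemma biforms_mon_hcoord:
  assumes "\<And>r l. Y r l \<in> biforms 1" "m \<in> biforms 1"
  shows "(\<lambda>V W. mon_at (hcoord (\<lambda>r l. Y r l V W) (m V W)) I) \<in> biforms (size I)"
proof (induction I)
  case (add o' I)
  have "(\<lambda>V W. hcoord (\<lambda>r l. Y r l V W) (m V W) o') \<in> biforms 1"
    by (cases o') (use assms in \<open>auto simp: hcoord_def split: prod.splits\<close>)
  from biforms_mult[OF this add] show ?case by simp
qed (simp add: biforms_one)

section \<open>Polarization\<close>

lemma mat_poly_eqI: "(\<And>x. value_at F x = value_at G x) \<Longrightarrow> F = G"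
  by (simp add: value_at_inject[symmetric] fun_eq_iff)

lemma value_at_simps [simp]:
  "value_at (F + G) x = value_at F x + value_at G x"
  "value_at (F * G) x = value_at F x * value_at G x"
  "value_at (F - G) x = value_at F x - value_at G x"
  "value_at (- F) x = - value_at F x"
  "value_at 0 x = 0" "value_at 1 x = 1"
  "value_at (const_poly a) x = a"
  by (simp_all add: plus_mat_poly.rep_eq times_mat_poly.rep_eq minus_mat_poly.rep_eq
      uminus_mat_poly.rep_eq zero_mat_poly.rep_eq one_mat_poly.rep_eq const_poly.rep_eq)

lemma value_at_right_act [simp]: "value_at (right_act g F) x = value_at F (x ** g)"
  and value_at_left_act [simp]: "value_at (left_act h F) x = value_at F (matrix_inv h ** x)"
  and value_at_first_cols [simp]: "value_at (first_cols \<sigma> f) x = value_at f (\<chi> i c. x $ i $ \<sigma> c)"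
  by (simp_all add: right_act.rep_eq left_act.rep_eq first_cols.rep_eq)

lemma value_at_power [simp]: "value_at (F ^ n) x = value_at F x ^ n"
  by (induction n) simp_all

lemma value_at_sum [simp]: "value_at (\<Sum>i\<in>T. f i) x = (\<Sum>i\<in>T. value_at (f i) x)"
  by (induction T rule: infinite_finite_induct) simp_all

lemma value_at_mon [simp]: "value_at (mon_at V I) x = mon_at (\<lambda>i. value_at (V i) x) I"
  by (induction I) simp_all

lift_definition coord_poly :: "'n \<Rightarrow> 'd \<Rightarrow> ('k::comm_ring_1, 'n::finite, 'd::finite) mat_poly"
  is "\<lambda>i c x. x $ i $ c"
  by (rule poly_functions.coord)

lemma value_at_coord [simp]: "value_at (coord_poly i c) x = x $ i $ c"
  by (simp add: coord_poly.rep_eq)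

lemma subalgebra_imp_subring:
  assumes "subalgebra A"
  shows "unital_subring A"
proof -
  have c: "const_poly a \<in> A" and add: "F \<in> A \<Longrightarrow> G \<in> A \<Longrightarrow> F + G \<in> A"
    and mult: "F \<in> A \<Longrightarrow> G \<in> A \<Longrightarrow> F * G \<in> A" for a F G
    using assms unfolding subalgebra_def by auto
  have "const_poly 1 = (1 :: ('a, 'b, 'c) mat_poly)" by (rule mat_poly_eqI) simp
  then have "1 \<in> A" using c[of 1] by simp
  moreover have "F - G \<in> A" if "F \<in> A" "G \<in> A" for F G
  proof -
    have "F - G = F + const_poly (-1) * G" by (rule mat_poly_eqI) simp
    then show ?thesis using add[OF that(1) mult[OF c that(2)]] by metis
  qed
  ultimately show ?thesis using mult unfolding unital_subring_def by blast
qed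

lemma subalgebra_hull: "subalgebra (subalgebra hull S)"
  proof (rule hull_in)
  fix T :: "('a, 'b, 'c) mat_poly set set" assume "Ball T subalgebra"
  then show "subalgebra (\<Inter>T)" by (simp add: subalgebra_def subset_iff)
qed

lemma invariants_iff:
  "F \<in> invariants H \<longleftrightarrow> (\<forall>h\<in>H. \<forall>x. value_at F (matrix_inv h ** x) = value_at F x)"
  by (simp add: invariants_def value_at_inject[symmetric] fun_eq_iff)

lemma subalgebra_invariants: "subalgebra (invariants H)"
  by (auto simp: subalgebra_def invariants_iff)

definition sc :: "'k::alg_closed_field \<Rightarrow> ('k, 'n::finite, 'd::finite) mat_poly fract" where
  "sc a = to_fract (const_poly a)"

interpretation sc: scalars "sc :: 'k::alg_closed_field \<Rightarrow> ('k, 'n::finite, 'd::finite) mat_poly fract"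
proof
  fix a b :: 'k
  let ?sc = "sc :: 'k \<Rightarrow> ('k, 'n, 'd) mat_poly fract"
  show "?sc (a + b) = ?sc a + ?sc b"
    unfolding sc_def to_fract_add[symmetric] by (rule arg_cong[where f = to_fract], rule mat_poly_eqI) simp
  show "?sc (a * b) = ?sc a * ?sc b"
    unfolding sc_def to_fract_mult[symmetric] by (rule arg_cong[where f = to_fract], rule mat_poly_eqI) simp
  show "?sc 1 = 1"
    unfolding sc_def to_fract_1[symmetric] by (rule arg_cong[where f = to_fract], rule mat_poly_eqI) simp
qed (rule infinite_alg_closed_field)

lemma to_fract_mon: "mon_at (\<lambda>i. to_fract (V i)) I = to_fract (mon_at V I)"
  by (rule mon_hom[where f = to_fract]) simp_all

lemma to_fract_power: "to_fract (a ^ n) = to_fract a ^ n"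
  by (induction n) simp_all

section \<open>Homogenized values over the function field\<close>

definition homogenizes :: "(('n \<times> 'd) option multiset \<Rightarrow> 'k) \<Rightarrow> nat \<Rightarrow>
    ('k::comm_ring_1, 'n::finite, 'd::finite) mat_poly \<Rightarrow> bool" where
  "homogenizes \<kappa> D F \<longleftrightarrow>
    (\<forall>x. value_at F x = (\<Sum>I | size I = D. \<kappa> I * mon_at (hcoord (\<lambda>r l. x $ r $ l) 1) I))"

lemma ex_homogenizes: "\<exists>\<kappa> D. homogenizes \<kappa> D F"
proof -
  have "value_at F \<in> poly_functions" by (rule value_at)
  from poly_functions_homogenize[OF this] obtain D P
    where P: "P \<in> polys {I. size I = D}" "\<And>x. value_at F x = P (hcoord (\<lambda>r l. x $ r $ l) 1)"
    by blast
  from polysD[OF P(1)] obtain c where "\<And>V. P V = (\<Sum>I | size I = D. c I * mon_at V I)" by blast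
  then have "homogenizes c D F" by (simp add: homogenizes_def P(2))
  then show ?thesis by blast
qed

text \<open>For m \<noteq> 0 and F homogenized by \<kappa> in degree D, this is m^D F(Y / m).
  Matrices with the common denominator m can thus be inserted without division.\<close>

definition hval :: "(('n \<times> 'd) option multiset \<Rightarrow> 'k) \<Rightarrow> nat \<Rightarrow>
    ('n \<Rightarrow> 'd \<Rightarrow> ('k::alg_closed_field, 'm::finite, 'e::finite) mat_poly fract) \<Rightarrow>
    ('k, 'm, 'e) mat_poly fract \<Rightarrow> ('k, 'm, 'e) mat_poly fract" where
  "hval \<kappa> D Y m = (\<Sum>I | size I = D. sc (\<kappa> I) * mon_at (hcoord Y m) I)"

lemma hval_scale: "hval \<kappa> D (\<lambda>r l. t * Y r l) (t * m) = t ^ D * hval \<kappa> D Y m"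
  unfolding hval_def hcoord_scale by (simp add: mon_scale sum_distrib_left ac_simps)

lemma vec_nth_vec_lambda [simp]: "($) (vec_lambda f) = f"
  by (rule ext) simp

lemma hval_to_fract:
  fixes F :: "('k::alg_closed_field, 'n::finite, 'd::finite) mat_poly"
  assumes "homogenizes \<kappa> D F" and "\<And>r l. Y r l = to_fract (\<phi> r l)"
    and "\<And>x. value_at G x = value_at F (\<chi> r l. value_at (\<phi> r l) x)"
  shows "hval \<kappa> D Y 1 = to_fract G"
proof -
  have "hcoord Y 1 = (\<lambda>o'. to_fract (hcoord \<phi> 1 o'))"
    unfolding hcoord_hom[of to_fract, symmetric] using assms(2)
    by (simp add: hcoord_def fun_eq_iff split: option.splits)
  then have "hval \<kappa> D Y 1 = to_fract (\<Sum>I | size I = D. const_poly (\<kappa> I) * mon_at (hcoord \<phi> 1) I)"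
    unfolding hval_def by (simp add: to_fract_mon to_fract_sum sc_def)
  also have "(\<Sum>I | size I = D. const_poly (\<kappa> I) * mon_at (hcoord \<phi> 1) I) = G"
  proof (rule mat_poly_eqI)
    fix x
    have "(\<lambda>o'. value_at (hcoord \<phi> 1 o') x) = hcoord (\<lambda>r l. value_at (\<phi> r l) x) 1"
      unfolding hcoord_hom[of "\<lambda>F. value_at F x", symmetric] by (simp add: hcoord_def fun_eq_iff split: option.splits)
    then show "value_at (\<Sum>I | size I = D. const_poly (\<kappa> I) * mon_at (hcoord \<phi> 1) I) x = value_at G x"
      using assms(1) unfolding assms(3) homogenizes_def by simp
  qed
  finally show ?thesis .
qed

definition gen_coord :: "'n \<Rightarrow> 'd \<Rightarrow> ('k::alg_closed_field, 'n::finite, 'd::finite) mat_poly fract" where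
  "gen_coord r l = to_fract (coord_poly r l)"

lemma hval_right_act:
  fixes F :: "('k::alg_closed_field, 'n::finite, 'd::finite) mat_poly"
  assumes "homogenizes \<kappa> D F"
  shows "hval \<kappa> D (\<lambda>r l. \<Sum>k\<in>UNIV. gen_coord r k * sc (g $ k $ l)) 1 = to_fract (right_act g F)"
proof (rule hval_to_fract[OF assms])
  show "(\<Sum>k\<in>UNIV. gen_coord r k * sc (g $ k $ l))
      = to_fract (\<Sum>k\<in>UNIV. coord_poly r k * const_poly (g $ k $ l))" for r :: 'n and l
    by (simp add: gen_coord_def sc_def to_fract_sum)
  show "value_at (right_act g F) x
      = value_at F (\<chi> r l. value_at (\<Sum>k\<in>UNIV. coord_poly r k * const_poly (g $ k $ l)) x)" for x
    by (simp add: matrix_matrix_mult_def)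
qed

lemma det_poly_function: "(\<lambda>g :: 'k::field^'d::finite^'d. det g) \<in> poly_functions"
proof -
  have prod: "(\<lambda>g :: 'k^'d^'d. \<Prod>i\<in>T. g $ i $ p i) \<in> poly_functions" for T :: "'d set" and p
    by (induction T rule: infinite_finite_induct) (auto intro: poly_functions.intros)
  show ?thesis
    unfolding det_def by (intro poly_functions_sum poly_functions.mult poly_functions.const prod)
qed

text \<open>On this line the determinant is a polynomial in t with value 1 at t = 0.\<close>

lemma finite_singular_on_line:
  fixes g :: "'k::field^'d::finite^'d"
  shows "finite {t. det (\<chi> i c. mat 1 $ i $ c + t * (g - mat 1) $ i $ c) = 0}"
proof -
  obtain P where P: "\<And>t. det (\<chi> i c. (mat 1 :: 'k^'d^'d) $ i $ c + t * (g - mat 1) $ i $ c) = poly P t"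
    using poly_function_on_line[OF det_poly_function, of "mat 1" "g - mat 1"] by blast
  have "(\<chi> i c. (mat 1 :: 'k^'d^'d) $ i $ c + 0 * (g - mat 1) $ i $ c) = mat 1"
    by (simp add: vec_eq_iff)
  then have "poly P 0 = 1" using P[of 0] by simp
  then have "P \<noteq> 0" by auto
  then show ?thesis using poly_roots_finite[of P] P by simp
qed

lemma sum_in_set:
  "0 \<in> A \<Longrightarrow> (\<And>a b. a \<in> A \<Longrightarrow> b \<in> A \<Longrightarrow> a + b \<in> A) \<Longrightarrow> (\<And>i. i \<in> T \<Longrightarrow> f i \<in> A) \<Longrightarrow> sum f T \<in> A"
  by (induction T rule: infinite_finite_induct) auto

section \<open>The invariants S and the polarized algebra R\<close>

locale polarization =
  fixes H :: "('k::alg_closed_field^'n::finite^'n) set" and \<sigma> :: "'n \<Rightarrow> 'd::finite"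
  assumes inj_\<sigma>: "inj \<sigma>"
begin

definition S :: "('k, 'n, 'd) mat_poly set" where "S = invariants H"
definition R :: "('k, 'n, 'd) mat_poly set" where "R = polarized_algebra \<sigma> (invariants H)"

lemma subalgebra_R: "subalgebra R"
  unfolding R_def polarized_algebra_def by (rule subalgebra_hull)

lemma subalgebra_S: "subalgebra S"
  unfolding S_def by (rule subalgebra_invariants)

lemmas subring_R = subalgebra_imp_subring[OF subalgebra_R]
  and subring_S = subalgebra_imp_subring[OF subalgebra_S]

lemma S_iff: "F \<in> S \<longleftrightarrow> (\<forall>h\<in>H. \<forall>x. value_at F (matrix_inv h ** x) = value_at F x)"
  unfolding S_def by (rule invariants_iff)

lemma right_act_S: "F \<in> S \<Longrightarrow> right_act g F \<in> S"
  unfolding S_iff by (simp flip: matrix_mul_assoc)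

lemma R_subset_S: "R \<subseteq> S"
  unfolding R_def polarized_algebra_def
proof (rule hull_minimal[where S = subalgebra, OF _ subalgebra_S], safe)
  fix g :: "'k^'d^'d" and f :: "('k, 'n, 'n) mat_poly"
  assume f: "f \<in> invariants H"
  have "value_at f (matrix_inv h ** x) = value_at f x" if "h \<in> H" for h x
    using f that unfolding invariants_iff by blast
  moreover have "(\<chi> i c. (h ** x) $ i $ \<sigma> c) = h ** (\<chi> i c. x $ i $ \<sigma> c)" for h :: "'k^'n^'n" and x :: "'k^'d^'n"
    by (simp add: vec_eq_iff matrix_matrix_mult_def)
  ultimately have "first_cols \<sigma> f \<in> S" unfolding S_iff value_at_first_cols by metis
  then show "right_act g (first_cols \<sigma> f) \<in> S" by (rule right_act_S)
qed

lemma subsp_to_fract: "subalgebra A \<Longrightarrow> sc.subsp (to_fract ` A)"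
  unfolding sc.subsp_def sc_def
proof (intro conjI ballI allI)
  assume A: "subalgebra A"
  note ring = subalgebra_imp_subring[OF A]
  show "0 \<in> to_fract ` A" using unital_subringD(2)[OF ring] by (metis image_eqI to_fract_0)
  fix a b c assume "a \<in> to_fract ` A" "b \<in> to_fract ` A"
  then obtain F G where FG: "a = to_fract F" "b = to_fract G" "F \<in> A" "G \<in> A" by blast
  have "F + G \<in> A" "const_poly c * F \<in> A" using FG(3,4) A unfolding subalgebra_def by blast+
  then show "a + b \<in> to_fract ` A" "to_fract (const_poly c) * a \<in> to_fract ` A"
    unfolding FG to_fract_add[symmetric] to_fract_mult[symmetric] by blast+
qed

lemma subring_to_fract: "unital_subring A \<Longrightarrow> unital_subring (to_fract ` A)"
  unfolding unital_subring_def
  by (auto simp: image_iff simp flip: to_fract_1 to_fract_diff to_fract_mult)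

text \<open>
  Invertibility of \<open>g\<close> can be dropped: all but finitely many matrices on the line through \<open>1\<close> and
  \<open>g\<close> are invertible.
\<close>

lemma generator_R:
  assumes f: "f \<in> invariants H"
  shows "right_act g (first_cols \<sigma> f) \<in> R"
proof -
  define G :: "('k, 'n, 'd) mat_poly" where "G = first_cols \<sigma> f"
  define gt where "gt t = (\<chi> i c. (mat 1 :: 'k^'d^'d) $ i $ c + t * (g - mat 1) $ i $ c)" for t
  define T where "T = - {t. det (gt t) = 0}"
  have "infinite T"
    unfolding T_def gt_def Compl_eq_Diff_UNIV
    by (rule Diff_infinite_finite[OF finite_singular_on_line infinite_alg_closed_field])
  have inv: "right_act (gt t) G \<in> R" if "t \<in> T" for t
  proof -
    have "gt t \<in> carrier GL" using that by (simp add: T_def GL_def invertible_det_nz)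
    then have "right_act (gt t) G \<in> {right_act g (first_cols \<sigma> f) | g f. g \<in> carrier GL \<and> f \<in> invariants H}"
      using f unfolding G_def by blast
    then show ?thesis unfolding R_def polarized_algebra_def by (rule hull_inc)
  qed
  obtain \<kappa> D where \<kappa>: "homogenizes \<kappa> D G" using ex_homogenizes by blast
  define Y where "Y r l = (\<Sum>k\<in>UNIV. [: gen_coord r k * sc ((mat 1 :: 'k^'d^'d) $ k $ l),
      gen_coord r k * sc ((g - mat 1) $ k $ l) :])" for r :: 'n and l
  \<comment> \<open>A polynomial in t over the function field whose value at a scalar t is G(x gt
    t). Membership in R passes from infinitely many values to the coefficients, and from these to
    their sum, which is the value at t = 1.\<close>
  define P where "P = (\<Sum>I | size I = D. [: sc (\<kappa> I) :] * mon_at (hcoord Y 1) I)"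
  have P: "poly P (sc t) = to_fract (right_act (gt t) G)" for t
  proof -
    have "mon_at (hcoord (\<lambda>r l. \<Sum>k\<in>UNIV. gen_coord r k * sc (gt t $ k $ l)) 1) I = poly (mon_at (hcoord Y 1) I) (sc t)" for I
    proof -
      have "poly (mon_at (hcoord Y 1) I) (sc t) = mon_at (\<lambda>o'. poly (hcoord Y 1 o') (sc t)) I"
        by (rule mon_hom[where f = "\<lambda>p. poly p (sc t)", symmetric]) simp_all
      also have "(\<lambda>o'. poly (hcoord Y 1 o') (sc t)) = hcoord (\<lambda>r l. poly (Y r l) (sc t)) (poly 1 (sc t))"
        by (rule hcoord_hom[symmetric])
      also have "\<dots> = hcoord (\<lambda>r l. \<Sum>k\<in>UNIV. gen_coord r k * sc (gt t $ k $ l)) 1"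
        by (simp add: Y_def gt_def poly_sum sc.iota_add sc.iota_mult sc.iota_diff algebra_simps)
      finally show ?thesis by simp
    qed
    then have "poly P (sc t) = hval \<kappa> D (\<lambda>r l. \<Sum>k\<in>UNIV. gen_coord r k * sc (gt t $ k $ l)) 1"
      by (simp add: P_def hval_def poly_sum)
    then show ?thesis by (simp add: hval_right_act[OF \<kappa>])
  qed
  have "coeff P i \<in> to_fract ` R" for i
    by (rule sc.poly_coeff_mem[OF subsp_to_fract[OF subalgebra_R] \<open>infinite T\<close>]) (use P inv in auto)
  then have "(\<Sum>i\<le>degree P. coeff P i) \<in> to_fract ` R"
    using sc.subspD(1,2)[OF subsp_to_fract[OF subalgebra_R]] by (intro sum_in_set) auto
  moreover have "(\<Sum>i\<le>degree P. coeff P i) = to_fract (right_act g G)"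
  proof -
    have "gt 1 = g" by (simp add: gt_def vec_eq_iff)
    then show ?thesis using P[of 1] by (simp add: poly_altdef)
  qed
  ultimately have "to_fract (right_act g G) \<in> to_fract ` R" by simp
  then show ?thesis by (simp add: G_def image_iff)
qed

lemma right_act_R: "F \<in> R \<Longrightarrow> right_act g F \<in> R"
proof -
  have "R \<subseteq> {F. right_act g F \<in> R}"
    unfolding R_def polarized_algebra_def
  proof (rule hull_minimal[where S = subalgebra], fold polarized_algebra_def R_def, safe)
    fix g' :: "'k^'d^'d" and f :: "('k, 'n, 'n) mat_poly"
    assume f: "f \<in> invariants H"
    have "right_act g (right_act g' (first_cols \<sigma> f)) = right_act (g ** g') (first_cols \<sigma> f)"
      by (rule mat_poly_eqI) (simp add: matrix_mul_assoc)
    then show "right_act g (right_act g' (first_cols \<sigma> f)) \<in> R" using generator_R[OF f] by simp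
  next
    have hom: "right_act g (F + G) = right_act g F + right_act g G"
      "right_act g (F * G) = right_act g F * right_act g G" "right_act g (const_poly a) = const_poly a"
      for F G :: "('k, 'n, 'd) mat_poly" and a
      by (rule mat_poly_eqI, simp)+
    show "subalgebra {F. right_act g F \<in> R}"
      using subalgebra_R unfolding subalgebra_def by (auto simp: hom)
  qed
  then show "F \<in> R \<Longrightarrow> right_act g F \<in> R" by blast
qed

text \<open>f(y) = F(y a) is an invariant of square matrices, and x b consists of the columns
  \<sigma> c of x g if g has the columns of b in these places and zeros elsewhere. This g may be
  singular, which is why \<open>generator_R\<close> admits every g.\<close>

lemma low_rank_R:
  fixes b :: "'k^'n^'d" and a :: "'k^'d^'n"
  assumes F: "F \<in> S"
  shows "right_act (b ** a) F \<in> R"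
proof -
  define f :: "('k, 'n, 'n) mat_poly" where "f = Abs_mat_poly (\<lambda>y. value_at F (y ** a))"
  have "(\<lambda>y :: 'k^'n^'n. value_at F (y ** a)) \<in> poly_functions"
    by (rule poly_functions_compose[OF value_at]) (rule poly_functions_matrix_mult_right)
  then have f: "value_at f y = value_at F (y ** a)" for y
    unfolding f_def by (simp add: Abs_mat_poly_inverse)
  have "f \<in> invariants H"
    using F by (simp add: f S_iff invariants_iff flip: matrix_mul_assoc)
  define g :: "'k^'d^'d" where "g = (\<chi> k l. if l \<in> range \<sigma> then b $ k $ (inv_into UNIV \<sigma> l) else 0)"
  have "right_act g (first_cols \<sigma> f) = right_act (b ** a) F"
  proof (rule mat_poly_eqI)
    fix x :: "'k^'d^'n"
    have "(\<chi> i c. (x ** g) $ i $ \<sigma> c) = x ** b"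
      by (simp add: vec_eq_iff matrix_matrix_mult_def g_def inv_f_f[OF inj_\<sigma>])
    then show "value_at (right_act g (first_cols \<sigma> f)) x = value_at (right_act (b ** a) F) x"
      by (simp add: f matrix_mul_assoc)
  qed
  then show ?thesis using generator_R[OF \<open>f \<in> invariants H\<close>, of g] by simp
qed

end

section \<open>Positive characteristic\<close>

definition minor2 :: "'d \<Rightarrow> 'd \<Rightarrow> ('d \<Rightarrow> 'a::comm_ring_1) \<Rightarrow> ('d \<Rightarrow> 'a) \<Rightarrow> 'a" where
  "minor2 i j V W = V i * W j - V j * W i"

text \<open>The coefficients of the linear form that sends U to
  \<open>minor2 i j U W\<close>.\<close>

definition alt2 :: "'d \<Rightarrow> 'd \<Rightarrow> ('d \<Rightarrow> 'a::comm_ring_1) \<Rightarrow> 'd \<Rightarrow> 'a" where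
  "alt2 i j W l = (if l = i then W j else if l = j then - W i else 0)"

text \<open>
  Up to the factor \<open>m = minor2 i j V W\<close>, for \<open>(x, y) = (1, 0), (0, 1), (1, 1)\<close> these are the projections
  of the coordinate space on \<open>T\<close> that kill \<open>V\<close>, \<open>W\<close>, and both \<open>V\<close> and \<open>W\<close>, respectively.
\<close>

definition killing :: "'a::comm_ring_1 \<Rightarrow> 'a \<Rightarrow> 'd set \<Rightarrow> 'd \<Rightarrow> 'd \<Rightarrow> ('d \<Rightarrow> 'a) \<Rightarrow> ('d \<Rightarrow> 'a) \<Rightarrow> 'd \<Rightarrow> 'd \<Rightarrow> 'a" where
  "killing x y T i j V W k l = (if k = l \<and> l \<in> T then minor2 i j V W else 0)
    + (if k \<in> T then y * W k * alt2 i j V l - x * V k * alt2 i j W l else 0)"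

lemma sum_alt2:
  fixes W :: "'d::finite \<Rightarrow> 'a::comm_ring_1"
  assumes "i \<noteq> j" "i \<in> T" "j \<in> T"
  shows "(\<Sum>l\<in>T. alt2 i j W l * V l) = W j * V i - W i * V j"
proof -
  have "(\<Sum>l\<in>T. alt2 i j W l * V l) = (\<Sum>l\<in>{i, j}. alt2 i j W l * V l)"
    using assms by (intro sum.mono_neutral_right) (auto simp: alt2_def)
  then show ?thesis using assms by (simp add: alt2_def)
qed

lemma sum_diag:
  fixes f :: "'d::finite \<Rightarrow> 'a::comm_ring_1"
  shows "(\<Sum>l\<in>T. (if k = l then m else 0) * f l) = (if k \<in> T then m * f k else 0)"
proof -
  have "(\<Sum>l\<in>T. (if k = l then m else 0) * f l) = (\<Sum>l\<in>T. if k = l then m * f l else 0)"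
    by (intro sum.cong) auto
  then show ?thesis by simp
qed

text \<open>With m = minor2 i j V W, the k-th entry of the image of U, for k in T, is m U_k + y W_k
  minor2 i j U V - x V_k minor2 i j U W, and \<open>minor2 i j\<close> is alternating.\<close>

lemma killing_kernel:
  fixes V W :: "'d::finite \<Rightarrow> 'a::comm_ring_1"
  assumes "i \<noteq> j" "i \<in> T" "j \<in> T"
  shows "(\<Sum>l\<in>T. killing 1 y T i j V W k l * V l) = 0"
    and "(\<Sum>l\<in>T. killing x 1 T i j V W k l * W l) = 0"
proof -
  have gen: "(\<Sum>l\<in>T. killing x y T i j V W k l * U l)
      = (if k \<in> T then minor2 i j V W * U k + y * W k * (V j * U i - V i * U j)
          - x * V k * (W j * U i - W i * U j) else 0)" for x y U
  proof (cases "k \<in> T")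
    case True
    have "(\<Sum>l\<in>T. killing x y T i j V W k l * U l)
        = (\<Sum>l\<in>T. (if k = l \<and> l \<in> T then minor2 i j V W else 0) * U l)
          + y * W k * (\<Sum>l\<in>T. alt2 i j V l * U l) - x * V k * (\<Sum>l\<in>T. alt2 i j W l * U l)"
      using True unfolding killing_def
      by (simp add: distrib_right left_diff_distrib sum.distrib sum_subtractf sum_distrib_left mult.assoc)
    then show ?thesis using True by (simp add: sum_diag sum_alt2[OF assms])
  qed (auto simp: killing_def intro!: sum.neutral)
  show "(\<Sum>l\<in>T. killing 1 y T i j V W k l * V l) = 0"
    "(\<Sum>l\<in>T. killing x 1 T i j V W k l * W l) = 0"
    unfolding gen by (simp_all add: minor2_def algebra_simps)
qed

lemma killing_outside: "i \<in> T \<Longrightarrow> j \<in> T \<Longrightarrow> l \<notin> T \<Longrightarrow> killing x y T i j V W k l = 0"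
  by (auto simp: killing_def alt2_def)

text \<open>The parameter x enters only through the product of X with V on T, and y only through
  that with W. If the row X is orthogonal to V, x can therefore be changed freely; this is how the
  different projections are compared.\<close>

lemma sum_killing:
  fixes V W :: "'d::finite \<Rightarrow> 'a::comm_ring_1"
  shows "(\<Sum>k\<in>UNIV. X k * killing x y T i j V W k l) = (if l \<in> T then minor2 i j V W * X l else 0)
    + y * (\<Sum>k\<in>T. X k * W k) * alt2 i j V l - x * (\<Sum>k\<in>T. X k * V k) * alt2 i j W l"
proof -
  have "(\<Sum>k\<in>UNIV. X k * killing x y T i j V W k l)
      = (\<Sum>k\<in>UNIV. if k = l then if l \<in> T then minor2 i j V W * X l else 0 else 0)
        + (\<Sum>k\<in>UNIV. if k \<in> T then X k * (y * W k * alt2 i j V l - x * V k * alt2 i j W l) else 0)"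
    unfolding sum.distrib[symmetric] by (intro sum.cong) (auto simp: killing_def algebra_simps)
  also have "(\<Sum>k\<in>UNIV. if k \<in> T then X k * (y * W k * alt2 i j V l - x * V k * alt2 i j W l) else 0)
      = (\<Sum>k\<in>T. X k * (y * W k * alt2 i j V l - x * V k * alt2 i j W l))"
    by (simp add: sum.If_cases)
  also have "\<dots> = y * (\<Sum>k\<in>T. X k * W k) * alt2 i j V l - x * (\<Sum>k\<in>T. X k * V k) * alt2 i j W l"
    by (simp add: right_diff_distrib sum_subtractf sum_distrib_left sum_distrib_right ac_simps)
  finally show ?thesis by simp
qed

lemma minor2_biforms: "minor2 i j \<in> biforms 1"
proof -
  have "(\<lambda>V W. mon_at V {#i#} * mon_at W {#j#} - mon_at V {#j#} * mon_at W {#i#}) \<in> biforms 1"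
    by (intro biforms_diff biforms_mon) auto
  also have "(\<lambda>V W. mon_at V {#i#} * mon_at W {#j#} - mon_at V {#j#} * mon_at W {#i#}) = minor2 i j"
    by (simp add: minor2_def fun_eq_iff)
  finally show ?thesis .
qed

lemma killing_biforms:
  fixes x y :: "'a::comm_ring_1" and T :: "'d::finite set"
  shows "(\<lambda>V W. killing x y T i j V W k l) \<in> biforms 1"
proof -
  have prod: "(\<lambda>V W. c * V a * W b) \<in> biforms 1" for c :: 'a and a b :: 'd
    using biforms_scale[OF biforms_mon[of "{#a#}" 1 "{#b#}"], of c] by (simp add: mult.assoc)
  have 1: "(\<lambda>V W. y * W k * alt2 i j V l) \<in> biforms 1"
  proof -
    consider "l = i" | "l = j" "l \<noteq> i" | "l \<noteq> i" "l \<noteq> j" by blast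
    then show ?thesis
      by cases (use prod[of y j k] prod[of "- y" i k] biforms_zero in \<open>auto simp: alt2_def ac_simps\<close>)
  qed
  have 2: "(\<lambda>V W. x * V k * alt2 i j W l) \<in> biforms 1"
  proof -
    consider "l = i" | "l = j" "l \<noteq> i" | "l \<noteq> i" "l \<noteq> j" by blast
    then show ?thesis
      by cases (use prod[of x k j] prod[of "- x" k i] biforms_zero in \<open>auto simp: alt2_def ac_simps\<close>)
  qed
  have "(\<lambda>V W. if k = l \<and> l \<in> T then minor2 i j V W else 0) \<in> biforms 1"
    using minor2_biforms[of i j] biforms_zero by (cases "k = l \<and> l \<in> T") auto
  moreover have "(\<lambda>V W. if k \<in> T then y * W k * alt2 i j V l - x * V k * alt2 i j W l else 0) \<in> biforms 1"
    using biforms_diff[OF 1 2] biforms_zero by (cases "k \<in> T") auto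
  ultimately show ?thesis unfolding killing_def by (rule biforms_add)
qed

context scalars
begin

lemma biform_coeff_mem:
  fixes c :: "'d::finite multiset \<Rightarrow> 'd multiset \<Rightarrow> 'a"
  assumes R: "subsp R"
    and P: "\<And>V W. P V W = (\<Sum>I | size I = D. \<Sum>J | size J = D. c I J * mon_at V I * mon_at W J)"
    and val: "\<And>V W. (\<And>l. V l \<noteq> 0) \<Longrightarrow> (\<And>l. W l \<noteq> 0) \<Longrightarrow> P (\<lambda>l. \<iota> (V l)) (\<lambda>l. \<iota> (W l)) \<in> R"
    and IJ: "size I = D" "size J = D"
  shows "c I J \<in> R"
proof (rule coeff_mem[OF R, of "{J. size J = D}"])
  fix W :: "'d \<Rightarrow> 'k" assume W: "\<And>l. W l \<noteq> 0"
  show "(\<Sum>J | size J = D. c I J * mon_at (\<lambda>l. \<iota> (W l)) J) \<in> R"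
  proof (rule coeff_mem[OF R, of "{I. size I = D}" "\<lambda>I. \<Sum>J | size J = D. c I J * mon_at (\<lambda>l. \<iota> (W l)) J"])
    fix V :: "'d \<Rightarrow> 'k" assume V: "\<And>l. V l \<noteq> 0"
    have "P (\<lambda>l. \<iota> (V l)) (\<lambda>l. \<iota> (W l))
        = (\<Sum>I | size I = D. (\<Sum>J | size J = D. c I J * mon_at (\<lambda>l. \<iota> (W l)) J) * mon_at (\<lambda>l. \<iota> (V l)) I)"
      unfolding P by (simp add: sum_distrib_left sum_distrib_right ac_simps)
    then show "(\<Sum>I | size I = D. (\<Sum>J | size J = D. c I J * mon_at (\<lambda>l. \<iota> (W l)) J) * mon_at (\<lambda>l. \<iota> (V l)) I) \<in> R"
      using val[of V W] V W by simp
  qed (use IJ in auto)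
qed (use IJ in auto)

lemma forms_unique:
  fixes c d :: "'d::finite multiset \<Rightarrow> 'a"
  assumes "\<And>V. (\<And>l. V l \<noteq> 0) \<Longrightarrow> (\<Sum>I | size I = D. c I * mon_at (\<lambda>l. \<iota> (V l)) I) = (\<Sum>I | size I = D. d I * mon_at (\<lambda>l. \<iota> (V l)) I)"
    and "size J = D"
  shows "c J = d J"
proof -
  have "c J - d J \<in> {0}"
  proof (rule coeff_mem[OF subsp_zero, of "{I. size I = D}" "\<lambda>I. c I - d I"])
    show "(\<Sum>I | size I = D. (c I - d I) * mon_at (\<lambda>l. \<iota> (V l)) I) \<in> {0}" if "\<And>l. V l \<noteq> 0" for V
      using assms(1)[OF that] by (simp add: left_diff_distrib sum_subtractf)
  qed (use assms(2) in auto)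
  then show ?thesis by simp
qed

lemma iota_killing:
  "killing (\<iota> x) (\<iota> y) T i j (\<lambda>l. \<iota> (V l)) (\<lambda>l. \<iota> (W l)) k l = \<iota> (killing x y T i j V W k l)"
  "minor2 i j (\<lambda>l. \<iota> (V l)) (\<lambda>l. \<iota> (W l)) = \<iota> (minor2 i j V W)"
  by (auto simp: killing_def minor2_def alt2_def iota_add iota_diff iota_mult iota_uminus)

end

lemma of_nat_mat_poly: "of_nat n = (const_poly (of_nat n) :: ('k::comm_ring_1, 'n::finite, 'd::finite) mat_poly)"
  by (induction n) (auto intro: mat_poly_eqI)

lemma CHAR_mat_poly: "CHAR(('k::comm_ring_1, 'n::finite, 'd::finite) mat_poly) = CHAR('k)"
proof (rule CHAR_eqI)
  have iff: "of_nat n = (0 :: ('k, 'n, 'd) mat_poly) \<longleftrightarrow> of_nat n = (0::'k)" for n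
    unfolding of_nat_mat_poly by (auto simp: value_at_inject[symmetric] fun_eq_iff)
  show "of_nat CHAR('k) = (0 :: ('k, 'n, 'd) mat_poly)" unfolding iff by simp
  show "CHAR('k) dvd n" if "of_nat n = (0 :: ('k, 'n, 'd) mat_poly)" for n
    using that unfolding iff of_nat_eq_0_iff_char_dvd .
qed

lemma CHAR_fract: "CHAR('a::idom fract) = CHAR('a)"
proof (rule CHAR_eqI)
  have of_nat: "of_nat n = to_fract (of_nat n :: 'a)" for n by (induction n) simp_all
  show "of_nat CHAR('a) = (0 :: 'a fract)" unfolding of_nat by simp
  show "CHAR('a) dvd n" if "of_nat n = (0 :: 'a fract)" for n
    using that unfolding of_nat by (simp add: of_nat_eq_0_iff_char_dvd)
qed

lemma diff_power_char:
  fixes a b :: "'a::comm_ring_1"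
  assumes "prime CHAR('a)" "q = CHAR('a) ^ n"
  shows "(a - b) ^ q = a ^ q - b ^ q"
  using freshmans_dream'[OF assms, of "a - b" b] by (simp add: eq_diff_eq)

section \<open>Removing columns of the generic matrix\<close>

locale polarization_char_p = polarization H \<sigma>
  for H :: "('k::alg_closed_field^'n::finite^'n) set" and \<sigma> :: "'n \<Rightarrow> 'd::finite" +
  fixes p :: nat
  assumes p_char: "p = CHAR('k)" and prime_p: "prime p"
begin

definition Rp :: "('k, 'n, 'd) mat_poly set" where "Rp = {F. \<exists>m. F ^ (p ^ m) \<in> R}"
text \<open>The descent theorem is applied inside the function field, since the entries of a null
  vector of the generic matrix lie there; hence the root closure is formed in that field as
  well.\<close>

definition RK :: "('k, 'n, 'd) mat_poly fract set" where "RK = {z. \<exists>m. z ^ (p ^ m) \<in> to_fract ` R}"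

lemma CHAR_K: "CHAR(('k, 'n, 'd) mat_poly fract) = p"
  by (simp add: CHAR_fract CHAR_mat_poly p_char)

lemma prime_CHAR_K: "prime CHAR(('k, 'n, 'd) mat_poly fract)"
  using CHAR_K prime_p by simp

lemma to_fract_RK_iff: "to_fract F \<in> RK \<longleftrightarrow> F \<in> Rp"
  unfolding RK_def Rp_def by (simp add: image_iff flip: to_fract_power)

lemmas subring_to_fract_R = subring_to_fract[OF subring_R]

lemma subring_RK: "unital_subring RK"
  unfolding unital_subring_def
proof (intro conjI ballI)
  have "1 ^ (p ^ 0) \<in> to_fract ` R" using unital_subringD(1)[OF subring_to_fract_R] by simp
  then show "1 \<in> RK" unfolding RK_def by blast
  fix a b assume "a \<in> RK" "b \<in> RK"
  then obtain m n where mn: "a ^ (p ^ m) \<in> to_fract ` R" "b ^ (p ^ n) \<in> to_fract ` R"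
    unfolding RK_def by blast
  have "(a ^ (p ^ m)) ^ (p ^ n) \<in> to_fract ` R" "(b ^ (p ^ n)) ^ (p ^ m) \<in> to_fract ` R"
    using mn by (auto intro: subring_power[OF subring_to_fract_R])
  then have ab: "a ^ (p ^ (m + n)) \<in> to_fract ` R" "b ^ (p ^ (m + n)) \<in> to_fract ` R"
    by (simp_all add: power_add mult.commute flip: power_mult)
  have "(a - b) ^ (p ^ (m + n)) = a ^ (p ^ (m + n)) - b ^ (p ^ (m + n))"
    using diff_power_char[OF prime_CHAR_K] CHAR_K by simp
  then have "(a - b) ^ (p ^ (m + n)) \<in> to_fract ` R"
    using unital_subringD(3)[OF subring_to_fract_R ab] by simp
  then show "a - b \<in> RK" unfolding RK_def by blast
  have "(a * b) ^ (p ^ (m + n)) \<in> to_fract ` R"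
    using unital_subringD(4)[OF subring_to_fract_R ab] by (simp add: power_mult_distrib)
  then show "a * b \<in> RK" unfolding RK_def by blast
qed

lemma root_closed_RK: "root_closed p RK"
  unfolding root_closed_def
proof (intro allI impI)
  fix z assume "z ^ p \<in> RK"
  then obtain m where "(z ^ p) ^ (p ^ m) \<in> to_fract ` R" unfolding RK_def by blast
  then have "z ^ (p ^ Suc m) \<in> to_fract ` R" by (simp add: power_mult)
  then show "z \<in> RK" unfolding RK_def by blast
qed

lemma R_subset_Rp: "R \<subseteq> Rp"
  unfolding Rp_def by (auto intro!: exI[of _ 0])

lemma sc_RK: "sc a \<in> RK"
proof -
  have "const_poly a \<in> R" using subalgebra_R unfolding subalgebra_def by blast
  then show ?thesis unfolding sc_def to_fract_RK_iff using R_subset_Rp by blast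
qed

lemma subsp_RK: "sc.subsp RK"
  by (rule sc.subsp_subring[OF subring_RK]) (auto intro: sc_RK)

lemma right_act_Rp: "F \<in> Rp \<Longrightarrow> right_act g F \<in> Rp"
proof -
  assume "F \<in> Rp"
  then obtain m where "F ^ (p ^ m) \<in> R" unfolding Rp_def by blast
  then have "right_act g (F ^ (p ^ m)) \<in> R" by (rule right_act_R)
  moreover have "right_act g (F ^ (p ^ m)) = right_act g F ^ (p ^ m)"
    by (rule mat_poly_eqI) simp
  ultimately show ?thesis unfolding Rp_def by auto
qed

definition cut :: "'d set \<Rightarrow> 'k^'d^'d" where
  "cut T = (\<chi> k l. if k = l \<and> l \<in> T then 1 else 0)"

text \<open>A projection onto at most n coordinates factors through an n-dimensional space, so
  \<open>low_rank_R\<close> applies.\<close>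

lemma cut_small:
  assumes "F \<in> S" "card T \<le> CARD('n)"
  shows "right_act (cut T) F \<in> Rp"
proof -
  obtain f :: "'d \<Rightarrow> 'n" where f: "inj_on f T"
    using card_le_inj[of T "UNIV :: 'n set"] assms(2) by auto
  define b :: "'k^'n^'d" where "b = (\<chi> k c. if k \<in> T \<and> f k = c then 1 else 0)"
  define a :: "'k^'d^'n" where "a = (\<chi> c l. if l \<in> T \<and> f l = c then 1 else 0)"
  have "b ** a = cut T"
  proof -
    have "(\<Sum>c\<in>UNIV. (if k \<in> T \<and> f k = c then 1 else 0) * (if l \<in> T \<and> f l = c then 1 else 0 :: 'k))
        = (if k = l \<and> l \<in> T then 1 else 0)" for k l
    proof -
      have "(\<Sum>c\<in>UNIV. (if k \<in> T \<and> f k = c then 1 else 0) * (if l \<in> T \<and> f l = c then 1 else 0 :: 'k))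
          = (\<Sum>c\<in>UNIV. if c = f k then if k \<in> T \<and> l \<in> T \<and> f k = f l then 1 else 0 else 0)"
        by (intro sum.cong) auto
      also have "\<dots> = (if k \<in> T \<and> l \<in> T \<and> f k = f l then 1 else 0)" by simp
      also have "\<dots> = (if k = l \<and> l \<in> T then 1 else 0)" using f by (auto dest: inj_onD)
      finally show ?thesis .
    qed
    then show ?thesis by (simp add: vec_eq_iff matrix_matrix_mult_def a_def b_def cut_def)
  qed
  then show ?thesis using low_rank_R[OF assms(1), of b a] R_subset_Rp by auto
qed

text \<open>Since c kills u, c = c a for a = 1 - u e_i / u_i. The i-th row of a is zero and c
  ignores the coordinates outside T, so \<open>cut (T - {i})\<close> can be inserted between c and
  a. The induction hypothesis is applied to \<open>right_act a F\<close>.\<close>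

lemma kernel_step:
  assumes IH: "\<And>F. F \<in> S \<Longrightarrow> right_act (cut (T - {i})) F \<in> Rp"
    and outside: "\<And>k l. l \<notin> T \<Longrightarrow> c $ k $ l = 0"
    and kernel: "\<And>k. (\<Sum>l\<in>T. c $ k $ l * u l) = 0" and ui: "u i \<noteq> 0" "i \<in> T" and F: "F \<in> S"
  shows "right_act c F \<in> Rp"
proof -
  define a :: "'k^'d^'d" where "a = (\<chi> k l. (if k = l then 1 else 0) - (if l = i then u k / u i else 0))"
  have "c = c ** cut (T - {i}) ** a"
  proof -
    have "(c ** cut (T - {i}) ** a) $ k $ l = c $ k $ l" for k l
    proof -
      have cut: "(c ** cut (T - {i})) $ k $ m = (if m \<in> T - {i} then c $ k $ m else 0)" for m
      proof -
        have "(c ** cut (T - {i})) $ k $ m = (\<Sum>l\<in>UNIV. c $ k $ l * cut (T - {i}) $ l $ m)"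
          by (simp add: matrix_matrix_mult_def)
        also have "\<dots> = (\<Sum>l\<in>UNIV. if l = m then if m \<in> T - {i} then c $ k $ m else 0 else 0)"
          unfolding cut_def by (intro sum.cong) auto
        finally show ?thesis by simp
      qed
      have "(c ** cut (T - {i}) ** a) $ k $ l = (\<Sum>m\<in>UNIV. (if m \<in> T - {i} then c $ k $ m else 0) * a $ m $ l)"
        by (subst matrix_matrix_mult_def) (simp only: vec_lambda_beta cut)
      also have "\<dots> = (\<Sum>m\<in>UNIV. c $ k $ m * a $ m $ l)"
        using outside ui by (intro sum.cong) (auto simp: a_def)
      also have "\<dots> = (\<Sum>m\<in>UNIV. if m = l then c $ k $ m else 0) - (if l = i then (\<Sum>m\<in>UNIV. c $ k $ m * u m) / u i else 0)"
        unfolding a_def by (auto simp: right_diff_distrib sum_subtractf sum_divide_distrib if_distrib[of "\<lambda>x. _ * x"] cong: if_cong)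
      also have "(\<Sum>m\<in>UNIV. c $ k $ m * u m) = (\<Sum>m\<in>T. c $ k $ m * u m)"
        using outside by (intro sum.mono_neutral_right) auto
      finally show ?thesis using kernel by simp
    qed
    then show ?thesis by (simp add: vec_eq_iff)
  qed
  then have "right_act c F = right_act c (right_act (cut (T - {i})) (right_act a F))"
  proof -
    assume c: "c = c ** cut (T - {i}) ** a"
    have "right_act c (right_act (cut (T - {i})) (right_act a F)) = right_act (c ** cut (T - {i}) ** a) F"
      by (rule mat_poly_eqI) (simp add: matrix_mul_assoc)
    then show ?thesis using c by simp
  qed
  then show ?thesis using right_act_Rp IH right_act_S F by simp
qed

text \<open>The forms \<open>P x y\<close> with x, y in {0, 1} clear the denominators of F at the
  four matrices \<open>killing x y\<close>. Unless x = y = 0, scalar V and W give a singular matrix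
  on T, so the coefficients lie in \<open>RK\<close>; for x = y = 0 the form is m^q s. At V = v the
  parameter x drops out, and at W = v the parameter y, which links the four forms.\<close>

lemma cut_step:
  assumes IH: "\<And>i F. i \<in> T \<Longrightarrow> F \<in> S \<Longrightarrow> right_act (cut (T - {i})) F \<in> Rp"
    and T: "card T > CARD('n)" and F: "F \<in> S"
  shows "right_act (cut T) F \<in> Rp"
proof -
  obtain \<kappa> D where \<kappa>: "homogenizes \<kappa> D F" using ex_homogenizes by blast
  \<comment> \<open>q is a power of p, so that q-th powers of minors have two terms, and it exceeds
    D, so that a positive power of the minor is left over and \<open>P\<close> vanishes with the
    minor.\<close>
  obtain e where "p ^ e > D" using power_gt_expt[of p D] prime_gt_1_nat[OF prime_p] by auto
  define q where "q = p ^ e"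
  have qD: "q > D" using \<open>p ^ e > D\<close> q_def by simp
  have T_card: "card T > 1" using T by (metis One_nat_def Suc_leI le_less_trans zero_less_card_finite)
  define s where "s = to_fract (right_act (cut T) F)"
  obtain v :: "'d \<Rightarrow> ('k, 'n, 'd) mat_poly fract" where v: "\<And>l. l \<notin> T \<Longrightarrow> v l = 0" "\<exists>l. v l \<noteq> 0"
    and null: "\<And>r. (\<Sum>l\<in>T. gen_coord r l * v l) = 0"
    using ex_null_vector[of "UNIV :: 'n set" T gen_coord] T by auto
  define P where "P x y i j V W = minor2 i j V W ^ (q - D) *
      hval \<kappa> D (\<lambda>r l. \<Sum>k\<in>UNIV. gen_coord r k * killing x y T i j V W k l) (minor2 i j V W)"
    for x y i j and V W :: "'d \<Rightarrow> ('k, 'n, 'd) mat_poly fract"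
  have biform: "P x y i j \<in> biforms q" for x y i j
  proof -
    have entry: "(\<lambda>V W. \<Sum>k\<in>UNIV. gen_coord r k * killing x y T i j V W k l) \<in> biforms 1"
      for r :: 'n and l
      by (intro biforms_sum biforms_scale killing_biforms)
    have "(\<lambda>V W. hval \<kappa> D (\<lambda>r l. \<Sum>k\<in>UNIV. gen_coord r k * killing x y T i j V W k l) (minor2 i j V W)) \<in> biforms D"
      unfolding hval_def
    proof (intro biforms_sum biforms_scale)
      fix I :: "('n \<times> 'd) option multiset" assume "I \<in> {I. size I = D}"
      then show "(\<lambda>V W. mon_at (hcoord (\<lambda>r l. \<Sum>k\<in>UNIV. gen_coord r k * killing x y T i j V W k l) (minor2 i j V W)) I) \<in> biforms D"
        using biforms_mon_hcoord[OF entry minor2_biforms, where I = I] by simp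
    qed
    then have "(\<lambda>V W. minor2 i j V W ^ (q - D) *
        hval \<kappa> D (\<lambda>r l. \<Sum>k\<in>UNIV. gen_coord r k * killing x y T i j V W k l) (minor2 i j V W)) \<in> biforms (q - D + D)"
      by (intro biforms_mult biforms_power minor2_biforms)
    then show ?thesis using qD unfolding P_def by (simp add: fun_eq_iff)
  qed
  have P00: "P 0 0 i j V W = minor2 i j V W ^ q * s" if "i \<in> T" "j \<in> T" for i j V W
  proof -
    have eq: "(\<Sum>k\<in>UNIV. gen_coord r k * killing 0 0 T i j V W k l)
        = minor2 i j V W * (\<Sum>k\<in>UNIV. gen_coord r k * sc (cut T $ k $ l))" for r l
    proof -
      have "(\<Sum>k\<in>UNIV. gen_coord r k * sc (cut T $ k $ l)) = (\<Sum>k\<in>UNIV. if k = l then if l \<in> T then gen_coord r l else 0 else 0)"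
        by (intro sum.cong) (auto simp: cut_def)
      then show ?thesis unfolding sum_killing by simp
    qed
    have "P 0 0 i j V W = minor2 i j V W ^ (q - D) * (minor2 i j V W ^ D * s)"
      unfolding P_def eq s_def hval_right_act[OF \<kappa>, symmetric]
      by (simp add: hval_scale[where m = 1, simplified])
    then show ?thesis using qD by (simp flip: mult.assoc power_add)
  qed
  have left: "P 1 y i j v W = P 0 y i j v W" for y i j W
    unfolding P_def sum_killing using null by simp
  have right: "P x 1 i j V v = P x 0 i j V v" for x i j V
    unfolding P_def sum_killing using null by simp
  have val: "P (sc x) (sc y) i j (\<lambda>l. sc (V l)) (\<lambda>l. sc (W l)) \<in> RK"
    if ij: "i \<noteq> j" "i \<in> T" "j \<in> T" and xy: "x = 1 \<or> y = 1" and VW: "\<And>l. V l \<noteq> 0" "\<And>l. W l \<noteq> 0" for x y i j V W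
  proof (cases "minor2 i j V W = 0")
    case True
    then show ?thesis using qD unital_subringD(2)[OF subring_RK]
      by (simp add: P_def sc.iota_killing power_0_left)
  next
    case False
    define m where "m = minor2 i j V W"
    define c :: "'k^'d^'d" where "c = (\<chi> k l. killing x y T i j V W k l / m)"
    have "right_act c F \<in> Rp"
    proof -
      have out: "c $ k $ l = 0" if "l \<notin> T" for k l
        using killing_outside[of i T j l x y V W k] ij that by (simp add: c_def)
      \<comment> \<open>The vector killed is V or W, according to the parameter that is 1. Its i-th
        coordinate is nonzero because only points without zero coordinates are tested.\<close>
      have "\<exists>u. (\<forall>k. (\<Sum>l\<in>T. c $ k $ l * u l) = 0) \<and> u i \<noteq> 0"
        using xy
      proof
        assume "x = 1"
        then have "(\<Sum>l\<in>T. c $ k $ l * V l) = 0" for k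
          using killing_kernel(1)[OF ij, of y V W k] by (simp add: c_def flip: sum_divide_distrib)
        then show ?thesis using VW by blast
      next
        assume "y = 1"
        then have "(\<Sum>l\<in>T. c $ k $ l * W l) = 0" for k
          using killing_kernel(2)[OF ij, of x V W k] by (simp add: c_def flip: sum_divide_distrib)
        then show ?thesis using VW by blast
      qed
      then show ?thesis using kernel_step[OF IH[OF ij(2)] out _ _ ij(2) F] by blast
    qed
    then have RK: "to_fract (right_act c F) \<in> RK" by (simp add: to_fract_RK_iff)
    have eq: "(\<Sum>k\<in>UNIV. gen_coord r k * killing (sc x) (sc y) T i j (\<lambda>l. sc (V l)) (\<lambda>l. sc (W l)) k l)
        = sc m * (\<Sum>k\<in>UNIV. gen_coord r k * sc (c $ k $ l))" for r l
      unfolding sc.iota_killing sum_distrib_left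
    proof (intro sum.cong refl)
      fix k
      have "killing x y T i j V W k l = m * c $ k $ l" using False by (simp add: c_def m_def)
      then show "gen_coord r k * sc (killing x y T i j V W k l) = sc m * (gen_coord r k * sc (c $ k $ l))"
        by (simp add: sc.iota_mult)
    qed
    have "P (sc x) (sc y) i j (\<lambda>l. sc (V l)) (\<lambda>l. sc (W l)) = sc m ^ (q - D) * (sc m ^ D * to_fract (right_act c F))"
      unfolding P_def eq unfolding hval_right_act[OF \<kappa>, symmetric] sc.iota_killing m_def[symmetric]
      by (simp add: hval_scale[where m = 1, simplified])
    also have "\<dots> \<in> RK"
      using RK sc_RK by (intro unital_subringD(4)[OF subring_RK] subring_power[OF subring_RK])
    finally show ?thesis .
  qed
  have coeffs: "\<exists>a. (\<forall>I J. a I J \<in> RK) \<and>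
      (\<forall>V W. P x y i j V W = (\<Sum>I | size I = q. \<Sum>J | size J = q. a I J * mon_at V I * mon_at W J))"
    if ij: "i \<noteq> j" "i \<in> T" "j \<in> T" and xy: "(x, y) \<in> {(1, 0), (0, 1), (1, 1)}" for x y i j
  proof -
    obtain a where a: "\<And>V W. P x y i j V W = (\<Sum>I | size I = q. \<Sum>J | size J = q. a I J * mon_at V I * mon_at W J)"
      using biform[of x y i j] unfolding biforms_def by blast
    obtain x' y' where xy': "x = sc x'" "y = sc y'" "x' = 1 \<or> y' = 1"
      using xy by (metis (no_types, lifting) Pair_inject empty_iff insert_iff sc.iota_0 sc.iota_1)
    have mem: "a I J \<in> RK" if "size I = q" "size J = q" for I J
      by (rule sc.biform_coeff_mem[OF subsp_RK a, OF _ that])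
         (use val[OF ij xy'(3)] xy' in auto)
    show ?thesis
      by (rule exI[of _ "\<lambda>I J. if size I = q \<and> size J = q then a I J else 0"])
         (use mem unital_subringD(2)[OF subring_RK] in \<open>auto simp: a intro!: sum.cong\<close>)
  qed
  have minor_power: "minor2 i j V W ^ q = V i ^ q * W j ^ q - V j ^ q * W i ^ q"
    for i j and V W :: "'d \<Rightarrow> ('k, 'n, 'd) mat_poly fract"
    unfolding minor2_def
    by (subst diff_power_char[OF prime_CHAR_K, of q e]) (simp_all add: q_def CHAR_K power_mult_distrib)
  have "s \<in> RK"
  proof (rule root_closed_descent[OF prime_p CHAR_K subring_RK root_closed_RK v(2) q_def])
    show "\<exists>c. (\<forall>I. c I \<in> RK) \<and> s * v i ^ q = (\<Sum>I | size I = q. c I * mon_at v I)" for i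
    proof (cases "i \<in> T")
      case False
      then show ?thesis using v(1)[of i] qD unital_subringD(2)[OF subring_RK]
        by (intro exI[of _ "\<lambda>_. 0"]) (simp add: power_0_left)
    next
      case i: True
      obtain j where j: "j \<in> T" "i \<noteq> j"
        using T_card i by (metis One_nat_def card_le_Suc0_iff_eq finite not_less)
      obtain a where a: "\<And>I J. a I J \<in> RK"
        "\<And>V W. P 1 0 i j V W = (\<Sum>I | size I = q. \<Sum>J | size J = q. a I J * mon_at V I * mon_at W J)"
        using coeffs[OF j(2) i j(1), of 1 0] by auto
      \<comment> \<open>With the j-th unit vector in place of W the minor becomes v i, and the
        bihomogeneous form becomes a form of degree q in v.\<close>
      define \<delta> :: "'d \<Rightarrow> ('k, 'n, 'd) mat_poly fract" where "\<delta> l = (if l = j then 1 else 0)" for l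
      have "s * v i ^ q = P 0 0 i j v \<delta>"
        unfolding P00[OF i j(1)] minor_power using j qD by (simp add: \<delta>_def power_0_left)
      also have "\<dots> = P 1 0 i j v \<delta>" by (simp only: left)
      also have "\<dots> = (\<Sum>I | size I = q. (\<Sum>J | size J = q. a I J * mon_at \<delta> J) * mon_at v I)"
        unfolding a(2) by (simp add: sum_distrib_left sum_distrib_right ac_simps)
      finally have "s * v i ^ q = (\<Sum>I | size I = q. (\<Sum>J | size J = q. a I J * mon_at \<delta> J) * mon_at v I)" .
      moreover have "(\<Sum>J | size J = q. a I J * mon_at \<delta> J) \<in> RK" for I
        using unital_subringD[OF subring_RK]
        by (intro subring_sum[OF subring_RK] unital_subringD(4)[OF subring_RK] a subring_mon[OF subring_RK])
           (auto simp: \<delta>_def)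
      ultimately show ?thesis by (intro exI[of _ "\<lambda>I. \<Sum>J | size J = q. a I J * mon_at \<delta> J"] conjI) auto
    qed
    fix i j assume ij: "i \<noteq> j" "v i \<noteq> 0" "v j \<noteq> 0"
    then have T: "i \<in> T" "j \<in> T" using v(1) by blast+
    let ?form = "\<lambda>a V W. \<Sum>I | size I = q. \<Sum>J | size J = q. a I J * mon_at V I * mon_at W J"
    \<comment> \<open>a, b and c belong to killing V, both vectors, and W, respectively. Neighbours
      differ in one parameter only and agree where that parameter drops out.\<close>
    obtain a b c where mem: "\<And>I J. a I J \<in> RK" "\<And>I J. b I J \<in> RK" "\<And>I J. c I J \<in> RK"
      and a: "\<And>V W. P 1 0 i j V W = ?form a V W"
      and b: "\<And>V W. P 1 1 i j V W = ?form b V W"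
      and c: "\<And>V W. P 0 1 i j V W = ?form c V W"
      using coeffs[OF ij(1) T, of 1 0] coeffs[OF ij(1) T, of 1 1] coeffs[OF ij(1) T, of 0 1] by auto
    have form_left: "?form a V W = (\<Sum>J | size J = q. (\<Sum>I | size I = q. a I J * mon_at V I) * mon_at W J)"
      for a and V W :: "'d \<Rightarrow> ('k, 'n, 'd) mat_poly fract"
      by (subst sum.swap) (simp add: sum_distrib_right)
    have form_right: "?form a V W = (\<Sum>I | size I = q. (\<Sum>J | size J = q. a I J * mon_at W J) * mon_at V I)"
      for a and V W :: "'d \<Rightarrow> ('k, 'n, 'd) mat_poly fract"
      by (simp add: sum_distrib_left sum_distrib_right ac_simps)
    have two: "(\<Sum>J | size J = q. (s * (if J = replicate_mset q j then x else 0) - s * (if J = replicate_mset q i then y else 0)) * mon_at W J)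
        = s * (x * W j ^ q - y * W i ^ q)" for i j x y and W :: "'d \<Rightarrow> ('k, 'n, 'd) mat_poly fract"
    proof -
      have "(\<Sum>J | size J = q. (s * (if J = replicate_mset q j then x else 0) - s * (if J = replicate_mset q i then y else 0)) * mon_at W J)
          = (\<Sum>J | size J = q. (if J = replicate_mset q j then s * x * mon_at W J else 0)
              - (if J = replicate_mset q i then s * y * mon_at W J else 0))"
        by (intro sum.cong) (auto simp: left_diff_distrib)
      then show ?thesis by (simp add: sum_subtractf right_diff_distrib mult.assoc)
    qed
    have "overlap_forms s v q i j a b c"
      unfolding overlap_forms_def
    proof (intro conjI allI impI)
      fix J :: "'d multiset" assume J: "size J = q"
      show "(\<Sum>I | size I = q. a I J * mon_at v I)
          = s * (if J = replicate_mset q j then v i ^ q else 0) - s * (if J = replicate_mset q i then v j ^ q else 0)"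
        by (rule sc.forms_unique[OF _ J],
            simp only: two form_left[symmetric] a[symmetric] left P00[OF T] minor_power, simp add: ac_simps)
      show "(\<Sum>I | size I = q. b I J * mon_at v I) = (\<Sum>I | size I = q. c I J * mon_at v I)"
        by (rule sc.forms_unique[OF _ J]) (simp only: form_left[symmetric] b[symmetric] c[symmetric] left)
    next
      fix I :: "'d multiset" assume I: "size I = q"
      show "(\<Sum>J | size J = q. a I J * mon_at v J) = (\<Sum>J | size J = q. b I J * mon_at v J)"
        by (rule sc.forms_unique[OF _ I]) (simp only: form_right[symmetric] b[symmetric] a[symmetric] right)
      show "(\<Sum>J | size J = q. c I J * mon_at v J)
          = s * (if I = replicate_mset q i then v j ^ q else 0) - s * (if I = replicate_mset q j then v i ^ q else 0)"
        by (rule sc.forms_unique[OF _ I],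
            simp only: two form_right[symmetric] c[symmetric] right P00[OF T] minor_power, simp add: ac_simps)
    qed
    then show "overlap_data RK s v q i j" unfolding overlap_data_def using mem by blast
  qed
  then show ?thesis by (simp add: s_def to_fract_RK_iff)
qed

lemma S_subset_Rp: "S \<subseteq> Rp"
proof
  have cut: "\<forall>F\<in>S. right_act (cut T) F \<in> Rp" for T
  proof (induction "card T" arbitrary: T rule: less_induct)
    case less
    show ?case
    proof (cases "card T \<le> CARD('n)")
      case False
      have "\<forall>F\<in>S. right_act (cut (T - {i})) F \<in> Rp" if "i \<in> T" for i
        using that by (intro less card_Diff1_less) auto
      then show ?thesis using False by (auto intro: cut_step)
    qed (auto intro: cut_small)
  qed
  fix F assume F: "F \<in> S"
  have "cut UNIV = mat 1" by (simp add: cut_def mat_def)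
  then have "right_act (cut UNIV) F = F" by (intro mat_poly_eqI) simp
  then show "F \<in> Rp" using cut[of UNIV] F by auto
qed

end

section \<open>Characteristic zero\<close>

definition ip :: "'w set \<Rightarrow> ('w \<Rightarrow> rat) \<Rightarrow> ('w \<Rightarrow> rat) \<Rightarrow> rat" where
  "ip E f g = (\<Sum>w\<in>E. f w * g w)"

lemma ip_simps:
  "ip E (\<lambda>w. f w - g w) h = ip E f h - ip E g h" "ip E f (\<lambda>w. g w + h w) = ip E f g + ip E f h"
  "ip E (\<lambda>w. c * f w) h = c * ip E f h" "ip E f (\<lambda>w. \<Sum>t\<in>T. c' t * t w) = (\<Sum>t\<in>T. c' t * ip E f t)"
proof -
  have "ip E f (\<lambda>w. \<Sum>t\<in>T. c' t * t w) = (\<Sum>w\<in>E. \<Sum>t\<in>T. c' t * (f w * t w))"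
    unfolding ip_def by (simp add: sum_distrib_left ac_simps)
  also have "\<dots> = (\<Sum>t\<in>T. c' t * ip E f t)"
    unfolding ip_def by (subst sum.swap) (simp add: sum_distrib_left)
  finally show "ip E f (\<lambda>w. \<Sum>t\<in>T. c' t * t w) = (\<Sum>t\<in>T. c' t * ip E f t)" .
qed (simp_all add: ip_def algebra_simps sum_subtractf sum.distrib sum_distrib_left)

lemma ip_self_eq_0:
  assumes "finite E" "ip E f f = 0" "w \<in> E"
  shows "f w = 0"
proof -
  have "\<forall>w\<in>E. f w * f w = 0"
    using assms(1,2) unfolding ip_def by (subst sum_nonneg_eq_0_iff[symmetric]) auto
  then show ?thesis using assms(3) by simp
qed

text \<open>Gram-Schmidt, with u' the part of u orthogonal to U. If u' has norm zero, it vanishes on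
  E by positivity, and the value of \<alpha> is immaterial.\<close>

lemma orthogonal_projection:
  assumes "finite U" "finite E"
  shows "\<exists>c. \<forall>u\<in>U. ip E (\<lambda>w. f w - (\<Sum>t\<in>U. c t * t w)) u = 0"
  using assms(1)
proof (induction U arbitrary: f rule: finite_induct)
  case (insert u U)
  obtain \<mu> where \<mu>: "\<And>t. t \<in> U \<Longrightarrow> ip E (\<lambda>w. u w - (\<Sum>t\<in>U. \<mu> t * t w)) t = 0" using insert.IH by blast
  obtain \<nu> where \<nu>: "\<And>t. t \<in> U \<Longrightarrow> ip E (\<lambda>w. f w - (\<Sum>t\<in>U. \<nu> t * t w)) t = 0" using insert.IH by blast
  define u' where "u' w = u w - (\<Sum>t\<in>U. \<mu> t * t w)" for w
  define r where "r w = f w - (\<Sum>t\<in>U. \<nu> t * t w)" for w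
  have u'_U: "ip E u' t = 0" and r_U: "ip E r t = 0" if "t \<in> U" for t
    using \<mu>[OF that] \<nu>[OF that] unfolding u'_def[abs_def] r_def[abs_def] .
  define \<alpha> where "\<alpha> = ip E r u' / ip E u' u'"
  define z where "z w = r w - \<alpha> * u' w" for w
  have z_ip: "ip E z h = ip E r h - \<alpha> * ip E u' h" for h
    unfolding z_def[abs_def] ip_simps ..
  have z_U: "ip E z t = 0" if "t \<in> U" for t using u'_U[OF that] r_U[OF that] by (simp add: z_ip)
  have "ip E z u' = 0"
  proof (cases "ip E u' u' = 0")
    case True
    then have "ip E r u' = 0"
      using ip_self_eq_0[OF assms(2) True] unfolding ip_def by (intro sum.neutral) auto
    then show ?thesis using True by (simp add: z_ip)
  qed (simp add: z_ip \<alpha>_def)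
  moreover have "u = (\<lambda>w. u' w + (\<Sum>t\<in>U. \<mu> t * t w))" by (simp add: u'_def)
  from arg_cong[OF this, of "ip E z"]
  have "ip E z u = ip E z u' + ip E z (\<lambda>w. \<Sum>t\<in>U. \<mu> t * t w)" by (simp only: ip_simps(2))
  then have "ip E z u = ip E z u'" unfolding ip_simps(4) using z_U by simp
  ultimately have z: "ip E z t = 0" if "t \<in> insert u U" for t using z_U that by auto
  define c where "c t = (if t = u then \<alpha> else \<nu> t - \<alpha> * \<mu> t)" for t
  have "(\<Sum>t\<in>insert u U. c t * t w) = \<alpha> * u w + (\<Sum>t\<in>U. (\<nu> t - \<alpha> * \<mu> t) * t w)" for w
  proof -
    have "(\<Sum>t\<in>U. c t * t w) = (\<Sum>t\<in>U. (\<nu> t - \<alpha> * \<mu> t) * t w)"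
      using insert.hyps(2) by (intro sum.cong) (auto simp: c_def)
    then show ?thesis using insert.hyps by (simp add: c_def)
  qed
  then have "(\<lambda>w. f w - (\<Sum>t\<in>insert u U. c t * t w)) = z"
    by (simp add: fun_eq_iff z_def r_def u'_def left_diff_distrib right_diff_distrib sum_subtractf sum_distrib_left mult.assoc)
  then show ?case using z by (intro exI[of _ c]) simp
qed simp

text \<open>Each further point of E raises the dimension of the space of restrictions by at most
  one.\<close>

lemma finite_spanning:
  fixes U :: "('w \<Rightarrow> rat) set"
  assumes "finite E"
  shows "\<exists>U0\<subseteq>U. finite U0 \<and> (\<forall>u\<in>U. \<exists>c. \<forall>w\<in>E. u w = (\<Sum>t\<in>U0. c t * t w))"
  using assms
proof (induction E rule: finite_induct)
  case empty
  then show ?case by (intro exI[of _ "{}"]) simp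
next
  case (insert x E)
  then obtain U0 where U0: "U0 \<subseteq> U" "finite U0"
    and span: "\<And>u. u \<in> U \<Longrightarrow> \<exists>c. \<forall>w\<in>E. u w = (\<Sum>t\<in>U0. c t * t w)" by blast
  show ?case
  proof (cases "\<forall>u\<in>U. \<exists>c. \<forall>w\<in>insert x E. u w = (\<Sum>t\<in>U0. c t * t w)")
    case True
    then show ?thesis using U0 by blast
  next
    case False
    then obtain u1 where u1: "u1 \<in> U" "\<And>c. \<exists>w\<in>insert x E. u1 w \<noteq> (\<Sum>t\<in>U0. c t * t w)" by blast
    obtain c1 where c1: "\<And>w. w \<in> E \<Longrightarrow> u1 w = (\<Sum>t\<in>U0. c1 t * t w)" using span[OF u1(1)] by blast
    define \<delta> where "\<delta> = u1 x - (\<Sum>t\<in>U0. c1 t * t x)"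
    have "\<delta> \<noteq> 0" using u1(2)[of c1] c1 unfolding \<delta>_def by auto
    have "u1 \<notin> U0"
    proof
      assume "u1 \<in> U0"
      then have "u1 w = (\<Sum>t\<in>U0. (if t = u1 then 1 else 0) * t w)" for w
        using U0(2) by (simp add: if_distrib[of "\<lambda>x. x * _"] sum.delta cong: if_cong)
      then show False using u1(2)[of "\<lambda>t. if t = u1 then 1 else 0"] by auto
    qed
    have "\<exists>c. \<forall>w\<in>insert x E. u w = (\<Sum>t\<in>insert u1 U0. c t * t w)" if u: "u \<in> U" for u
    proof -
      obtain c0 where c0: "\<And>w. w \<in> E \<Longrightarrow> u w = (\<Sum>t\<in>U0. c0 t * t w)" using span[OF u] by blast
      define d where "d = (u x - (\<Sum>t\<in>U0. c0 t * t x)) / \<delta>"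
      define c where "c t = (if t = u1 then d else c0 t - d * c1 t)" for t
      have sum: "(\<Sum>t\<in>insert u1 U0. c t * t w) = d * (u1 w - (\<Sum>t\<in>U0. c1 t * t w)) + (\<Sum>t\<in>U0. c0 t * t w)" for w
      proof -
        have "(\<Sum>t\<in>U0. c t * t w) = (\<Sum>t\<in>U0. (c0 t - d * c1 t) * t w)"
          using \<open>u1 \<notin> U0\<close> by (intro sum.cong) (auto simp: c_def)
        then show ?thesis using U0(2) \<open>u1 \<notin> U0\<close>
          by (simp add: c_def left_diff_distrib right_diff_distrib sum_subtractf sum_distrib_left mult.assoc)
      qed
      have "u w = (\<Sum>t\<in>insert u1 U0. c t * t w)" if "w \<in> insert x E" for w
        using that \<open>\<delta> \<noteq> 0\<close> c0[of w] c1[of w] unfolding sum by (auto simp: d_def \<delta>_def)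
      then show ?thesis by blast
    qed
    then show ?thesis using U0 u1(1) by (intro exI[of _ "insert u1 U0"]) auto
  qed
qed

lemma sum_power_words:
  fixes z :: "'j::finite \<Rightarrow> 'a::comm_ring_1"
  shows "(\<Sum>j\<in>UNIV. z j) ^ D = (\<Sum>w\<in>PiE {..<D} (\<lambda>_. UNIV). \<Prod>i<D. z (w i))"
  using prod_sum_PiE[of "{..<D}" "\<lambda>_. UNIV :: 'j set" "\<lambda>_. z"] by simp

text \<open>
  The vectors \<open>Y \<otimes> \<dots> \<otimes> Y\<close> have inner products \<open>\<langle>Y, C\<rangle>\<^sup>D\<close>, and orthogonal projection is possible over
  the ordered field of rational numbers.
\<close>

lemma power_reproducing:
  fixes \<Y> :: "('j::finite \<Rightarrow> rat) set"
  shows "\<exists>T c. finite T \<and> T \<subseteq> \<Y> \<and>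
    (\<forall>Y\<in>\<Y>. (\<Sum>j\<in>UNIV. Y j * C0 j) ^ D = (\<Sum>C\<in>T. c C * (\<Sum>j\<in>UNIV. Y j * C j) ^ D))"
proof -
  define E where "E = PiE {..<D} (\<lambda>_. UNIV :: 'j set)"
  have fin: "finite E" unfolding E_def by (rule finite_PiE) auto
  define K where "K Y w = (\<Prod>i<D. Y (w i))" for Y :: "'j \<Rightarrow> rat" and w :: "nat \<Rightarrow> 'j"
  have ip_K: "ip E (K X) (K Y) = (\<Sum>j\<in>UNIV. Y j * X j) ^ D" for X Y
    unfolding ip_def K_def sum_power_words E_def by (simp add: prod.distrib mult.commute)
  obtain U0 where U0: "U0 \<subseteq> K ` \<Y>" "finite U0"
    and span: "\<And>u. u \<in> K ` \<Y> \<Longrightarrow> \<exists>c. \<forall>w\<in>E. u w = (\<Sum>t\<in>U0. c t * t w)"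
    using finite_spanning[OF fin, of "K ` \<Y>"] by blast
  obtain c where c: "\<And>u. u \<in> U0 \<Longrightarrow> ip E (\<lambda>w. K C0 w - (\<Sum>t\<in>U0. c t * t w)) u = 0"
    using orthogonal_projection[OF U0(2) fin] by blast
  define z where "z w = K C0 w - (\<Sum>t\<in>U0. c t * t w)" for w
  have z0: "ip E z (K Y) = 0" if "Y \<in> \<Y>" for Y
  proof -
    from span[OF imageI[OF that]] obtain d where d: "\<forall>w\<in>E. K Y w = (\<Sum>t\<in>U0. d t * t w)" by blast
    have "ip E z (K Y) = ip E z (\<lambda>w. \<Sum>t\<in>U0. d t * t w)" unfolding ip_def using d by (intro sum.cong) auto
    then show ?thesis using c unfolding ip_simps z_def[abs_def] by simp
  qed
  \<comment> \<open>Different matrices may have the same tensor power, so one matrix is chosen for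
    each vector in U0.\<close>
  define g where "g = inv_into \<Y> K"
  have g: "g u \<in> \<Y>" "K (g u) = u" if "u \<in> U0" for u
    using inv_into_into[of u K \<Y>] f_inv_into_f[of u K \<Y>] subsetD[OF U0(1) that]
    unfolding g_def by simp_all
  have inj: "inj_on g U0" by (rule inj_on_inverseI[of _ K]) (rule g)
  have comm: "ip E f h = ip E h f" for f h unfolding ip_def by (simp add: mult.commute)
  have "(\<Sum>j\<in>UNIV. Y j * C0 j) ^ D = (\<Sum>C\<in>g ` U0. c (K C) * (\<Sum>j\<in>UNIV. Y j * C j) ^ D)" if Y: "Y \<in> \<Y>" for Y
  proof -
    have "0 = ip E (K C0) (K Y) - ip E (\<lambda>w. \<Sum>t\<in>U0. c t * t w) (K Y)"
      using z0[OF Y] unfolding z_def[abs_def] ip_simps by simp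
    also have "ip E (\<lambda>w. \<Sum>t\<in>U0. c t * t w) (K Y) = (\<Sum>t\<in>U0. c t * ip E (K Y) t)"
      unfolding comm[of _ "K Y"] ip_simps ..
    also have "\<dots> = (\<Sum>t\<in>U0. c (K (g t)) * ip E (K (g t)) (K Y))"
      using g by (intro sum.cong) (simp_all add: comm)
    also have "\<dots> = (\<Sum>C\<in>g ` U0. c (K C) * ip E (K C) (K Y))"
      by (simp add: sum.reindex[OF inj])
    finally show ?thesis unfolding ip_K by simp
  qed
  then show ?thesis using g(1) U0(2)
    by (intro exI[of _ "g ` U0"] exI[of _ "\<lambda>C. c (K C)"]) auto
qed

text \<open>N I counts the words with content I. As it is positive, it can be cancelled in
  characteristic zero.\<close>

lemma multinomial:
  obtains N :: "'j::finite multiset \<Rightarrow> nat"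
  where "\<And>I. size I = D \<Longrightarrow> N I > 0"
    and "\<And>z :: 'j \<Rightarrow> 'a::comm_ring_1. (\<Sum>j\<in>UNIV. z j) ^ D = (\<Sum>I | size I = D. of_nat (N I) * mon_at z I)"
proof
  define E where "E = PiE {..<D} (\<lambda>_. UNIV :: 'j set)"
  have fin: "finite E" unfolding E_def by (rule finite_PiE) auto
  define f where "f w = image_mset w (mset_set {..<D})" for w :: "nat \<Rightarrow> 'j"
  show "card {w\<in>E. f w = I} > 0" if I: "size I = D" for I
  proof -
    obtain xs where xs: "mset xs = I" using ex_mset by blast
    have len: "length xs = D" using I xs by auto
    define w where "w = restrict (\<lambda>i. xs ! i) {..<D}"
    have "f w = image_mset (\<lambda>i. xs ! i) (mset_set {..<D})"
      unfolding f_def w_def by (rule image_mset_cong) auto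
    also have "\<dots> = mset (map (\<lambda>i. xs ! i) [0..<D])"
      by (simp add: mset_map flip: mset_upt atLeast0LessThan)
    also have "\<dots> = I" using xs len by (simp add: map_nth flip: len)
    finally have "w \<in> {w\<in>E. f w = I}" unfolding E_def w_def by auto
    then show ?thesis using fin by (auto simp: card_gt_0_iff)
  qed
  show "(\<Sum>j\<in>UNIV. z j) ^ D = (\<Sum>I | size I = D. of_nat (card {w\<in>E. f w = I}) * mon_at z I)"
    for z :: "'j \<Rightarrow> 'a"
  proof -
    have "(\<Sum>j\<in>UNIV. z j) ^ D = (\<Sum>w\<in>E. mon_at z (f w))"
      unfolding sum_power_words E_def[symmetric]
      by (intro sum.cong refl) (simp add: f_def mon_at_def image_mset.compositionality comp_def prod_unfold_prod_mset)
    also have "\<dots> = (\<Sum>I | size I = D. \<Sum>w | w \<in> E \<and> f w = I. mon_at z (f w))"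
      by (rule sum.group[symmetric]) (auto simp: fin f_def)
    also have "\<dots> = (\<Sum>I | size I = D. of_nat (card {w\<in>E. f w = I}) * mon_at z I)"
      by (intro sum.cong refl) simp
    finally show ?thesis .
  qed
qed

definition rat_hom :: "rat \<Rightarrow> 'k::field" where
  "rat_hom r = of_int (fst (quotient_of r)) / of_int (snd (quotient_of r))"

lemma scalars_rat_hom:
  assumes char: "CHAR('k::field) = 0"
  shows "scalars (rat_hom :: rat \<Rightarrow> 'k)"
proof -
  have zero: "of_int a = (0::'k) \<longleftrightarrow> a = 0" for a
    using char by (simp add: of_int_eq_0_iff_char_dvd)
  have eq: "rat_hom r = (of_int a / of_int b :: 'k)" if r: "r = of_int a / of_int b" and b: "b \<noteq> 0" for r a b
  proof -
    obtain c d where cd: "quotient_of r = (c, d)" by fastforce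
    have d: "d > 0" by (rule quotient_of_denom_pos[OF cd])
    have "(of_int c / of_int d :: rat) = of_int a / of_int b" using quotient_of_div[OF cd] r by simp
    then have "(of_int (c * b) :: rat) = of_int (a * d)" using b d by (simp add: field_simps)
    then have "c * b = a * d" by (simp only: of_int_eq_iff)
    then have "(of_int c * of_int b :: 'k) = of_int a * of_int d" by (metis of_int_mult)
    then show ?thesis using b d zero[of b] zero[of d] unfolding rat_hom_def cd by (simp add: field_simps)
  qed
  show ?thesis
  proof
    fix r s :: rat
    obtain a b where ab: "quotient_of r = (a, b)" by fastforce
    obtain c d where cd: "quotient_of s = (c, d)" by fastforce
    have r: "r = of_int a / of_int b" "b \<noteq> 0"
      using quotient_of_div[OF ab] quotient_of_denom_pos[OF ab] by auto
    have s: "s = of_int c / of_int d" "d \<noteq> 0"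
      using quotient_of_div[OF cd] quotient_of_denom_pos[OF cd] by auto
    have "r + s = of_int (a * d + c * b) / of_int (b * d)" using r s by (simp add: field_simps)
    then have "rat_hom (r + s) = (of_int (a * d + c * b) / of_int (b * d) :: 'k)" using r s by (intro eq) auto
    then show "rat_hom (r + s) = (rat_hom r + rat_hom s :: 'k)"
      using r(2) s(2) zero[of b] zero[of d] by (simp add: eq[OF r] eq[OF s] field_simps)
    have "r * s = of_int (a * c) / of_int (b * d)" using r s by simp
    then have "rat_hom (r * s) = (of_int (a * c) / of_int (b * d) :: 'k)" using r s by (intro eq) auto
    then show "rat_hom (r * s) = (rat_hom r * rat_hom s :: 'k)" by (simp add: eq[OF r] eq[OF s])
    show "rat_hom 1 = (1 :: 'k)" using eq[of 1 1 1] by simp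
  qed (rule infinite_UNIV_char_0)
qed

section \<open>Polynomial identities that pass from the rational numbers to k\<close>

definition polyfuns :: "(('v \<Rightarrow> 'a::comm_ring_1) \<Rightarrow> 'a) set" where
  "polyfuns = {P. \<exists>E. finite E \<and> P \<in> polys E}"

lemma polys_mono:
  assumes "P \<in> polys E" "E \<subseteq> E'" "finite E'"
  shows "P \<in> polys E'"
proof -
  obtain c where c: "\<And>V. P V = (\<Sum>I\<in>E. c I * mon_at V I)" using polysD[OF assms(1)] by blast
  have "P V = (\<Sum>I\<in>E'. (if I \<in> E then c I else 0) * mon_at V I)" for V
    unfolding c using assms(2,3) by (intro sum.mono_neutral_cong_left) auto
  then show ?thesis by (rule polysI)
qed

lemma polyfuns_add: "P \<in> polyfuns \<Longrightarrow> Q \<in> polyfuns \<Longrightarrow> (\<lambda>V. P V + Q V) \<in> polyfuns"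
proof -
  assume "P \<in> polyfuns" "Q \<in> polyfuns"
  then obtain E E' where E: "finite E" "P \<in> polys E" "finite E'" "Q \<in> polys E'"
    unfolding polyfuns_def by blast
  have "(\<lambda>V. P V + Q V) \<in> polys (E \<union> E')"
    by (intro polys_add polys_mono[OF E(2)] polys_mono[OF E(4)]) (use E in auto)
  moreover have "finite (E \<union> E')" using E by simp
  ultimately show ?thesis unfolding polyfuns_def by blast
qed

lemma polyfuns_mult: "P \<in> polyfuns \<Longrightarrow> Q \<in> polyfuns \<Longrightarrow> (\<lambda>V. P V * Q V) \<in> polyfuns"
proof -
  assume "P \<in> polyfuns" "Q \<in> polyfuns"
  then obtain E E' where E: "finite E" "P \<in> polys E" "finite E'" "Q \<in> polys E'"
    unfolding polyfuns_def by blast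
  have "(\<lambda>V. P V * Q V) \<in> polys ((\<lambda>(I, J). I + J) ` (E \<times> E'))"
    by (rule polys_mult[OF E(2,4)]) (use E in auto)
  moreover have "finite ((\<lambda>(I, J). I + J) ` (E \<times> E'))" using E by simp
  ultimately show ?thesis unfolding polyfuns_def by blast
qed

lemma polyfuns_const: "(\<lambda>V. a) \<in> polyfuns"
proof -
  have "(\<lambda>V. a * mon_at V {#}) \<in> polys {{#}}" by (intro polys_scale polys_mon) auto
  then show ?thesis unfolding polyfuns_def by auto
qed

lemma polyfuns_var: "(\<lambda>V. V i) \<in> polyfuns"
proof -
  have "(\<lambda>V. mon_at V {#i#}) \<in> polys {{#i#}}" by (intro polys_mon) auto
  then show ?thesis unfolding polyfuns_def by auto
qed

lemma polyfuns_sum: "(\<And>t. t \<in> T \<Longrightarrow> P t \<in> polyfuns) \<Longrightarrow> (\<lambda>V. \<Sum>t\<in>T. P t V) \<in> polyfuns"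
  by (induction T rule: infinite_finite_induct) (simp_all add: polyfuns_const polyfuns_add)

lemma polyfuns_power: "P \<in> polyfuns \<Longrightarrow> (\<lambda>V. P V ^ n) \<in> polyfuns"
  by (induction n) (simp_all add: polyfuns_const polyfuns_mult)

lemma (in scalars) polyfuns_zero:
  fixes P :: "('v::finite \<Rightarrow> 'a) \<Rightarrow> 'a"
  assumes "P \<in> polyfuns" "\<And>V. P (\<lambda>i. \<iota> (V i)) = 0"
  shows "P V = 0"
proof -
  obtain E c where E: "finite E" and c: "\<And>V. P V = (\<Sum>I\<in>E. c I * mon_at V I)"
    using assms(1) unfolding polyfuns_def by (auto dest: polysD)
  have "c J \<in> {0}" if "J \<in> E" for J
    by (rule coeff_mem[OF subsp_zero E _ that]) (use assms(2) in \<open>simp flip: c\<close>)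
  then show ?thesis by (simp add: c)
qed

lemma sum_option_prod:
  fixes f :: "('n::finite \<times> 'd::finite) option \<Rightarrow> 'a::comm_monoid_add"
  shows "(\<Sum>o'\<in>UNIV. f o') = f None + (\<Sum>r\<in>UNIV. \<Sum>l\<in>UNIV. f (Some (r, l)))"
proof -
  have "(\<Sum>o'\<in>UNIV. f o') = f None + (\<Sum>x\<in>range Some. f x)"
    by (simp add: UNIV_option_conv)
  also have "(\<Sum>x\<in>range Some. f x) = (\<Sum>x\<in>UNIV. f (Some x))" by (simp add: sum.reindex)
  also have "\<dots> = (\<Sum>r\<in>UNIV. \<Sum>l\<in>UNIV. f (Some (r, l)))"
    by (simp add: sum.cartesian_product UNIV_Times_UNIV[symmetric] del: UNIV_Times_UNIV)
  finally show ?thesis .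
qed

lemma mon_mult: "mon_at (\<lambda>i. V i * W i) I = mon_at V I * mon_at W I"
  by (induction I) (simp_all add: ac_simps)

definition lmul :: "('n \<Rightarrow> 'd::finite \<Rightarrow> 'a::comm_ring_1) \<Rightarrow> ('d \<Rightarrow> 'd \<Rightarrow> 'a) \<Rightarrow> 'n \<Rightarrow> 'd \<Rightarrow> 'a" where
  "lmul x \<gamma> r l = (\<Sum>m\<in>UNIV. x r m * \<gamma> m l)"

text \<open>Adjunction for the trace form: the transpose of x times a pairs with \<gamma> as a pairs
  with x \<gamma>. The extra coordinate adds 1 on both sides.\<close>

lemma pairing_lmul:
  fixes x a :: "'n::finite \<Rightarrow> 'd::finite \<Rightarrow> 'a::comm_ring_1"
  shows "(\<Sum>o'\<in>UNIV. hcoord (\<lambda>m k. \<Sum>r\<in>UNIV. x r m * a r k) 1 o' * hcoord \<gamma> 1 o')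
    = (\<Sum>o'\<in>UNIV. hcoord a 1 o' * hcoord (lmul x \<gamma>) 1 o')"
proof -
  have "(\<Sum>m\<in>UNIV. \<Sum>k\<in>UNIV. (\<Sum>r\<in>UNIV. x r m * a r k) * \<gamma> m k)
      = (\<Sum>m\<in>UNIV. \<Sum>k\<in>UNIV. \<Sum>r\<in>UNIV. a r k * (x r m * \<gamma> m k))"
    by (simp add: sum_distrib_right sum_distrib_left ac_simps)
  also have "\<dots> = (\<Sum>m\<in>UNIV. \<Sum>r\<in>UNIV. \<Sum>k\<in>UNIV. a r k * (x r m * \<gamma> m k))"
    by (intro sum.cong refl sum.swap)
  also have "\<dots> = (\<Sum>r\<in>UNIV. \<Sum>m\<in>UNIV. \<Sum>k\<in>UNIV. a r k * (x r m * \<gamma> m k))"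
    by (rule sum.swap)
  also have "\<dots> = (\<Sum>r\<in>UNIV. \<Sum>k\<in>UNIV. \<Sum>m\<in>UNIV. a r k * (x r m * \<gamma> m k))"
    by (intro sum.cong refl sum.swap)
  also have "\<dots> = (\<Sum>r\<in>UNIV. \<Sum>k\<in>UNIV. a r k * lmul x \<gamma> r k)"
    by (simp add: lmul_def sum_distrib_left)
  finally show ?thesis by (simp add: sum_option_prod)
qed

lemma polyfuns_diff:
  assumes P: "P \<in> polyfuns" and Q: "Q \<in> polyfuns"
  shows "(\<lambda>V. P V - Q V) \<in> polyfuns"
proof -
  have "(\<lambda>V. P V + (-1) * Q V) \<in> polyfuns"
    by (rule polyfuns_add[OF P polyfuns_mult[OF polyfuns_const Q]])
  then show ?thesis by simp
qed

lemma polyfuns_hcoord: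
  assumes "\<And>r l. (\<lambda>V. Y r l V) \<in> polyfuns"
  shows "(\<lambda>V. hcoord (\<lambda>r l. Y r l V) 1 o') \<in> polyfuns"
proof (cases o')
  case None
  have "(\<lambda>V. 1) \<in> polyfuns" by (rule polyfuns_const)
  then show ?thesis unfolding None hcoord_simps .
next
  case (Some p)
  obtain r l where "p = (r, l)" by (cases p)
  then show ?thesis unfolding Some using assms[of r l] by simp
qed

text \<open>After homogenizing y by V None, which is nonzero at the points tested, both sides are
  forms of degree D. Comparing coefficients at J leaves the factor N J, which is invertible in
  characteristic zero.\<close>

lemma power_identity_coeffs:
  fixes X :: "('n::finite \<times> 'd::finite) option \<Rightarrow> 'k::field"
  assumes char: "CHAR('k) = 0" and inf: "infinite (UNIV :: 'k set)"
    and eq: "\<And>y. (\<Sum>o'\<in>UNIV. hcoord y 1 o' * X o') ^ D = (\<Sum>C\<in>T. c C * (\<Sum>o'\<in>UNIV. hcoord y 1 o' * X' C o') ^ D)"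
    and J: "size J = D"
  shows "mon_at X J = (\<Sum>C\<in>T. c C * mon_at (X' C) J)"
proof -
  have scalars: "scalars (\<lambda>x :: 'k. x)" by unfold_locales (simp_all add: inf)
  obtain N :: "('n \<times> 'd) option multiset \<Rightarrow> nat" where N: "\<And>I. size I = D \<Longrightarrow> N I > 0"
    "\<And>z :: ('n \<times> 'd) option \<Rightarrow> 'k. (\<Sum>j\<in>UNIV. z j) ^ D = (\<Sum>I | size I = D. of_nat (N I) * mon_at z I)"
    by (rule multinomial[where 'j = "('n \<times> 'd) option" and 'a = 'k and D = D]) (rule that)
  define f where "f I = of_nat (N I) * mon_at X I" for I
  define g where "g I = of_nat (N I) * (\<Sum>C\<in>T. c C * mon_at (X' C) I)" for I
  have fg: "(\<Sum>I | size I = D. f I * mon_at V I) = (\<Sum>I | size I = D. g I * mon_at V I)"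
    if V: "\<And>l. V l \<noteq> 0" for V
  proof -
    define y where "y r l = V (Some (r, l)) / V None" for r l
    have Vy: "V o' = V None * hcoord y 1 o'" for o'
    proof (cases o')
      case (Some p)
      then show ?thesis using V[of None] by (cases p) (simp add: y_def)
    qed simp
    have expand: "(\<Sum>I | size I = D. of_nat (N I) * mon_at Z I * mon_at V I)
        = V None ^ D * (\<Sum>o'\<in>UNIV. hcoord y 1 o' * Z o') ^ D" for Z
    proof -
      have "(\<Sum>I | size I = D. of_nat (N I) * mon_at Z I * mon_at V I) = (\<Sum>o'\<in>UNIV. Z o' * V o') ^ D"
        unfolding N(2) mon_mult by (simp only: mult.assoc)
      also have "(\<Sum>o'\<in>UNIV. Z o' * V o') = (\<Sum>o'\<in>UNIV. V None * (hcoord y 1 o' * Z o'))"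
      proof (rule sum.cong)
        show "Z o' * V o' = V None * (hcoord y 1 o' * Z o')" for o'
          by (subst Vy) (simp only: ac_simps)
      qed simp
      finally show ?thesis by (simp only: sum_distrib_left[symmetric] power_mult_distrib)
    qed
    have "(\<Sum>I | size I = D. g I * mon_at V I)
        = (\<Sum>I | size I = D. \<Sum>C\<in>T. c C * (of_nat (N I) * mon_at (X' C) I * mon_at V I))"
      unfolding g_def sum_distrib_left sum_distrib_right by (intro sum.cong refl) (simp only: ac_simps)
    also have "\<dots> = (\<Sum>C\<in>T. \<Sum>I | size I = D. c C * (of_nat (N I) * mon_at (X' C) I * mon_at V I))"
      by (rule sum.swap)
    also have "\<dots> = (\<Sum>C\<in>T. V None ^ D * (c C * (\<Sum>o'\<in>UNIV. hcoord y 1 o' * X' C o') ^ D))"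
      unfolding sum_distrib_left[symmetric] expand by (simp only: sum_distrib_left ac_simps)
    also have "\<dots> = (\<Sum>I | size I = D. f I * mon_at V I)"
      unfolding sum_distrib_left[symmetric] eq[symmetric] f_def expand ..
    finally show ?thesis ..
  qed
  have "f J = g J" by (rule scalars.forms_unique[OF scalars, where c = f and d = g, OF fg J])
  moreover have "of_nat (N J) \<noteq> (0 :: 'k)"
    using N(1)[OF J] char by (simp add: of_nat_eq_0_iff_char_dvd)
  ultimately show ?thesis by (simp add: f_def g_def)
qed

text \<open>For n x d matrices x and y, the transpose of x times y has rank at most n, and its
  pairing with the identity matrix is that of y with x. \<open>power_reproducing\<close> replaces
  the identity matrix by matrices of the same shape, which become the B C ** A C. Comparing
  coefficients in y turns the identity of D-th powers into one of monomials in x.\<close>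

lemma monomial_reproducing:
  fixes D :: nat
  assumes char: "CHAR('k::field) = 0"
  obtains T :: "(('d::finite \<times> 'd) option \<Rightarrow> rat) set" and c :: "_ \<Rightarrow> 'k::field"
    and B :: "_ \<Rightarrow> 'k::field^'n::finite^'d::finite" and A :: "_ \<Rightarrow> 'k::field^'d::finite^'n::finite"
  where "finite T" and "\<And>(x :: 'k::field^'d::finite^'n::finite) I. size I = D \<Longrightarrow> mon_at (hcoord (\<lambda>r l. x $ r $ l) 1) I
    = (\<Sum>C\<in>T. c C * mon_at (hcoord (\<lambda>r l. (x ** (B C ** A C)) $ r $ l) 1) I)"
proof -
  interpret rh: scalars "rat_hom :: rat \<Rightarrow> 'k" by (rule scalars_rat_hom[OF char])
  have inf: "infinite (UNIV :: 'k set)"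
  proof
    assume fin: "finite (UNIV :: 'k set)"
    have "inj (rat_hom :: rat \<Rightarrow> 'k)"
      by (rule injI) (metis eq_iff_diff_eq_0 rh.iota_diff rh.iota_eq_0_iff)
    then have "finite (UNIV :: rat set)" using finite_subset[OF subset_UNIV fin] finite_imageD by blast
    then show False using infinite_UNIV_char_0 by blast
  qed
  define \<Y> where "\<Y> = {hcoord (\<lambda>(m :: 'd) k. \<Sum>r\<in>UNIV. x r m * a r k) 1 | x a :: 'n \<Rightarrow> 'd \<Rightarrow> rat. True}"
  define C0 :: "('d \<times> 'd) option \<Rightarrow> rat" where "C0 = hcoord (\<lambda>m k. if m = k then 1 else 0) 1"
  from power_reproducing[of \<Y> C0 D] obtain T c where T: "finite T" "T \<subseteq> \<Y>"
    and rep': "\<forall>Y\<in>\<Y>. (\<Sum>j\<in>UNIV. Y j * C0 j) ^ D = (\<Sum>C\<in>T. c C * (\<Sum>j\<in>UNIV. Y j * C j) ^ D)"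
    by (elim exE conjE) (rule that)
  note rep = bspec[OF rep']
  have "\<forall>C\<in>T. \<exists>ba :: ('n \<Rightarrow> 'd \<Rightarrow> rat) \<times> ('n \<Rightarrow> 'd \<Rightarrow> rat).
      C = hcoord (\<lambda>m k. \<Sum>r\<in>UNIV. fst ba r m * snd ba r k) 1"
  proof
    fix C assume "C \<in> T"
    then have "C \<in> \<Y>" using T(2) by (rule rev_subsetD)
    then obtain x a :: "'n \<Rightarrow> 'd \<Rightarrow> rat" where "C = hcoord (\<lambda>m k. \<Sum>r\<in>UNIV. x r m * a r k) 1"
      unfolding \<Y>_def mem_Collect_eq by (elim exE conjE) (rule that)
    then show "\<exists>ba :: ('n \<Rightarrow> 'd \<Rightarrow> rat) \<times> ('n \<Rightarrow> 'd \<Rightarrow> rat).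
      C = hcoord (\<lambda>m k. \<Sum>r\<in>UNIV. fst ba r m * snd ba r k) 1"
      by (intro exI[of _ "(x, a)"]) simp
  qed
  from bchoice[OF this] obtain ba' :: "_ \<Rightarrow> ('n \<Rightarrow> 'd \<Rightarrow> rat) \<times> ('n \<Rightarrow> 'd \<Rightarrow> rat)" where
    ba': "\<forall>C\<in>T. C = hcoord (\<lambda>m k. \<Sum>r\<in>UNIV. fst (ba' C) r m * snd (ba' C) r k) 1"
    by (elim exE) (rule that)
  define b where "b C = fst (ba' C)" for C
  define a where "a C = snd (ba' C)" for C
  have ba: "hcoord (\<lambda>m k. \<Sum>r\<in>UNIV. b C r m * a C r k) 1 = C" if "C \<in> T" for C
    unfolding b_def a_def by (rule bspec[OF ba' that, symmetric])
  define \<gamma> where "\<gamma> C m k = (\<Sum>r\<in>UNIV. b C r m * a C r k)" for C m k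
  have id: "lmul x (\<lambda>m k. if m = k then 1 else 0) = x" for x :: "'n \<Rightarrow> 'd \<Rightarrow> rat"
    by (simp add: lmul_def fun_eq_iff if_distrib[of "\<lambda>y. _ * y"] cong: if_cong)
  have rat: "(\<Sum>o'\<in>UNIV. hcoord y 1 o' * hcoord x 1 o') ^ D
      = (\<Sum>C\<in>T. c C * (\<Sum>o'\<in>UNIV. hcoord y 1 o' * hcoord (lmul x (\<gamma> C)) 1 o') ^ D)"
    for x y :: "'n \<Rightarrow> 'd \<Rightarrow> rat"
  proof -
    let ?Y = "hcoord (\<lambda>m k. \<Sum>r\<in>UNIV. x r m * y r k) 1"
    have "?Y \<in> \<Y>" unfolding \<Y>_def by blast
    from rep[OF this]
    have "(\<Sum>j\<in>UNIV. ?Y j * C0 j) ^ D = (\<Sum>C\<in>T. c C * (\<Sum>j\<in>UNIV. ?Y j * hcoord (\<gamma> C) 1 j) ^ D)"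
      unfolding \<gamma>_def[abs_def] by (rule trans) (intro sum.cong refl, simp add: ba)
    then show ?thesis unfolding C0_def pairing_lmul id .
  qed
  define \<gamma>' where "\<gamma>' C m k = (rat_hom (\<gamma> C m k) :: 'k)" for C m k
  \<comment> \<open>The identity is rewritten as the vanishing of a polynomial in the entries of y
    (left summand) and x (right summand); vanishing at rational points implies vanishing over
    k.\<close>
  define G where "G V = (\<Sum>o'\<in>UNIV. hcoord (\<lambda>r l. V (Inl (r, l))) 1 o' * hcoord (\<lambda>r l. V (Inr (r, l))) 1 o') ^ D
      - (\<Sum>C\<in>T. rat_hom (c C) * (\<Sum>o'\<in>UNIV. hcoord (\<lambda>r l. V (Inl (r, l))) 1 o'
          * hcoord (lmul (\<lambda>r l. V (Inr (r, l))) (\<gamma>' C)) 1 o') ^ D)"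
    for V :: "('n \<times> 'd) + ('n \<times> 'd) \<Rightarrow> 'k"
  have "G V = 0" for V
  proof (rule rh.polyfuns_zero[of G])
    have lm: "(\<lambda>V. lmul (\<lambda>r l. V (Inr (r, l))) (\<gamma>' C) r l) \<in> polyfuns" for C r l
      unfolding lmul_def by (intro polyfuns_sum polyfuns_mult polyfuns_const polyfuns_var)
    show "G \<in> polyfuns"
      unfolding G_def[abs_def]
      by (intro polyfuns_diff polyfuns_power polyfuns_sum polyfuns_mult polyfuns_hcoord polyfuns_const polyfuns_var lm)
    fix V :: "('n \<times> 'd) + ('n \<times> 'd) \<Rightarrow> rat"
    have hom: "hcoord (\<lambda>r l. rat_hom (Y r l)) 1 = (\<lambda>o'. rat_hom (hcoord Y 1 o') :: 'k)" for Y :: "'n \<Rightarrow> 'd \<Rightarrow> rat"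
      using hcoord_hom[of "rat_hom :: rat \<Rightarrow> 'k" Y 1] unfolding rh.iota_1 .
    have hom_lmul: "lmul (\<lambda>r l. rat_hom (x r l)) (\<gamma>' C) = (\<lambda>r l. rat_hom (lmul x (\<gamma> C) r l))" for x :: "'n \<Rightarrow> 'd \<Rightarrow> rat" and C
      by (simp add: lmul_def \<gamma>'_def fun_eq_iff rh.iota_sum rh.iota_mult)
    let ?y = "\<lambda>r l. V (Inl (r, l))" and ?x = "\<lambda>r l. V (Inr (r, l))"
    let ?L = "(\<Sum>o'\<in>UNIV. hcoord ?y 1 o' * hcoord ?x 1 o') ^ D"
    let ?R = "\<Sum>C\<in>T. c C * (\<Sum>o'\<in>UNIV. hcoord ?y 1 o' * hcoord (lmul ?x (\<gamma> C)) 1 o') ^ D"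
    have "G (\<lambda>i. rat_hom (V i)) = rat_hom (?L - ?R)"
      unfolding G_def hom_lmul hom
      by (simp only: rh.iota_sum rh.iota_mult rh.iota_power rh.iota_diff)
    also have "?L - ?R = 0" using rat[of ?y ?x] by (simp only: right_minus_eq)
    finally show "G (\<lambda>i. rat_hom (V i)) = 0" by (simp only: rh.iota_0)
  qed
  then have G0: "\<And>V. G V = 0" .
  have k_id: "(\<Sum>o'\<in>UNIV. hcoord y 1 o' * hcoord x 1 o') ^ D
      = (\<Sum>C\<in>T. rat_hom (c C) * (\<Sum>o'\<in>UNIV. hcoord y 1 o' * hcoord (lmul x (\<gamma>' C)) 1 o') ^ D)"
    for x y :: "'n \<Rightarrow> 'd \<Rightarrow> 'k"
    using G0[of "case_sum (case_prod y) (case_prod x)"] unfolding G_def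
    by (simp only: sum.case prod.case right_minus_eq)
  have mono: "mon_at (hcoord x 1) I = (\<Sum>C\<in>T. rat_hom (c C) * mon_at (hcoord (lmul x (\<gamma>' C)) 1) I)"
    if "size I = D" for x :: "'n \<Rightarrow> 'd \<Rightarrow> 'k" and I
    by (rule power_identity_coeffs[OF char inf k_id that])
  define B where "B C = (\<chi> m r. (rat_hom (b C r m) :: 'k))" for C
  define A where "A C = (\<chi> r l. (rat_hom (a C r l) :: 'k))" for C
  have BA: "(\<lambda>r l. (x ** (B C ** A C)) $ r $ l) = lmul (\<lambda>r l. x $ r $ l) (\<gamma>' C)" for x :: "'k^'d^'n" and C
    by (simp add: fun_eq_iff lmul_def \<gamma>'_def \<gamma>_def A_def B_def matrix_matrix_mult_def rh.iota_sum rh.iota_mult)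
  show ?thesis
  proof (rule that[of T "\<lambda>C. rat_hom (c C)" B A, OF T(1)])
    fix x :: "'k^'d^'n" and I :: "('n \<times> 'd) option multiset" assume "size I = D"
    then show "mon_at (hcoord (\<lambda>r l. x $ r $ l) 1) I
      = (\<Sum>C\<in>T. rat_hom (c C) * mon_at (hcoord (\<lambda>r l. (x ** (B C ** A C)) $ r $ l) 1) I)"
      unfolding BA by (rule mono)
  qed
qed

lemma (in polarization) S_subset_R_char_0:
  assumes "CHAR('k) = 0"
  shows "S \<subseteq> R"
proof
  fix F assume F: "F \<in> S"
  obtain \<kappa> D where \<kappa>: "homogenizes \<kappa> D F" using ex_homogenizes by blast
  obtain T :: "(('d \<times> 'd) option \<Rightarrow> rat) set" and c B and A :: "_ \<Rightarrow> 'k^'d^'n" where T: "finite T"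
    and rep: "\<And>x :: 'k^'d^'n. \<And>I. size I = D \<Longrightarrow> mon_at (hcoord (\<lambda>r l. x $ r $ l) 1) I
    = (\<Sum>C\<in>T. c C * mon_at (hcoord (\<lambda>r l. (x ** (B C ** A C)) $ r $ l) 1) I)"
    using monomial_reproducing[OF assms] by blast
  have "F = (\<Sum>C\<in>T. const_poly (c C) * right_act (B C ** A C) F)"
  proof (rule mat_poly_eqI)
    fix x
    have "value_at F x = (\<Sum>I | size I = D. \<Sum>C\<in>T. \<kappa> I * (c C * mon_at (hcoord (\<lambda>r l. (x ** (B C ** A C)) $ r $ l) 1) I))"
      using \<kappa> unfolding homogenizes_def by (simp add: rep sum_distrib_left)
    also have "\<dots> = (\<Sum>C\<in>T. c C * value_at F (x ** (B C ** A C)))"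
      using \<kappa> unfolding homogenizes_def by (subst sum.swap) (simp add: sum_distrib_left ac_simps)
    finally show "value_at F x = value_at (\<Sum>C\<in>T. const_poly (c C) * right_act (B C ** A C) F) x" by simp
  qed
  also have "\<dots> \<in> R"
  proof (rule subring_sum[OF subring_R], rule unital_subringD(4)[OF subring_R])
    show "const_poly a \<in> R" for a using subalgebra_R unfolding subalgebra_def by blast
    show "right_act (B C ** A C) F \<in> R" for C by (rule low_rank_R[OF F])
  qed
  finally show "F \<in> R" .
qed

section \<open>Roots of polynomial functions\<close>

definition expr :: "('n \<times> 'd) multiset set \<Rightarrow> (('n \<times> 'd) multiset \<Rightarrow> 'k) \<Rightarrow>
    ('k::alg_closed_field, 'n::finite, 'd::finite) mat_poly" where
  "expr E c = (\<Sum>I\<in>E. const_poly (c I) * mon_at (case_prod coord_poly) I)"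

lemma value_at_expr:
  "value_at (expr E c) (\<chi> r l. V (r, l)) = (\<Sum>I\<in>E. c I * mon_at V I)"
proof -
  have "(\<lambda>i. value_at (case_prod coord_poly i) (\<chi> r l. V (r, l))) = V" by (auto simp: fun_eq_iff)
  then show ?thesis by (simp add: expr_def)
qed

lemma expr_mult_const: "const_poly a * expr E c = expr E (\<lambda>I. a * c I)"
  by (rule mat_poly_eqI) (simp add: expr_def sum_distrib_left mult.assoc)

lemma expr_zero_coeff:
  fixes c :: "('n::finite \<times> 'd::finite) multiset \<Rightarrow> 'k::alg_closed_field"
  assumes "finite E" "expr E c = 0" "I \<in> E"
  shows "c I = 0"
proof -
  have scalars: "scalars (\<lambda>x :: 'k. x)" by unfold_locales (simp_all add: infinite_alg_closed_field)
  have "c I \<in> {0}"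
  proof (rule scalars.coeff_mem[OF scalars scalars.subsp_zero[OF scalars] assms(1) _ assms(3)])
    show "(\<Sum>I\<in>E. c I * mon_at (\<lambda>i. V i) I) \<in> {0}" for V
      using value_at_expr[of E c V] assms(2) by simp
  qed
  then show ?thesis by simp
qed

definition mspan :: "(('n \<times> 'd) multiset \<Rightarrow> bool) \<Rightarrow> ('k::alg_closed_field, 'n::finite, 'd::finite) mat_poly set" where
  "mspan Q = {G. \<exists>E c. finite E \<and> (\<forall>I\<in>E. Q I) \<and> G = expr E c}"

lemma mspan_zero: "0 \<in> mspan Q"
  unfolding mspan_def by (rule CollectI, rule exI[of _ "{}"]) (simp add: expr_def)

lemma mspan_add:
  fixes F G :: "('k::alg_closed_field, 'n::finite, 'd::finite) mat_poly"
  assumes "F \<in> mspan Q" "G \<in> mspan Q"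
  shows "F + G \<in> mspan Q"
proof -
  from assms obtain E c E' d where E: "finite E" "\<forall>I\<in>E. Q I" "F = expr E c" "finite E'" "\<forall>I\<in>E'. Q I" "G = expr E' d"
    unfolding mspan_def by blast
  have ext: "expr E c = expr (E \<union> E') (\<lambda>I. if I \<in> E then c I else 0)"
    if "finite E" "finite E'" for E E' :: "('n \<times> 'd) multiset set" and c :: "_ \<Rightarrow> 'k"
    unfolding expr_def
  proof (rule sum.mono_neutral_cong_left)
    have "const_poly 0 = (0 :: ('k, 'n, 'd) mat_poly)" by (rule mat_poly_eqI) simp
    then show "\<forall>i\<in>E \<union> E' - E. const_poly (if i \<in> E then c i else 0) * mon_at (case_prod coord_poly) i = (0 :: ('k, 'n, 'd) mat_poly)"
      by simp
  qed (use that in auto)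
  have "F + G = expr (E \<union> E') (\<lambda>I. (if I \<in> E then c I else 0) + (if I \<in> E' then d I else 0))"
    unfolding E(3,6) ext[OF E(1,4)] ext[OF E(4,1)] Un_commute[of E' E]
    by (rule mat_poly_eqI) (simp add: expr_def distrib_right sum.distrib)
  moreover have "finite (E \<union> E')" "\<forall>I\<in>E \<union> E'. Q I" using E by auto
  ultimately show ?thesis unfolding mspan_def by blast
qed

lemma mspan_const_mult:
  assumes "F \<in> mspan Q"
  shows "const_poly a * F \<in> mspan Q"
proof -
  from assms obtain E c where E: "finite E" "\<forall>I\<in>E. Q I" "F = expr E c" unfolding mspan_def by blast
  show ?thesis unfolding E(3) expr_mult_const mspan_def using E(1,2) by blast
qed

lemma mspan_sum: "(\<And>t. t \<in> T \<Longrightarrow> F t \<in> mspan Q) \<Longrightarrow> (\<Sum>t\<in>T. F t) \<in> mspan Q"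
  by (induction T rule: infinite_finite_induct) (simp_all add: mspan_zero mspan_add)

lemma mspan_mon:
  assumes "Q I"
  shows "mon_at (case_prod coord_poly) I \<in> mspan Q"
proof -
  have "mon_at (case_prod coord_poly) I = expr {I} (\<lambda>_. 1)"
    unfolding expr_def by (rule mat_poly_eqI) simp
  then show ?thesis unfolding mspan_def using assms
    by (intro CollectI exI[of _ "{I}"] exI[of _ "\<lambda>_. 1"] conjI) simp_all
qed

lemma mspan_disjoint:
  assumes "G \<in> mspan Q" "G \<in> mspan (\<lambda>I. \<not> Q I)"
  shows "G = 0"
proof -
  from assms obtain E c E' d where E: "finite E" "\<forall>I\<in>E. Q I" "G = expr E c" "finite E'" "\<forall>I\<in>E'. \<not> Q I" "G = expr E' d"
    unfolding mspan_def by blast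
  have disj: "E \<inter> E' = {}" using E by blast
  define f where "f I = (if I \<in> E then c I else - d I)" for I
  have "expr (E \<union> E') f = expr E c + expr E' (\<lambda>I. - 1 * d I)"
  proof -
    have "expr (E \<union> E') f = expr E f + expr E' f"
      unfolding expr_def by (rule sum.union_disjoint[OF E(1,4) disj])
    moreover have "expr E f = expr E c" unfolding expr_def by (intro sum.cong) (auto simp: f_def)
    moreover have "expr E' f = expr E' (\<lambda>I. - 1 * d I)"
      unfolding expr_def using disj by (intro sum.cong) (auto simp: f_def)
    ultimately show ?thesis by simp
  qed
  also have "\<dots> = 0" unfolding expr_mult_const[symmetric] E(3)[symmetric] E(6)[symmetric]
    by (rule mat_poly_eqI) simp
  finally have "f I = 0" if "I \<in> E" for I
    using expr_zero_coeff[of "E \<union> E'" f I] E(1,4) that by blast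
  then have "c I = 0" if "I \<in> E" for I using that by (auto simp: f_def)
  then show ?thesis unfolding E(3) by (intro mat_poly_eqI) (simp add: expr_def)
qed

lemma ex_expr: "\<exists>E c. finite E \<and> F = expr E c"
proof -
  have "value_at F \<in> poly_functions" by (rule value_at)
  then have "\<exists>G\<in>mspan (\<lambda>_. True). \<forall>x. value_at F x = value_at G x"
  proof (induction rule: poly_functions.induct)
    case (const a)
    have "const_poly a * mon_at (case_prod coord_poly) {#} \<in> mspan (\<lambda>_. True)"
      by (intro mspan_const_mult mspan_mon) simp
    then show ?case by (rule rev_bexI) simp
  next
    case (coord i c)
    have "mon_at (case_prod coord_poly) {#(i, c)#} \<in> mspan (\<lambda>_. True)" by (intro mspan_mon) simp
    then show ?case by (rule rev_bexI) simp
  next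
    case (add F G)
    then obtain P Q where P: "P \<in> mspan (\<lambda>_. True)" "\<forall>x. F x = value_at P x"
      and Q: "Q \<in> mspan (\<lambda>_. True)" "\<forall>x. G x = value_at Q x" by blast
    show ?case by (rule rev_bexI[OF mspan_add[OF P(1) Q(1)]]) (simp add: P Q)
  next
    case (mult F G)
    then obtain P Q where P: "P \<in> mspan (\<lambda>_. True)" "\<forall>x. F x = value_at P x"
      and Q: "Q \<in> mspan (\<lambda>_. True)" "\<forall>x. G x = value_at Q x" by blast
    from P(1) Q(1) obtain E c E' d where E: "P = expr E c" "Q = expr E' d" unfolding mspan_def by blast
    have "P * Q = (\<Sum>I\<in>E. \<Sum>J\<in>E'. const_poly (c I * d J) * mon_at (case_prod coord_poly) (I + J))"
      unfolding E by (rule mat_poly_eqI) (simp add: expr_def sum_product ac_simps)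
    also have "\<dots> \<in> mspan (\<lambda>_. True)"
      by (intro mspan_sum mspan_const_mult mspan_mon) simp
    finally have "P * Q \<in> mspan (\<lambda>_. True)" .
    then show ?case by (rule rev_bexI) (simp add: P Q)
  qed
  then obtain G where "G \<in> mspan (\<lambda>_. True)" "F = G" using mat_poly_eqI by blast
  then show ?thesis unfolding mspan_def by blast
qed

lemma ex_repeat_mset:
  fixes I :: "'v::finite multiset"
  assumes "\<forall>i. p dvd count I i"
  shows "\<exists>Q. I = repeat_mset p Q"
proof -
  define Q where "Q = Abs_multiset (\<lambda>i. count I i div p)"
  have "count Q i = count I i div p" for i
    unfolding Q_def by (subst count_Abs_multiset) auto
  then have "I = repeat_mset p Q" using assms by (intro multiset_eqI) simp
  then show ?thesis by blast
qed

text \<open>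
  The polynomial ring is graded by the exponents modulo \<open>p\<close>, and its part of degree zero consists of
  the \<open>p\<close>-th powers.
\<close>

lemma power_quotient_is_power:
  fixes a b r :: "('k::alg_closed_field, 'n::finite, 'd::finite) mat_poly"
  assumes p: "p = CHAR('k)" "prime p" and eq: "a ^ p = b ^ p * r" and b: "b \<noteq> 0"
  shows "\<exists>r1. r = r1 ^ p"
proof -
  define Q where "Q I \<longleftrightarrow> (\<forall>i. p dvd count I i)" for I :: "('n \<times> 'd) multiset"
  let ?m = "mon_at (case_prod coord_poly) :: _ \<Rightarrow> ('k, 'n, 'd) mat_poly"
  have prime: "prime CHAR(('k, 'n, 'd) mat_poly)" using p by (simp add: CHAR_mat_poly)
  have p_CHAR: "p = CHAR(('k, 'n, 'd) mat_poly)" using p by (simp add: CHAR_mat_poly)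
  note frobenius_sum = freshmans_dream_sum[OF prime p_CHAR]
  have const_power: "const_poly a ^ n = (const_poly (a ^ n) :: ('k, 'n, 'd) mat_poly)" for a n
    by (rule mat_poly_eqI) simp
  have power: "expr E c ^ p = (\<Sum>I\<in>E. const_poly (c I ^ p) * ?m (repeat_mset p I))" for E c
  proof -
    have "expr E c ^ p = (\<Sum>I\<in>E. (const_poly (c I) * ?m I) ^ p)"
      unfolding expr_def by (rule frobenius_sum)
    then show ?thesis by (simp add: power_mult_distrib const_power)
  qed
  have Q_repeat: "Q (repeat_mset p I)" for I by (simp add: Q_def)
  have power_Q: "F ^ p \<in> mspan Q" for F :: "('k, 'n, 'd) mat_poly"
  proof -
    obtain E c where "F = expr E c" using ex_expr by blast
    then have "F ^ p = (\<Sum>I\<in>E. const_poly (c I ^ p) * ?m (repeat_mset p I))" by (simp only: power)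
    also have "\<dots> \<in> mspan Q" by (intro mspan_sum mspan_const_mult mspan_mon Q_repeat)
    finally show ?thesis .
  qed
  obtain E c where E: "finite E" "r = expr E c" using ex_expr by blast
  define E0 where "E0 = {I\<in>E. Q I}"
  define E1 where "E1 = {I\<in>E. \<not> Q I}"
  have r: "r = expr E0 c + expr E1 c"
    unfolding E(2) expr_def E0_def E1_def
    by (subst sum.union_disjoint[symmetric]) (use E(1) in \<open>auto intro: sum.cong\<close>)
  have "\<forall>I\<in>E0. \<exists>J. I = repeat_mset p J" using ex_repeat_mset unfolding E0_def Q_def by blast
  from bchoice[OF this] obtain h where h: "\<And>I. I \<in> E0 \<Longrightarrow> I = repeat_mset p (h I)" by blast
  have "\<forall>x :: 'k. \<exists>y. y ^ p = x"
    using nth_root_exists[OF prime_gt_0_nat[OF p(2)]] by blast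
  from choice[OF this] obtain root where root: "\<And>x :: 'k. root x ^ p = x" by blast
  define r1 where "r1 = (\<Sum>I\<in>E0. const_poly (root (c I)) * ?m (h I))"
  have r1: "expr E0 c = r1 ^ p"
  proof -
    have "r1 ^ p = (\<Sum>I\<in>E0. (const_poly (root (c I)) * ?m (h I)) ^ p)"
      unfolding r1_def by (rule frobenius_sum)
    also have "\<dots> = (\<Sum>I\<in>E0. const_poly (c I) * ?m I)"
    proof (rule sum.cong)
      fix I assume "I \<in> E0"
      from arg_cong[OF h[OF this], of ?m] have "?m I = ?m (h I) ^ p" by (simp only: mon_repeat_mset)
      then show "(const_poly (root (c I)) * ?m (h I)) ^ p = const_poly (c I) * ?m I"
        by (simp add: power_mult_distrib const_power root)
    qed simp
    finally show ?thesis by (simp add: expr_def)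
  qed
  \<comment> \<open>\<open>expr E1 c\<close> is the part of r of nonzero degree, and multiplication
    by b^p preserves degrees. As its product with b^p is a p-th power, hence of degree zero, it has
    to vanish.\<close>
  have "b ^ p * expr E1 c = a ^ p - (b * r1) ^ p"
    using eq unfolding r r1 by (simp add: algebra_simps power_mult_distrib)
  also have "\<dots> = (a - b * r1) ^ p"
    using diff_power_char[OF prime, of p 1] p by (simp add: CHAR_mat_poly)
  finally have u: "b ^ p * expr E1 c = (a - b * r1) ^ p" .
  have "b ^ p * expr E1 c = 0"
  proof (rule mspan_disjoint)
    show "b ^ p * expr E1 c \<in> mspan Q" unfolding u by (rule power_Q)
    obtain Eb cb where Eb: "b = expr Eb cb" using ex_expr by blast
    have "b ^ p * expr E1 c = (\<Sum>I\<in>Eb. \<Sum>J\<in>E1. const_poly (cb I ^ p * c J) * ?m (repeat_mset p I + J))"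
      unfolding Eb power expr_def[of E1] sum_product
      by (intro sum.cong refl, rule mat_poly_eqI) (simp only: value_at_simps mon_union ac_simps)
    also have "\<dots> \<in> mspan (\<lambda>I. \<not> Q I)"
    proof (intro mspan_sum mspan_const_mult mspan_mon)
      fix I J assume "J \<in> E1"
      then obtain i where "\<not> p dvd count J i" unfolding E1_def Q_def by blast
      then have "\<not> p dvd count (repeat_mset p I + J) i" by (simp add: dvd_add_right_iff)
      then show "\<not> Q (repeat_mset p I + J)" unfolding Q_def by blast
    qed
    finally show "b ^ p * expr E1 c \<in> mspan (\<lambda>I. \<not> Q I)" .
  qed
  then have "expr E1 c = 0" using b by simp
  then have "r = r1 ^ p" using r r1 by simp
  then show ?thesis by blast
qed

text \<open>One p-th root is taken at a time: r is a p-th power, and Frobenius is injective. This is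
  the part of the normality of the polynomial ring that concerns p-power roots.\<close>

lemma root_divides:
  fixes a b r :: "('k::alg_closed_field, 'n::finite, 'd::finite) mat_poly"
  assumes p: "p = CHAR('k)" "prime p" and "a ^ (p ^ m) = b ^ (p ^ m) * r" and b: "b \<noteq> 0"
  shows "\<exists>c. a = b * c"
  using assms(3)
proof (induction m arbitrary: r)
  case (Suc m)
  have prime: "prime CHAR(('k, 'n, 'd) mat_poly)" using p by (simp add: CHAR_mat_poly)
  have eq: "(a ^ (p ^ m)) ^ p = (b ^ (p ^ m)) ^ p * r"
    using Suc.prems by (simp add: power_mult mult.commute[of p])
  then obtain r1 where r1: "r = r1 ^ p" using power_quotient_is_power[OF p eq] b by auto
  have "(a ^ (p ^ m) - b ^ (p ^ m) * r1) ^ p = (a ^ (p ^ m)) ^ p - (b ^ (p ^ m) * r1) ^ p"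
    using diff_power_char[OF prime, of p 1] p by (simp add: CHAR_mat_poly)
  also have "\<dots> = 0" unfolding eq r1 by (simp add: power_mult_distrib)
  finally have "a ^ (p ^ m) = b ^ (p ^ m) * r1" by simp
  then show ?case by (rule Suc.IH)
qed auto

section \<open>The quotient field\<close>

context polarization
begin

section \<open>Cramer's rule for the generic matrix, and denominators in R\<close>

definition detp :: "('k, 'n, 'n) mat_poly" where "detp = Abs_mat_poly det"

lemma value_at_detp: "value_at detp y = det y"
  unfolding detp_def by (subst Abs_mat_poly_inverse[OF det_poly_function]) (rule refl)

lemma detp_invariant:
  assumes "H \<subseteq> SL"
  shows "detp \<in> invariants H"
  unfolding invariants_iff value_at_detp det_mul
proof (intro ballI allI)
  fix h and y :: "'k^'n^'n" assume "h \<in> H"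
  then have h: "det h = 1" using assms by (auto simp: SL_def)
  then have "invertible h" by (simp add: invertible_det_nz)
  then have "h ** matrix_inv h = mat 1"
    unfolding invertible_def matrix_inv_def by (rule someI_ex[THEN conjunct1])
  then have "det h * det (matrix_inv h) = 1" by (metis det_I det_mul)
  then show "det (matrix_inv h) * det y = det y" using h by simp
qed

definition cols :: "'k^'d^'n \<Rightarrow> 'k^'n^'n" where "cols x = (\<chi> i c. x $ i $ \<sigma> c)"

text \<open>\<Delta> is the minor formed by the columns \<sigma> c, and \<Delta>' c l arises from it
  when the column \<sigma> c is replaced by the column l; the equations are Cramer's rule. Both are
  polarizations of the determinant, which is invariant as H lies in SL.\<close>

lemma polarized_det:
  assumes "H \<subseteq> SL"
  obtains \<Delta> :: "('k, 'n, 'd) mat_poly" and \<Delta>' :: "'n \<Rightarrow> 'd \<Rightarrow> ('k, 'n, 'd) mat_poly"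
  where "\<Delta> \<in> R" "\<Delta> \<noteq> 0" "\<And>c l. \<Delta>' c l \<in> R"
    "\<And>r l. (\<Sum>c\<in>UNIV. coord_poly r (\<sigma> c) * \<Delta>' c l) = \<Delta> * coord_poly r l"
proof -
  define g where "g c l = (\<chi> k m. if m = \<sigma> c then if k = l then 1 else 0 else if k = m then 1 else (0 :: 'k))" for c l
  define \<Delta> where "\<Delta> = right_act (mat 1) (first_cols \<sigma> detp)"
  define \<Delta>' where "\<Delta>' c l = right_act (g c l) (first_cols \<sigma> detp)" for c l
  have \<Delta>_R: "\<Delta> \<in> R" "\<Delta>' c l \<in> R" for c l
    unfolding \<Delta>_def \<Delta>'_def by (rule generator_R[OF detp_invariant[OF assms]])+
  have \<Delta>_val: "value_at \<Delta> x = det (cols x)" for x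
    by (simp add: \<Delta>_def value_at_detp cols_def)
  have \<Delta>'_val: "value_at (\<Delta>' c l) x = det (\<chi> i j. if j = c then x $ i $ l else cols x $ i $ j)" for c l x
  proof -
    have "(x ** g c l) $ i $ \<sigma> j = (if j = c then x $ i $ l else x $ i $ \<sigma> j)" for i j
    proof -
      have "(x ** g c l) $ i $ \<sigma> j = (\<Sum>k\<in>UNIV. x $ i $ k * (if \<sigma> j = \<sigma> c then if k = l then 1 else 0 else if k = \<sigma> j then 1 else 0))"
        by (simp add: matrix_matrix_mult_def g_def)
      also have "\<dots> = (\<Sum>k\<in>UNIV. if k = (if j = c then l else \<sigma> j) then x $ i $ k else 0)"
        using inj_\<sigma> by (intro sum.cong) (auto dest: injD)
      finally show ?thesis by simp
    qed
    then show ?thesis by (simp add: \<Delta>'_def value_at_detp cols_def cong: if_cong)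
  qed
  have "\<Delta> \<noteq> 0"
  proof
    assume "\<Delta> = 0"
    define x :: "'k^'d^'n" where "x = (\<chi> i l. if l = \<sigma> i then 1 else 0)"
    have "cols x = mat 1" using inj_\<sigma> by (auto simp: cols_def x_def mat_def vec_eq_iff dest: injD)
    then have "value_at \<Delta> x = 1" by (simp add: \<Delta>_val)
    then show False using \<open>\<Delta> = 0\<close> by simp
  qed
  have "(\<Sum>c\<in>UNIV. coord_poly r (\<sigma> c) * \<Delta>' c l) = \<Delta> * coord_poly r l" for r l
  proof -
    \<comment> \<open>Cramer's rule is available only where the minor is nonzero. The extra factor
      \<Delta> makes the identity trivial elsewhere and is cancelled afterwards.\<close>
    have "\<Delta> * ((\<Sum>c\<in>UNIV. coord_poly r (\<sigma> c) * \<Delta>' c l) - \<Delta> * coord_poly r l) = 0"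
    proof (rule mat_poly_eqI)
      fix x :: "'k^'d^'n"
      show "value_at (\<Delta> * ((\<Sum>c\<in>UNIV. coord_poly r (\<sigma> c) * \<Delta>' c l) - \<Delta> * coord_poly r l)) x = value_at 0 x"
      proof (cases "det (cols x) = 0")
        case False
        define b where "b = (\<chi> i. x $ i $ l)"
        define z where "z = (\<chi> k. det (\<chi> i j. if j = k then b $ i else cols x $ i $ j) / det (cols x))"
        have "cols x *v z = b" using cramer[OF False, of z b] by (simp add: z_def)
        then have "(\<Sum>c\<in>UNIV. cols x $ r $ c * z $ c) = b $ r" by (simp add: matrix_vector_mult_def vec_eq_iff)
        moreover have "z $ c = value_at (\<Delta>' c l) x / det (cols x)" for c
          by (simp add: z_def \<Delta>'_val b_def cong: if_cong)
        ultimately have "(\<Sum>c\<in>UNIV. cols x $ r $ c * value_at (\<Delta>' c l) x) = det (cols x) * b $ r"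
          using False by (simp add: sum_divide_distrib[symmetric] field_simps)
        then show ?thesis by (simp add: \<Delta>_val b_def cols_def)
      qed (simp add: \<Delta>_val)
    qed
    then show ?thesis using \<open>\<Delta> \<noteq> 0\<close> by simp
  qed
  then show ?thesis using that \<Delta>_R \<open>\<Delta> \<noteq> 0\<close> by blast
qed

text \<open>By Cramer's rule F(x) = F(y a), where y consists of the columns \<sigma> c of x and a
  has the entries \<Delta>' c l / \<Delta>. As a polynomial in a, F(y a) has its coefficients in R,
  because its values at scalar matrices a lie there by \<open>low_rank_R\<close>. So \<Delta>^D is a
  denominator.\<close>

lemma S_denominator:
  assumes SL: "H \<subseteq> SL" and F: "F \<in> S"
  shows "\<exists>d\<in>R. d \<noteq> 0 \<and> d * F \<in> R"
proof -
  obtain \<Delta> :: "('k, 'n, 'd) mat_poly" and \<Delta>' where \<Delta>: "\<Delta> \<in> R" "\<Delta> \<noteq> 0" "\<And>c l. \<Delta>' c l \<in> R"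
    and cramer: "\<And>r l. (\<Sum>c\<in>UNIV. coord_poly r (\<sigma> c) * \<Delta>' c l) = \<Delta> * coord_poly r l"
    by (rule polarized_det[OF SL]) (rule that)
  obtain \<kappa> D where \<kappa>: "homogenizes \<kappa> D F" using ex_homogenizes by blast
  define Y where "Y V r l = (\<Sum>c\<in>UNIV. gen_coord r (\<sigma> c) * V (Some (c, l)))"
    for V :: "('n \<times> 'd) option \<Rightarrow> ('k, 'n, 'd) mat_poly fract" and r and l
  define P where "P V = hval \<kappa> D (Y V) (V None)" for V
  have "P \<in> polys {J. size J = D}"
  proof -
    have hc: "(\<lambda>V. hcoord (Y V) (V None) o') \<in> polys {J. size J = 1}" for o'
    proof (cases o')
      case None
      have "(\<lambda>V. mon_at V {#None#}) \<in> polys {J :: ('n \<times> 'd) option multiset. size J = 1}"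
        by (intro polys_mon) auto
      then show ?thesis by (simp add: None)
    next
      case (Some rl)
      obtain r l where "rl = (r, l)" by (cases rl)
      have "(\<lambda>V. \<Sum>c\<in>UNIV. gen_coord r (\<sigma> c) * mon_at V {#Some (c, l)#}) \<in> polys {J :: ('n \<times> 'd) option multiset. size J = 1}"
        by (intro polys_sum polys_scale polys_mon) auto
      then show ?thesis by (simp add: Some \<open>rl = (r, l)\<close> Y_def)
    qed
    have "(\<lambda>V. mon_at (hcoord (Y V) (V None)) I) \<in> polys {J. size J = size I}" for I
    proof (induction I)
      case empty
      show ?case using polys_mon[of "{#}" "{J. size J = 0}"] by simp
    next
      case (add o' I)
      show ?case using polys_mult[OF hc[of o'] add, of "{J. size J = Suc (size I)}"] by simp
    qed
    then show ?thesis unfolding P_def[abs_def] hval_def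
      by (intro polys_sum polys_scale) auto
  qed
  then obtain c where c: "\<And>V. P V = (\<Sum>J | size J = D. c J * mon_at V J)" using polysD by blast
  note ring = subring_to_fract[OF subring_R]
  have cR: "c J \<in> to_fract ` R" if J: "size J = D" for J
  proof (rule sc.coeff_mem[OF subsp_to_fract[OF subalgebra_R], of "{J. size J = D}"])
    fix V :: "('n \<times> 'd) option \<Rightarrow> 'k" assume V: "\<And>i. V i \<noteq> 0"
    define m where "m = V None"
    define b :: "'k^'n^'d" where "b = (\<chi> k c. if k = \<sigma> c then 1 else 0)"
    define a :: "'k^'d^'n" where "a = (\<chi> c l. V (Some (c, l)) / m)"
    have "Y (\<lambda>i. sc (V i)) r l = sc m * (\<Sum>k\<in>UNIV. gen_coord r k * sc ((b ** a) $ k $ l))" for r l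
    proof -
      have V: "V (Some (c, l)) = m * a $ c $ l" for c using V[of None] by (simp add: a_def m_def)
      have "(\<Sum>k\<in>UNIV. gen_coord r k * sc ((b ** a) $ k $ l))
          = (\<Sum>k\<in>UNIV. \<Sum>c\<in>UNIV. gen_coord r k * (sc (b $ k $ c) * sc (a $ c $ l)))"
        by (simp add: matrix_matrix_mult_def sc.iota_sum sc.iota_mult sum_distrib_left)
      also have "\<dots> = (\<Sum>c\<in>UNIV. \<Sum>k\<in>UNIV. gen_coord r k * (sc (b $ k $ c) * sc (a $ c $ l)))"
        by (rule sum.swap)
      also have "\<dots> = (\<Sum>c\<in>UNIV. \<Sum>k\<in>UNIV. if k = \<sigma> c then gen_coord r k * sc (a $ c $ l) else 0)"
        by (intro sum.cong) (auto simp: b_def)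
      finally show ?thesis by (simp add: Y_def V sc.iota_mult sum_distrib_left ac_simps)
    qed
    then have "Y (\<lambda>i. sc (V i)) = (\<lambda>r l. sc m * (\<Sum>k\<in>UNIV. gen_coord r k * sc ((b ** a) $ k $ l)))"
      by (simp add: fun_eq_iff)
    then have "P (\<lambda>i. sc (V i)) = sc m ^ D * to_fract (right_act (b ** a) F)"
      unfolding P_def m_def[symmetric] hval_right_act[OF \<kappa>, symmetric]
      by (simp add: hval_scale[where m = 1, simplified])
    also have "\<dots> \<in> to_fract ` R"
    proof (intro unital_subringD(4)[OF ring] subring_power[OF ring])
      have "const_poly m \<in> R" using subalgebra_R unfolding subalgebra_def by blast
      then show "sc m \<in> to_fract ` R" unfolding sc_def by blast
      show "to_fract (right_act (b ** a) F) \<in> to_fract ` R" using low_rank_R[OF F] by blast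
    qed
    finally show "(\<Sum>J | size J = D. c J * mon_at (\<lambda>i. sc (V i)) J) \<in> to_fract ` R" unfolding c .
  qed (use J in auto)
  define W where "W = hcoord (\<lambda>c l. to_fract (\<Delta>' c l)) (to_fract \<Delta>)"
  have W_R: "W o' \<in> to_fract ` R" for o'
    using \<Delta> by (cases o') (auto simp: W_def hcoord_def split: prod.splits)
  have "Y W r l = to_fract \<Delta> * gen_coord r l" for r l
    using arg_cong[OF cramer[of r l], of to_fract] by (simp add: Y_def W_def gen_coord_def)
  then have "Y W = (\<lambda>r l. to_fract \<Delta> * gen_coord r l)" by (simp add: fun_eq_iff)
  then have "P W = to_fract \<Delta> ^ D * hval \<kappa> D gen_coord 1"
    by (simp add: P_def W_def hval_scale[where m = 1, simplified])
  also have "hval \<kappa> D gen_coord 1 = to_fract F"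
    by (rule hval_to_fract[OF \<kappa>, of _ coord_poly]) (simp_all add: gen_coord_def)
  finally have "to_fract (\<Delta> ^ D * F) = (\<Sum>J | size J = D. c J * mon_at W J)"
    by (simp add: c to_fract_power)
  also have "\<dots> \<in> to_fract ` R"
    by (intro subring_sum[OF ring] unital_subringD(4)[OF ring] subring_mon[OF ring] W_R cR) simp
  finally have "\<Delta> ^ D * F \<in> R" by (metis imageE to_fract_eq_iff)
  moreover have "\<Delta> ^ D \<in> R" using subring_power[OF subring_R \<Delta>(1)] .
  moreover have "\<Delta> ^ D \<noteq> 0" using \<Delta>(2) by simp
  ultimately show ?thesis by blast
qed

lemma S_quotient:
  assumes "b * c \<in> S" "b \<in> S" "b \<noteq> 0"
  shows "c \<in> S"
  unfolding S_def invariants_def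
proof (intro CollectI ballI)
  fix h assume h: "h \<in> H"
  have "b * left_act h c = left_act h (b * c)"
    by (rule mat_poly_eqI) (use assms(2) h in \<open>simp add: S_iff\<close>)
  also have "\<dots> = b * c" using assms(1) h unfolding S_def invariants_def by blast
  finally show "left_act h c = c" using assms(3) by simp
qed

end

theorem corollary9:
  fixes H :: "('k::alg_closed_field^'n::finite^'n) set"
    and \<sigma> :: "'n \<Rightarrow> 'd::finite"
    and p :: nat
  assumes "p = CHAR('k)"
    and "CARD('n) \<le> CARD('d)"
    and "inj \<sigma>"
    and "reductive H"
  shows "contained_in_root_closure p
           (invariants H :: ('k, 'n, 'd) mat_poly set)
           (polarized_algebra \<sigma> (invariants H))
       \<and> (H \<subseteq> SL \<longrightarrow>
           to_fract ` (invariants H :: ('k, 'n, 'd) mat_poly set)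
             = root_closure_in_quotient_field p (polarized_algebra \<sigma> (invariants H)))"
proof -
  interpret polarization H \<sigma> by unfold_locales (rule assms(3))
  have roots: "if p = 0 then R = S else \<forall>F\<in>S. \<exists>m. F ^ (p ^ m) \<in> R"
  proof (cases "p = 0")
    case True
    then show ?thesis using S_subset_R_char_0 R_subset_S assms(1) by auto
  next
    case False
    then have "prime p" using prime_CHAR_semidom[where 'a = 'k] assms(1) by simp
    then interpret polarization_char_p H \<sigma> p by unfold_locales (use assms(1) in auto)
    show ?thesis using False S_subset_Rp unfolding Rp_def by auto
  qed
  then have 1: "contained_in_root_closure p S R"
    unfolding contained_in_root_closure_def using R_subset_S by blast
  have 2: "to_fract ` S = root_closure_in_quotient_field p R" if SL: "H \<subseteq> SL"
  proof (cases "p = 0")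
    case True
    then show ?thesis using roots by (simp add: root_closure_in_quotient_field_def)
  next
    case False
    then have prime: "prime p" using prime_CHAR_semidom[where 'a = 'k] assms(1) by simp
    have "to_fract F \<in> quotient_field R" if F: "F \<in> S" for F
    proof -
      obtain d where d: "d \<in> R" "d \<noteq> 0" "d * F \<in> R" using S_denominator[OF SL F] by blast
      have "to_fract F = Fraction_Field.Fract (d * F) d"
        using d(2) by (simp add: to_fract_def eq_fract ac_simps)
      then show ?thesis unfolding quotient_field_def using d by blast
    qed
    moreover have "\<exists>m. to_fract F ^ (p ^ m) \<in> to_fract ` R" if "F \<in> S" for F
    proof -
      obtain m where "F ^ (p ^ m) \<in> R" using \<open>F \<in> S\<close> roots False by auto
      then have "to_fract (F ^ (p ^ m)) \<in> to_fract ` R" by (rule imageI)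
      then show ?thesis unfolding to_fract_power by blast
    qed
    \<comment> \<open>If a p-power of a / b is polynomial, b divides a by
      \<open>root_divides\<close>, and the quotient of the invariants a and b is invariant.\<close>
    moreover have "z \<in> to_fract ` S" if z: "z \<in> quotient_field R" and m: "z ^ (p ^ m) \<in> to_fract ` R" for z m
    proof -
      obtain a b where ab: "z = Fraction_Field.Fract a b" "a \<in> R" "b \<in> R" "b \<noteq> 0"
        using z unfolding quotient_field_def by blast
      obtain r where r: "z ^ (p ^ m) = to_fract r" using m by blast
      have "z * to_fract b = to_fract a" using ab(4) by (simp add: ab(1) to_fract_def eq_fract)
      then have "to_fract (a ^ (p ^ m)) = (z * to_fract b) ^ (p ^ m)" by (simp add: to_fract_power)
      also have "\<dots> = to_fract (b ^ (p ^ m) * r)"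
        by (simp add: power_mult_distrib r to_fract_power ac_simps)
      finally have "a ^ (p ^ m) = b ^ (p ^ m) * r" by (simp only: to_fract_eq_iff)
      then obtain c where c: "a = b * c" using root_divides[OF assms(1) prime _ ab(4)] by blast
      have "c \<in> S" using S_quotient[of b c] ab R_subset_S unfolding c by blast
      moreover have "z = to_fract c" using ab(4) unfolding ab(1) c by (simp add: to_fract_def eq_fract ac_simps)
      ultimately show ?thesis by blast
    qed
    ultimately show ?thesis unfolding root_closure_in_quotient_field_def if_not_P[OF False] by blast
  qed
  show ?thesis using 1 2 unfolding S_def R_def by blast
qed

end
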